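(* Let $\Omega\subset\mathbb{R}^N$ be a bounded smooth domain and $p_1,p_2\in C_+(\overline{\Omega})$. Let $f\in L^{\alpha(x)}(\Omega)$ where $\alpha\in C_+(\overline{\Omega})$ satisfies $\frac{1}{\alpha(x)}+\frac{1}{p_M^*(x)}<1$ for all $x\in\overline{\Omega}$. Then the problem $$-\mathrm{div}(|\nabla u|^{p_1(x)-2}\nabla u)-\mathrm{div}(|\nabla u|^{p_2(x)-2}\nabla u)=f(x)\ \text{in }\Omega,\qquad u=0\ \text{on }\partial\Omega$$ has a unique weak solution.
   Context: $C_+(\overline{\Omega})=\{h\in C(\overline{\Omega}):h(x)>1\ \forall x\in\overline{\Omega}\}$. $p_M(x)=\max\{p_1(x),p_2(x)\}$, and for $p\in C_+(\overline\Omega)$, $p^*(x)=\frac{Np(x)}{N-p(x)}$ if $p(x)<N$ and $p^*(x)=\infty$ if $p(x)\ge N$. Variable exponent spaces: $L^{p(x)}(\Omega)$ is the space of measurable $u$ with $\int_\Omega|u|^{p(x)}dx<\infty$ with Luxemburg norm $|u|_{p(x)}=\inf\{\lambda>0:\int_\Omega|u/\lambda|^{p(x)}dx\le1\}$; $W^{1,p(x)}(\Omega)=\{u\in L^{p(x)}:|\nabla u|\in L^{p(x)}\}$ with norm $|u|_{p(x)}+|\nabla u|_{p(x)}$; $W_0^{1,p(x)}(\Omega)$ is the closure of $C_0^\infty(\Omega)$ in it. $X:=W_0^{1,p_1(x)}(\Omega)\cap W_0^{1,p_2(x)}(\Omega)$. A weak solution is $u\in X$ with $\int_\Omega|\nabla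 u|^{p_1(x)-2}\nabla u\cdot\nabla v\,dx+\int_\Omega|\nabla u|^{p_2(x)-2}\nabla u\cdot\nabla v\,dx=\int_\Omega f v\,dx$ for all $v\in X$. *)

theory Defs
  imports "HOL-Analysis.Analysis"
begin

fun Ck_on :: "nat \<Rightarrow> 'a::euclidean_space set \<Rightarrow> ('a \<Rightarrow> real) \<Rightarrow> bool" where
  "Ck_on 0 S f = continuous_on S f"
| "Ck_on (Suc k) S f =
     (\<exists>D. (\<forall>x\<in>S. (f has_derivative D x) (at x)) \<and> (\<forall>b\<in>Basis. Ck_on k S (\<lambda>x. D x b)))"

definition smooth_on :: "'a::euclidean_space set \<Rightarrow> ('a \<Rightarrow> real) \<Rightarrow> bool" where
  "smooth_on S f \<longleftrightarrow> (\<forall>k. Ck_on k S f)"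

definition smooth_bounded_domain :: "'a::euclidean_space set \<Rightarrow> bool" where
  "smooth_bounded_domain \<Omega> \<longleftrightarrow> open \<Omega> \<and> connected \<Omega> \<and> bounded \<Omega> \<and> \<Omega> \<noteq> {} \<and>
     (\<forall>x\<in>frontier \<Omega>. \<exists>r>0. \<exists>\<phi>. smooth_on UNIV \<phi> \<and>
        (\<forall>y\<in>ball x r. frechet_derivative \<phi> (at y) \<noteq> (\<lambda>_. 0)) \<and>
        \<Omega> \<inter> ball x r = {y\<in>ball x r. \<phi> y < 0})"

definition test_fun :: "'a::euclidean_space set \<Rightarrow> ('a \<Rightarrow> real) \<Rightarrow> bool" where
  "test_fun \<Omega> \<phi> \<longleftrightarrow> smooth_on UNIV \<phi> \<and> compact (closure {x. \<phi> x \<noteq> 0}) \<and>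
      closure {x. \<phi> x \<noteq> 0} \<subseteq> \<Omega>"

definition grad :: "('a::euclidean_space \<Rightarrow> real) \<Rightarrow> 'a \<Rightarrow> 'a" where
  "grad \<phi> x = (\<Sum>b\<in>Basis. frechet_derivative \<phi> (at x) b *\<^sub>R b)"

definition C_plus :: "'a::euclidean_space set \<Rightarrow> ('a \<Rightarrow> real) \<Rightarrow> bool" where
  "C_plus \<Omega> h \<longleftrightarrow> continuous_on (closure \<Omega>) h \<and> (\<forall>x\<in>closure \<Omega>. h x > 1)"

definition crit_exp :: "('a::euclidean_space \<Rightarrow> real) \<Rightarrow> 'a \<Rightarrow> ereal" where
  "crit_exp p x = (if p x < real DIM('a)
      then ereal (real DIM('a) * p x / (real DIM('a) - p x)) else \<infinity>)"

definition modular :: "'a::euclidean_space set \<Rightarrow> ('a \<Rightarrow> real) \<Rightarrow> ('a \<Rightarrow> real) \<Rightarrow> ennreal" where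
  "modular \<Omega> p u = (\<integral>\<^sup>+ x. ennreal (\<bar>u x\<bar> powr p x) \<partial>lebesgue_on \<Omega>)"

definition Lp_var :: "'a::euclidean_space set \<Rightarrow> ('a \<Rightarrow> real) \<Rightarrow> ('a \<Rightarrow> real) set" where
  "Lp_var \<Omega> p = {u. u \<in> borel_measurable (lebesgue_on \<Omega>) \<and> modular \<Omega> p u < \<infinity>}"

definition lux_norm :: "'a::euclidean_space set \<Rightarrow> ('a \<Rightarrow> real) \<Rightarrow> ('a \<Rightarrow> real) \<Rightarrow> real" where
  "lux_norm \<Omega> p u = Inf {t::real. t > 0 \<and> modular \<Omega> p (\<lambda>x. u x / t) \<le> 1}"

definition weak_grad :: "'a::euclidean_space set \<Rightarrow> ('a \<Rightarrow> real) \<Rightarrow> ('a \<Rightarrow> 'a) \<Rightarrow> bool" where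
  "weak_grad \<Omega> u g \<longleftrightarrow> u \<in> borel_measurable (lebesgue_on \<Omega>) \<and>
     g \<in> borel_measurable (lebesgue_on \<Omega>) \<and>
     (\<forall>\<phi> i. test_fun \<Omega> \<phi> \<and> i \<in> Basis \<longrightarrow>
        integrable (lebesgue_on \<Omega>) (\<lambda>x. u x * frechet_derivative \<phi> (at x) i) \<and>
        integrable (lebesgue_on \<Omega>) (\<lambda>x. (g x \<bullet> i) * \<phi> x) \<and>
        (\<integral>x. u x * frechet_derivative \<phi> (at x) i \<partial>lebesgue_on \<Omega>) =
          - (\<integral>x. (g x \<bullet> i) * \<phi> x \<partial>lebesgue_on \<Omega>))"

definition W0_grad :: "'a::euclidean_space set \<Rightarrow> ('a \<Rightarrow> real) \<Rightarrow> ('a \<Rightarrow> real) \<Rightarrow> ('a \<Rightarrow> 'a) \<Rightarrow> bool" where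
  "W0_grad \<Omega> p u g \<longleftrightarrow> weak_grad \<Omega> u g \<and> u \<in> Lp_var \<Omega> p \<and> (\<lambda>x. norm (g x)) \<in> Lp_var \<Omega> p \<and>
     (\<exists>\<phi>::nat \<Rightarrow> 'a \<Rightarrow> real. (\<forall>k. test_fun \<Omega> (\<phi> k)) \<and>
        (\<lambda>k. lux_norm \<Omega> p (\<lambda>x. \<phi> k x - u x) + lux_norm \<Omega> p (\<lambda>x. norm (grad (\<phi> k) x - g x)))
          \<longlonglongrightarrow> 0)"

definition W0 :: "'a::euclidean_space set \<Rightarrow> ('a \<Rightarrow> real) \<Rightarrow> ('a \<Rightarrow> real) set" where
  "W0 \<Omega> p = {u. \<exists>g. W0_grad \<Omega> p u g}"

text \<open>X = W_0^{1,p1} \<inter> W_0^{1,p2}; weak solution of the (p1,p2)-Laplacian problem.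
  Weak gradients are a.e. unique, so quantifying over all weak gradients of the test
  function v is harmless.\<close>
definition weak_solution ::
  "'a::euclidean_space set \<Rightarrow> ('a \<Rightarrow> real) \<Rightarrow> ('a \<Rightarrow> real) \<Rightarrow> ('a \<Rightarrow> real) \<Rightarrow> ('a \<Rightarrow> real) \<Rightarrow> bool" where
  "weak_solution \<Omega> p1 p2 f u \<longleftrightarrow> u \<in> W0 \<Omega> p1 \<and> u \<in> W0 \<Omega> p2 \<and>
     (\<exists>g. weak_grad \<Omega> u g \<and>
       (\<forall>v h. v \<in> W0 \<Omega> p1 \<and> v \<in> W0 \<Omega> p2 \<and> weak_grad \<Omega> v h \<longrightarrow>
          (\<integral>x. norm (g x) powr (p1 x - 2) * (g x \<bullet> h x) \<partial>lebesgue_on \<Omega>) +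
          (\<integral>x. norm (g x) powr (p2 x - 2) * (g x \<bullet> h x) \<partial>lebesgue_on \<Omega>) =
          (\<integral>x. f x * v x \<partial>lebesgue_on \<Omega>)))"

end

theory Submission
  imports Defs
begin

text \<open>
  The solution is the minimizer of the energy
  \<open>\<integral> |\<nabla>u|^p1 / p1 + |\<nabla>u|^p2 / p2 - \<integral> f u\<close> over the intersection \<open>X\<close> of the two
  spaces. Every element of \<open>X\<close> is a limit in \<open>W^(1,1)\<close> of test functions, hence satisfies
  \<open>|u(x)| \<le> C \<integral> |\<nabla>u(y)| |x - y|^(1-N) dy\<close> almost everywhere. Combined with a trilinear Young
  inequality for \<open>\<integral>\<integral> h(x) g(y) |x - y|^(1-N)\<close>, in which the exponents may vary because only nearly
  constant values matter near the diagonal, this yields both the Poincare inequality and the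
  boundedness of \<open>u \<mapsto> \<integral> f u\<close>, without the density of test functions in \<open>X\<close> and without cut-offs.
  Uniform convexity makes minimizing sequences Cauchy, so no weak compactness is needed.
  Uniqueness follows from the strict monotonicity of \<open>\<xi> \<mapsto> |\<xi>|^(p-2) \<xi>\<close>.
\<close>

subsection \<open>Smooth bump functions and the fundamental lemma\<close>

text \<open>The exponents are merely continuous, so neither a Sobolev embedding with the exponent
  p_M^* nor a common approximating sequence for p1 and p2 is at hand. The potential estimate needs
  an approximation for one exponent only; the gradient may then enter with exponent p_M. The
  hypothesis on \<alpha> fits this route: where p_M < N it reads 1/\<alpha> + 1/p_M < 1 + 1/N, and
  |x - y|^(1-N) lies in L^S for S < N/(N-1), so there is room for 1/\<alpha> + 1/p_M + 1/S <= 2, the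
  exponent condition of the trilinear bound. Its strictness pays for the oscillation of the
  exponents near the diagonal. Arguing with modulars instead of norms makes the bounds
  inhomogeneous, of the form C (1 + modular). Homogeneity is recovered by rescaling: an estimate is
  applied to u/s or t u with s or t large, and the bounds on the exponents make the remainder small.
  Poincare inequality, coercivity and continuity of the load all follow this pattern.\<close>

lemma Ck_on_Suc_imp_Ck_on: "Ck_on (Suc k) S f \<Longrightarrow> Ck_on k S f"
proof (induction k arbitrary: f)
  case 0
  then obtain D where "\<And>x. x \<in> S \<Longrightarrow> (f has_derivative D x) (at x)" by auto
  then have "continuous_on S f"
    by (meson continuous_at_imp_continuous_on has_derivative_continuous)
  then show ?case by simp
next
  case (Suc k)
  from Suc.prems obtain D where "\<forall>x\<in>S. (f has_derivative D x) (at x)"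
    and "\<forall>b\<in>Basis. Ck_on (Suc k) S (\<lambda>x. D x b)"
    by (subst (asm) Ck_on.simps(2)) blast
  with Suc.IH show ?case by auto
qed

lemma Ck_on_const: "Ck_on k S (\<lambda>_. c)"
proof (induction k arbitrary: c)
  case (Suc k)
  then show ?case by (auto intro!: exI[where x="\<lambda>_ _. 0"])
qed simp

lemma Ck_on_add: "Ck_on k S f \<Longrightarrow> Ck_on k S g \<Longrightarrow> Ck_on k S (\<lambda>x. f x + g x)"
proof (induction k arbitrary: f g)
  case (Suc k)
  then obtain D E where "\<forall>x\<in>S. (f has_derivative D x) (at x)" "\<forall>b\<in>Basis. Ck_on k S (\<lambda>x. D x b)"
    "\<forall>x\<in>S. (g has_derivative E x) (at x)" "\<forall>b\<in>Basis. Ck_on k S (\<lambda>x. E x b)" by auto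
  then show ?case
    by (auto intro!: exI[where x="\<lambda>x h. D x h + E x h"] Suc.IH has_derivative_add)
qed (auto intro: continuous_intros)

lemma Ck_on_mult: "Ck_on k S f \<Longrightarrow> Ck_on k S g \<Longrightarrow> Ck_on k S (\<lambda>x. f x * g x)"
proof (induction k arbitrary: f g)
  case (Suc k)
  from Suc.prems obtain D E where *: "\<forall>x\<in>S. (f has_derivative D x) (at x)" "\<forall>b\<in>Basis. Ck_on k S (\<lambda>x. D x b)"
    "\<forall>x\<in>S. (g has_derivative E x) (at x)" "\<forall>b\<in>Basis. Ck_on k S (\<lambda>x. E x b)" by auto
  have "\<forall>x\<in>S. ((\<lambda>x. f x * g x) has_derivative (\<lambda>h. f x * E x h + D x h * g x)) (at x)"
    using * by (auto intro!: has_derivative_mult)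
  \<comment> \<open>The product rule pairs a derivative with an undifferentiated factor, so f and g
    themselves are needed at order k.\<close>
  moreover have "\<forall>b\<in>Basis. Ck_on k S (\<lambda>x. f x * E x b + D x b * g x)"
    using * Suc.prems[THEN Ck_on_Suc_imp_Ck_on] by (auto intro!: Ck_on_add Suc.IH)
  ultimately show ?case by auto
qed (auto intro: continuous_intros)

lemma Ck_on_prod: "(\<And>i. i \<in> I \<Longrightarrow> Ck_on k S (f i)) \<Longrightarrow> Ck_on k S (\<lambda>x. \<Prod>i\<in>I. f i x)"
  by (induction I rule: infinite_finite_induct) (auto intro: Ck_on_const Ck_on_mult)

lemma smooth_on_has_derivative:
  assumes "smooth_on UNIV \<phi>"
  shows "(\<phi> has_derivative frechet_derivative \<phi> (at x)) (at x)"
proof -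
  have "Ck_on (Suc 0) UNIV \<phi>" using assms unfolding smooth_on_def by blast
  then show ?thesis
    by (auto simp: differentiable_def simp flip: frechet_derivative_works)
qed

lemma smooth_on_continuous_frechet_derivative:
  assumes "smooth_on UNIV \<phi>" "b \<in> Basis"
  shows "continuous_on UNIV (\<lambda>x. frechet_derivative \<phi> (at x) b)"
proof -
  have "Ck_on (Suc 0) UNIV \<phi>" using assms unfolding smooth_on_def by blast
  then obtain D where D: "\<And>x. (\<phi> has_derivative D x) (at x)" "continuous_on UNIV (\<lambda>x. D x b)"
    using assms(2) by auto
  then have "D x = frechet_derivative \<phi> (at x)" for x
    using frechet_derivative_at by blast
  with D show ?thesis by simp
qed

lemma smooth_on_continuous: "smooth_on UNIV \<phi> \<Longrightarrow> continuous_on UNIV \<phi>"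
  unfolding smooth_on_def by (metis Ck_on.simps(1))

text \<open>The derivatives of \<open>exp (- 1 / t)\<close>, extended by zero, are linear combinations of these.\<close>

definition flat :: "nat \<Rightarrow> real \<Rightarrow> real" where
  "flat n t = (if t > 0 then (1 / t) ^ n * exp (- (1 / t)) else 0)"

text \<open>With s = 1/t this is s^n exp(-s) -> 0 for s -> infinity. It supplies the one-sided
  difference quotient of \<open>flat\<close> at the origin.\<close>

lemma flat_tendsto_0: "(flat n \<longlongrightarrow> 0) (at_right 0)"
proof -
  have "((\<lambda>t. (inverse t) ^ n / exp (inverse t)) \<longlongrightarrow> (0::real)) (at_right 0)"
    using tendsto_power_div_exp_0[of n] filterlim_inverse_at_top_right
    by (rule filterlim_compose)
  then show ?thesis
    by (rule Lim_transform_eventually)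
      (auto simp: flat_def eventually_at_filter exp_minus divide_inverse)
qed

text \<open>The derivative stays in the span of the family, so smoothness follows by induction on
  the order, for all n at once.\<close>

lemma flat_has_real_derivative:
  "(flat n has_real_derivative - real n * flat (Suc n) t + flat (n + 2) t) (at t)"
proof -
  consider "t < 0" | "t > 0" | "t = 0" by linarith
  then show ?thesis
  proof cases
    case 1
    have "(flat n has_real_derivative 0) (at t)"
      by (rule has_field_derivative_transform_within_open[where S="{..<0}" and f="\<lambda>_. 0"])
        (use 1 in \<open>auto simp: flat_def\<close>)
    with 1 show ?thesis by (simp add: flat_def)
  next
    case 2
    have "((\<lambda>t. (inverse t)^n * exp (- inverse t)) has_real_derivative
        real n * (inverse t ^ (n - 1) * - (inverse t * inverse t)) * exp (- inverse t)
        + (inverse t)^n * (exp (- inverse t) * (inverse t * inverse t))) (at t)"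
      using 2 by (auto intro!: derivative_eq_intros simp: algebra_simps)
    also have "real n * (inverse t ^ (n - 1) * - (inverse t * inverse t)) = - real n * inverse t ^ Suc n"
      by (cases n) (auto simp: algebra_simps)
    finally have "((\<lambda>t. (1/t)^n * exp (- (1/t))) has_real_derivative
        - real n * flat (Suc n) t + flat (n + 2) t) (at t)"
      using 2 by (simp add: flat_def algebra_simps inverse_eq_divide)
    then show ?thesis
      by (rule has_field_derivative_transform_within_open[where S="{0<..}"])
        (use 2 in \<open>auto simp: flat_def\<close>)
  next
    case 3
    have "((\<lambda>h. (flat n (0 + h) - flat n 0) / h) \<longlongrightarrow> 0) (at 0)"
    proof (rule filterlim_split_at)
      have "\<forall>\<^sub>F h in at_left 0. 0 = (flat n (0 + h) - flat n 0) / h"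
        by (auto simp: flat_def eventually_at_filter)
      then show "((\<lambda>h. (flat n (0 + h) - flat n 0) / h) \<longlongrightarrow> 0) (at_left 0)"
        by (rule Lim_transform_eventually[OF tendsto_const])
      \<comment> \<open>Dividing \<open>flat n\<close> by its positive argument gives
        \<open>flat (Suc n)\<close>.\<close>
      show "((\<lambda>h. (flat n (0 + h) - flat n 0) / h) \<longlongrightarrow> 0) (at_right 0)"
        by (rule Lim_transform_eventually[OF flat_tendsto_0[of "Suc n"]])
          (auto simp: flat_def eventually_at_filter)
    qed
    then show ?thesis using 3 by (simp add: DERIV_def flat_def)
  qed
qed

text \<open>The affine argument is part of the statement because the derivative then keeps the same
  shape, and no chain rule for \<open>Ck_on\<close> is required.\<close>

lemma Ck_on_flat: "Ck_on k UNIV (\<lambda>x::'a::euclidean_space. flat n (c * (x \<bullet> i) + d))"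
proof (induction k arbitrary: n)
  case 0
  have "continuous_on UNIV (flat n)"
    by (meson DERIV_continuous continuous_at_imp_continuous_on flat_has_real_derivative)
  then show ?case
    by (auto intro!: continuous_on_compose2[where f="\<lambda>x. c * (x \<bullet> i) + d" and g="flat n"] continuous_intros)
next
  case (Suc k)
  let ?f = "\<lambda>x. - real n * flat (Suc n) (c * (x \<bullet> i) + d) + flat (n + 2) (c * (x \<bullet> i) + d)"
  have "((\<lambda>x. flat n (c * (x \<bullet> i) + d)) has_derivative (\<lambda>h. c * (h \<bullet> i) * ?f x)) (at x)" for x
    by (rule has_derivative_eq_rhs, rule DERIV_compose_FDERIV[OF flat_has_real_derivative])
      (auto intro!: derivative_eq_intros)
  moreover have "Ck_on k UNIV (\<lambda>x. c * (b \<bullet> i) * ?f x)" for b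
    by (intro Ck_on_mult Ck_on_const Ck_on_add Suc.IH)
  ultimately show ?case
    by (auto intro!: exI[where x="\<lambda>x h. c * (h \<bullet> i) * ?f x"])
qed

text \<open>The parameter c is a sharpness: as it grows, the bump increases to the indicator of the
  open box.\<close>

definition box_bump :: "real \<Rightarrow> 'a::euclidean_space \<Rightarrow> 'a \<Rightarrow> 'a \<Rightarrow> real" where
  "box_bump c a b x = (\<Prod>i\<in>Basis. flat 0 (c * (x \<bullet> i - a \<bullet> i)) * flat 0 (c * (b \<bullet> i - x \<bullet> i)))"

lemma smooth_on_box_bump: "smooth_on UNIV (box_bump c a b)"
proof -
  have "Ck_on k UNIV (\<lambda>x. flat 0 (c * (x \<bullet> i) + (- c * (a \<bullet> i))) * flat 0 ((- c) * (x \<bullet> i) + c * (b \<bullet> i)))" for k i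
    by (intro Ck_on_mult Ck_on_flat)
  then show ?thesis unfolding smooth_on_def box_bump_def[abs_def]
    by (auto intro!: Ck_on_prod simp: algebra_simps)
qed

lemma flat_0_bounds: "0 \<le> flat 0 t" "flat 0 t \<le> 1"
  by (auto simp: flat_def)

lemma box_bump_bounds: "0 \<le> box_bump c a b x" "box_bump c a b x \<le> 1"
  unfolding box_bump_def
  by (auto intro!: prod_nonneg prod_le_1 mult_nonneg_nonneg mult_le_one simp: flat_0_bounds)

lemma box_bump_eq_0: "c > 0 \<Longrightarrow> x \<notin> box a b \<Longrightarrow> box_bump c a b x = 0"
  by (auto simp: box_bump_def mem_box flat_def not_less zero_less_mult_iff intro!: bexI)

lemma box_bump_pos: "c > 0 \<Longrightarrow> x \<in> box a b \<Longrightarrow> box_bump c a b x > 0"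
  by (auto simp: box_bump_def mem_box flat_def intro!: prod_pos)

lemma flat_0_tendsto_1:
  assumes "t > 0" shows "(\<lambda>n. flat 0 (real (Suc n) * t)) \<longlonglongrightarrow> 1"
proof -
  have "(\<lambda>n. exp (- ((1 / t) * inverse (real (Suc n))))) \<longlonglongrightarrow> exp (- ((1/t) * 0))"
    by (intro tendsto_intros LIMSEQ_inverse_real_of_nat)
  with assms show ?thesis by (simp add: flat_def field_simps del: of_nat_Suc)
qed

lemma box_bump_tendsto_indicator:
  "(\<lambda>n. box_bump (real (Suc n)) a b x) \<longlonglongrightarrow> indicator (box a b) x"
proof (cases "x \<in> box a b")
  case True
  then have "(\<lambda>n. box_bump (real (Suc n)) a b x) \<longlonglongrightarrow> (\<Prod>i\<in>(Basis::'a set). 1 * 1)"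
    unfolding box_bump_def by (intro tendsto_intros flat_0_tendsto_1) (auto simp: mem_box)
  with True show ?thesis by simp
next
  case False
  then have "box_bump (real (Suc n)) a b x = 0" for n
    by (intro box_bump_eq_0) auto
  with False show ?thesis by simp
qed

text \<open>The bump supplies the compact support, so the other factor may be any smooth function:
  the constant 1, or a second bump on an arbitrary box.\<close>

lemma test_fun_box_bump_mult:
  assumes "smooth_on UNIV \<phi>" "c > 0" "cbox a b \<subseteq> \<Omega>"
  shows "test_fun \<Omega> (\<lambda>x. box_bump c a b x * \<phi> x)"
proof -
  have "{x. box_bump c a b x * \<phi> x \<noteq> 0} \<subseteq> cbox a b"
    using box_bump_eq_0[OF assms(2)] box_subset_cbox by fastforce
  then have "closure {x. box_bump c a b x * \<phi> x \<noteq> 0} \<subseteq> cbox a b"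
    by (intro closure_minimal closed_cbox)
  moreover have "smooth_on UNIV (\<lambda>x. box_bump c a b x * \<phi> x)"
    using assms(1) smooth_on_box_bump[of c a b] by (auto simp: smooth_on_def intro: Ck_on_mult)
  ultimately show ?thesis
    using assms(3) unfolding test_fun_def
    by (meson bounded_cbox bounded_subset closed_closure compact_eq_bounded_closed subset_trans)
qed

text \<open>Lebesgue differentiation along the cubes with corner x: the averages vanish, and for
  almost every x they converge to w x.\<close>

lemma AE_eq_0_of_box_integrals:
  fixes w :: "'a::euclidean_space \<Rightarrow> real"
  assumes "integrable lebesgue w" "\<And>c d. (\<integral>x. indicator (box c d) x * w x \<partial>lebesgue) = 0"
  shows "AE x in lebesgue. w x = 0"
proof -
  have w: "w absolutely_integrable_on S" if "S \<in> sets lebesgue" for S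
    using integrable_mult_indicator[OF that assms(1)] by (simp add: set_integrable_def)
  have int0: "integral (cbox c d) w = 0" for c d
  proof -
    have "integral (cbox c d) w = integral (box c d) w"
      by (metis integral_open_interval)
    also have "\<dots> = (\<integral>x. indicator (box c d) x * w x \<partial>lebesgue)"
      using set_lebesgue_integral_eq_integral(2)[OF w[of "box c d"]]
      by (simp add: set_lebesgue_integral_def)
    finally show ?thesis using assms(2) by simp
  qed
  obtain N where "negligible N" and N: "\<And>x e. \<lbrakk>x \<notin> N; 0 < e\<rbrakk> \<Longrightarrow> \<exists>d>0. \<forall>h. 0 < h \<and> h < d \<longrightarrow>
      norm (integral (cbox x (x + h *\<^sub>R One)) w /\<^sub>R h ^ DIM('a) - w x) < e"
    by (rule integrable_ccontinuous_explicit[of w])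
      (use w in \<open>auto simp: set_lebesgue_integral_eq_integral(1)\<close>)
  have "w x = 0" if xN: "x \<notin> N" for x
  proof (rule ccontr)
    assume "w x \<noteq> 0"
    then have pos: "norm (w x) > 0" by simp
    obtain d where d: "d > 0" "\<forall>h. 0 < h \<and> h < d \<longrightarrow>
        norm (integral (cbox x (x + h *\<^sub>R One)) w /\<^sub>R h ^ DIM('a) - w x) < norm (w x)"
      using N[OF xN pos] by (elim exE conjE)
    \<comment> \<open>With vanishing averages the bound reads norm (w x) < norm (w x).\<close>
    from d(2)[rule_format, of "d / 2"] d(1) show False by (simp add: int0)
  qed
  then have "{x. w x \<noteq> 0} \<subseteq> N" by blast
  with \<open>negligible N\<close> show ?thesis
    by (intro AE_I'[of N]) (auto simp: negligible_iff_null_sets)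
qed

text \<open>Only products of w with test functions are known to be integrable, so w is first
  multiplied by a fixed bump. Sharper and sharper second bumps turn vanishing test integrals into
  vanishing box integrals.\<close>

lemma fundamental_lemma_calculus_variations:
  fixes w :: "'a::euclidean_space \<Rightarrow> real"
  assumes \<Omega>: "open \<Omega>"
    and int: "\<And>\<phi>. test_fun \<Omega> \<phi> \<Longrightarrow> integrable (lebesgue_on \<Omega>) (\<lambda>x. w x * \<phi> x)"
    and zero: "\<And>\<phi>. test_fun \<Omega> \<phi> \<Longrightarrow> (\<integral>x. w x * \<phi> x \<partial>lebesgue_on \<Omega>) = 0"
  shows "AE x in lebesgue_on \<Omega>. w x = 0"
proof -
  have \<Omega>S: "\<Omega> \<in> sets lebesgue" using \<Omega> by auto
  have local_AE: "AE x in lebesgue. x \<in> box a b \<longrightarrow> w x = 0" if ab: "cbox a b \<subseteq> \<Omega>" for a b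
  proof -
    define v where "v x = indicator \<Omega> x * (w x * box_bump 1 a b x)" for x
    have bump: "test_fun \<Omega> (\<lambda>x. box_bump 1 a b x * \<phi> x)" if "smooth_on UNIV \<phi>" for \<phi>
      using test_fun_box_bump_mult[OF that _ ab, of 1] by simp
    have one: "smooth_on UNIV (\<lambda>_. 1)" by (simp add: smooth_on_def Ck_on_const)
    have v: "integrable lebesgue v"
      using int[OF bump[OF one]] \<Omega>S by (simp add: integrable_restrict_space v_def[abs_def] mult.assoc)
    have "AE x in lebesgue. v x = 0"
    proof (rule AE_eq_0_of_box_integrals[OF v])
      fix c d :: 'a
      have "(\<integral>x. box_bump (real (Suc n)) c d x * v x \<partial>lebesgue) = 0" for n
        using zero[OF bump[OF smooth_on_box_bump], of "real (Suc n)" c d] \<Omega>S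
        by (simp add: integral_restrict_space v_def mult_ac del: of_nat_Suc)
      moreover have "(\<lambda>n. \<integral>x. box_bump (real (Suc n)) c d x * v x \<partial>lebesgue)
          \<longlonglongrightarrow> (\<integral>x. indicator (box c d) x * v x \<partial>lebesgue)"
      proof (rule integral_dominated_convergence[where w="\<lambda>x. norm (v x)"])
        show "(\<lambda>x. indicator (box c d) x * v x) \<in> borel_measurable lebesgue"
          using v by (intro borel_measurable_times borel_measurable_indicator borel_measurable_integrable) auto
        show "(\<lambda>x. box_bump (real (Suc n)) c d x * v x) \<in> borel_measurable lebesgue" for n
        proof -
          have "box_bump (real (Suc n)) c d \<in> borel_measurable lebesgue"
            using smooth_on_continuous[OF smooth_on_box_bump, of "real (Suc n)" c d]
            by (intro measurable_completion) (simp add: borel_measurable_continuous_onI del: of_nat_Suc)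
          then show ?thesis using borel_measurable_integrable[OF v] by (rule borel_measurable_times)
        qed
        show "AE x in lebesgue. (\<lambda>n. box_bump (real (Suc n)) c d x * v x) \<longlonglongrightarrow> indicator (box c d) x * v x"
          by (intro AE_I2 tendsto_intros box_bump_tendsto_indicator)
        show "AE x in lebesgue. norm (box_bump (real (Suc n)) c d x * v x) \<le> norm (v x)" for n
          using box_bump_bounds[of "real (Suc n)" c d]
          by (intro AE_I2) (auto simp: abs_mult intro!: mult_left_le_one_le)
      qed (use v in auto)
      ultimately show "(\<integral>x. indicator (box c d) x * v x \<partial>lebesgue) = 0"
        by (simp add: LIMSEQ_const_iff)
    qed
    then show ?thesis
    proof eventually_elim
      case (elim x)
      show ?case
      proof
        assume x: "x \<in> box a b"
        then have "x \<in> \<Omega>" using ab box_subset_cbox[of a b] by blast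
        with elim box_bump_pos[OF _ x, of 1] show "w x = 0" by (simp add: v_def)
      qed
    qed
  qed
  define \<B> where "\<B> = {box a b | a b. cbox a b \<subseteq> \<Omega>}"
  have cover: "x \<in> \<Union>\<B>" if "x \<in> \<Omega>" for x
  proof -
    obtain e where e: "e > 0" "ball x e \<subseteq> \<Omega>" using \<Omega> \<open>x \<in> \<Omega>\<close> openE by blast
    obtain a b where ab: "x \<in> box a b" "box a b \<subseteq> ball x (e / 2)"
      using rational_boxes[of "e / 2" x] e by auto
    have "cbox a b = closure (box a b)" using ab closure_box[of a b] by fast
    also have "\<dots> \<subseteq> cball x (e / 2)"
      using ab ball_subset_cball by (metis closed_cball closure_minimal order_trans)
    also have "\<dots> \<subseteq> \<Omega>" using e by (auto simp: subset_iff)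
    finally show ?thesis using ab by (auto simp: \<B>_def)
  qed
  \<comment> \<open>A countable subcover keeps the union of the exceptional null sets a null
    set.\<close>
  obtain \<C> where \<C>: "\<C> \<subseteq> \<B>" "countable \<C>" "\<Union>\<C> = \<Union>\<B>"
    by (rule Lindelof[of \<B>]) (auto simp: \<B>_def open_box)
  have "AE x in lebesgue. \<forall>B\<in>\<C>. x \<in> B \<longrightarrow> w x = 0"
    using \<C> local_AE by (subst AE_ball_countable) (auto simp: \<B>_def)
  then have "AE x in lebesgue. x \<in> \<Omega> \<longrightarrow> w x = 0"
    by eventually_elim (use cover \<C> in blast)
  then show ?thesis using \<Omega>S by (simp add: AE_restrict_space_iff)
qed

subsection \<open>Test functions\<close>

lemma inner_grad:
  assumes "i \<in> Basis" shows "grad \<phi> x \<bullet> i = frechet_derivative \<phi> (at x) i"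
  using assms by (simp add: grad_def inner_sum_left inner_Basis if_distrib cong: if_cong)

lemma frechet_derivative_eq_inner_grad:
  assumes "smooth_on UNIV \<phi>"
  shows "frechet_derivative \<phi> (at x) h = grad \<phi> x \<bullet> h"
proof -
  interpret D: bounded_linear "frechet_derivative \<phi> (at x)"
    using smooth_on_has_derivative[OF assms] by (rule has_derivative_bounded_linear)
  have "frechet_derivative \<phi> (at x) h = frechet_derivative \<phi> (at x) (\<Sum>b\<in>Basis. (h \<bullet> b) *\<^sub>R b)"
    by (simp add: euclidean_representation)
  also have "\<dots> = (\<Sum>b\<in>Basis. (h \<bullet> b) * frechet_derivative \<phi> (at x) b)"
    by (simp add: D.sum D.scaleR)
  also have "\<dots> = grad \<phi> x \<bullet> h"
    by (simp add: grad_def inner_sum_left inner_commute[of h] mult.commute)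
  finally show ?thesis .
qed

lemma smooth_on_continuous_grad: "smooth_on UNIV \<phi> \<Longrightarrow> continuous_on UNIV (grad \<phi>)"
  unfolding grad_def[abs_def]
  by (intro continuous_intros smooth_on_continuous_frechet_derivative)

lemma test_fun_grad_eq_0:
  assumes "test_fun \<Omega> \<phi>" "x \<notin> closure {x. \<phi> x \<noteq> 0}"
  shows "grad \<phi> x = 0"
proof -
  have "(\<phi> has_derivative (\<lambda>_. 0)) (at x)"
    by (rule has_derivative_transform_within_open[where s="- closure {x. \<phi> x \<noteq> 0}" and f="\<lambda>_. 0"])
      (use assms(2) closure_subset[of "{x. \<phi> x \<noteq> 0}"] in auto)
  then have "frechet_derivative \<phi> (at x) = (\<lambda>_. 0)"
    by (metis frechet_derivative_at)
  then show ?thesis by (simp add: grad_def)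
qed

lemma test_fun_eq_0: "test_fun \<Omega> \<phi> \<Longrightarrow> x \<notin> \<Omega> \<Longrightarrow> \<phi> x = 0"
  using closure_subset[of "{x. \<phi> x \<noteq> 0}"] unfolding test_fun_def by blast

lemma test_fun_grad_eq_0_outside: "test_fun \<Omega> \<phi> \<Longrightarrow> x \<notin> \<Omega> \<Longrightarrow> grad \<phi> x = 0"
  by (rule test_fun_grad_eq_0) (auto simp: test_fun_def)

lemma test_fun_bounded:
  assumes "test_fun \<Omega> \<phi>"
  obtains B where "B \<ge> 0" "\<And>x. \<bar>\<phi> x\<bar> \<le> B" "\<And>x. norm (grad \<phi> x) \<le> B"
proof -
  let ?K = "closure {x. \<phi> x \<noteq> 0}"
  have K: "compact ?K" and sm: "smooth_on UNIV \<phi>" using assms by (auto simp: test_fun_def)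
  obtain B1 where B1: "\<And>y. y \<in> \<phi> ` ?K \<Longrightarrow> norm y \<le> B1"
    using compact_continuous_image[OF continuous_on_subset[OF smooth_on_continuous[OF sm]] K]
    by (metis bounded_iff compact_imp_bounded subset_UNIV)
  obtain B2 where B2: "\<And>y. y \<in> grad \<phi> ` ?K \<Longrightarrow> norm y \<le> B2"
    using compact_continuous_image[OF continuous_on_subset[OF smooth_on_continuous_grad[OF sm]] K]
    by (metis bounded_iff compact_imp_bounded subset_UNIV)
  show ?thesis
  proof (rule that[of "max 0 (max B1 B2)"])
    fix x
    show "\<bar>\<phi> x\<bar> \<le> max 0 (max B1 B2)"
      using B1[of "\<phi> x"] closure_subset[of "{x. \<phi> x \<noteq> 0}"] by (cases "\<phi> x = 0") auto
    show "norm (grad \<phi> x) \<le> max 0 (max B1 B2)"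
      using B2[of "grad \<phi> x"] test_fun_grad_eq_0[OF assms, of x] by (cases "x \<in> ?K") auto
  qed simp
qed

lemma test_fun_0: "test_fun \<Omega> (\<lambda>_. 0)"
  by (simp add: test_fun_def smooth_on_def Ck_on_const)

lemma test_fun_lincomb:
  assumes "test_fun \<Omega> \<phi>" "test_fun \<Omega> \<psi>"
  shows "test_fun \<Omega> (\<lambda>x. c * \<phi> x + d * \<psi> x)"
proof -
  let ?K = "closure {x. \<phi> x \<noteq> 0} \<union> closure {x. \<psi> x \<noteq> 0}"
  have K: "compact ?K" "?K \<subseteq> \<Omega>" using assms by (auto simp: test_fun_def)
  have "{x. c * \<phi> x + d * \<psi> x \<noteq> 0} \<subseteq> ?K"
    using closure_subset[of "{x. \<phi> x \<noteq> 0}"] closure_subset[of "{x. \<psi> x \<noteq> 0}"] by force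
  then have "closure {x. c * \<phi> x + d * \<psi> x \<noteq> 0} \<subseteq> ?K"
    by (intro closure_minimal) auto
  moreover have "smooth_on UNIV (\<lambda>x. c * \<phi> x + d * \<psi> x)"
    using assms by (auto simp: test_fun_def smooth_on_def intro!: Ck_on_add Ck_on_mult Ck_on_const)
  ultimately show ?thesis
    using K unfolding test_fun_def
    by (meson bounded_subset closed_closure compact_eq_bounded_closed subset_trans)
qed

lemma grad_lincomb:
  assumes "smooth_on UNIV \<phi>" "smooth_on UNIV \<psi>"
  shows "grad (\<lambda>x. c * \<phi> x + d * \<psi> x) x = c *\<^sub>R grad \<phi> x + d *\<^sub>R grad \<psi> x"
proof -
  have "((\<lambda>x. c * \<phi> x + d * \<psi> x) has_derivative
      (\<lambda>h. c * frechet_derivative \<phi> (at x) h + d * frechet_derivative \<psi> (at x) h)) (at x)"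
    by (intro derivative_intros smooth_on_has_derivative assms)
  then have "frechet_derivative (\<lambda>x. c * \<phi> x + d * \<psi> x) (at x) =
      (\<lambda>h. c * frechet_derivative \<phi> (at x) h + d * frechet_derivative \<psi> (at x) h)"
    by (metis frechet_derivative_at)
  then show ?thesis
    by (simp add: grad_def scaleR_add_left sum.distrib scaleR_sum_right)
qed

lemma continuous_imp_measurable_lebesgue_on:
  "continuous_on UNIV f \<Longrightarrow> f \<in> borel_measurable (lebesgue_on S)"
  by (intro measurable_restrict_space1 measurable_completion) (simp add: borel_measurable_continuous_onI)

lemma test_fun_measurable:
  assumes "test_fun \<Omega> \<phi>"
  shows "\<phi> \<in> borel_measurable (lebesgue_on S)" "grad \<phi> \<in> borel_measurable (lebesgue_on S)"
  using assms by (auto simp: test_fun_def intro!: continuous_imp_measurable_lebesgue_on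
      smooth_on_continuous smooth_on_continuous_grad)

subsection \<open>Weak gradients\<close>

lemma weak_gradD:
  assumes "weak_grad \<Omega> u g"
  shows "u \<in> borel_measurable (lebesgue_on \<Omega>)" "g \<in> borel_measurable (lebesgue_on \<Omega>)"
    "test_fun \<Omega> \<phi> \<Longrightarrow> i \<in> Basis \<Longrightarrow> integrable (lebesgue_on \<Omega>) (\<lambda>x. u x * frechet_derivative \<phi> (at x) i)"
    "test_fun \<Omega> \<phi> \<Longrightarrow> i \<in> Basis \<Longrightarrow> integrable (lebesgue_on \<Omega>) (\<lambda>x. (g x \<bullet> i) * \<phi> x)"
    "test_fun \<Omega> \<phi> \<Longrightarrow> i \<in> Basis \<Longrightarrow> (\<integral>x. u x * frechet_derivative \<phi> (at x) i \<partial>lebesgue_on \<Omega>) =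
          - (\<integral>x. (g x \<bullet> i) * \<phi> x \<partial>lebesgue_on \<Omega>)"
  using assms unfolding weak_grad_def by blast+

lemma weak_grad_0: "weak_grad \<Omega> (\<lambda>_. 0) (\<lambda>_. 0)"
  by (simp add: weak_grad_def)

lemma weak_grad_lincomb:
  fixes u v :: "'a::euclidean_space \<Rightarrow> real"
  assumes "weak_grad \<Omega> u g" "weak_grad \<Omega> v h"
  shows "weak_grad \<Omega> (\<lambda>x. c * u x + d * v x) (\<lambda>x. c *\<^sub>R g x + d *\<^sub>R h x)"
  unfolding weak_grad_def
proof (intro conjI allI impI; (elim conjE)?)
  note u = weak_gradD[OF assms(1)] and v = weak_gradD[OF assms(2)]
  show "(\<lambda>x. c * u x + d * v x) \<in> borel_measurable (lebesgue_on \<Omega>)"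
    "(\<lambda>x. c *\<^sub>R g x + d *\<^sub>R h x) \<in> borel_measurable (lebesgue_on \<Omega>)"
    using u(1,2) v(1,2) by measurable
  fix \<phi> :: "'a \<Rightarrow> real" and i :: 'a assume \<phi>: "test_fun \<Omega> \<phi>" "i \<in> Basis"
  let ?D = "\<lambda>x. frechet_derivative \<phi> (at x) i"
  have 1: "(c * u x + d * v x) * ?D x = c * (u x * ?D x) + d * (v x * ?D x)"
    "(c *\<^sub>R g x + d *\<^sub>R h x) \<bullet> i * \<phi> x = c * ((g x \<bullet> i) * \<phi> x) + d * ((h x \<bullet> i) * \<phi> x)" for x
    by (auto simp: algebra_simps inner_simps)
  show "integrable (lebesgue_on \<Omega>) (\<lambda>x. (c * u x + d * v x) * ?D x)"
    "integrable (lebesgue_on \<Omega>) (\<lambda>x. (c *\<^sub>R g x + d *\<^sub>R h x) \<bullet> i * \<phi> x)"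
    unfolding 1 using u(3,4)[OF \<phi>] v(3,4)[OF \<phi>] by auto
  show "(\<integral>x. (c * u x + d * v x) * ?D x \<partial>lebesgue_on \<Omega>) =
      - (\<integral>x. (c *\<^sub>R g x + d *\<^sub>R h x) \<bullet> i * \<phi> x \<partial>lebesgue_on \<Omega>)"
    unfolding 1 using u(3-5)[OF \<phi>] v(3-5)[OF \<phi>] by simp
qed

text \<open>The difference is a weak gradient of the zero function; the fundamental lemma is applied
  to each of its components.\<close>

lemma weak_grad_unique:
  fixes g h :: "'a::euclidean_space \<Rightarrow> 'a"
  assumes "open \<Omega>" "weak_grad \<Omega> u g" "weak_grad \<Omega> u h"
  shows "AE x in lebesgue_on \<Omega>. g x = h x"
proof -
  have "AE x in lebesgue_on \<Omega>. (g x - h x) \<bullet> i = 0" if i: "i \<in> Basis" for i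
  proof (rule fundamental_lemma_calculus_variations[OF assms(1)])
    fix \<phi> :: "'a \<Rightarrow> real" assume \<phi>: "test_fun \<Omega> \<phi>"
    note w = weak_gradD[OF weak_grad_lincomb[OF assms(2,3), of 1 "- 1"], simplified]
    show "integrable (lebesgue_on \<Omega>) (\<lambda>x. (g x - h x) \<bullet> i * \<phi> x)"
      using w(4)[OF \<phi> i] by simp
    show "(\<integral>x. (g x - h x) \<bullet> i * \<phi> x \<partial>lebesgue_on \<Omega>) = 0"
      using w(5)[OF \<phi> i] by simp
  qed
  then have "AE x in lebesgue_on \<Omega>. \<forall>i\<in>Basis. (g x - h x) \<bullet> i = 0"
    by (simp add: AE_finite_all)
  then show ?thesis
    by eventually_elim (auto simp: inner_diff_left intro: euclidean_eqI)
qed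

lemma integrable_mult_bounded:
  fixes f g :: "'a \<Rightarrow> real"
  assumes "integrable M f" "g \<in> borel_measurable M" "\<And>x. \<bar>g x\<bar> \<le> B"
  shows "integrable M (\<lambda>x. f x * g x)"
proof (rule Bochner_Integration.integrable_bound)
  show "integrable M (\<lambda>x. B * f x)" using assms(1) by simp
  show "AE x in M. norm (f x * g x) \<le> norm (B * f x)"
    using order_trans[OF assms(3) abs_ge_self]
    by (intro AE_I2) (auto simp: abs_mult mult.commute[of "\<bar>B\<bar>"] intro!: mult_left_mono)
qed (use assms in auto)

lemma ennreal_tendsto_0_le:
  fixes a b :: "nat \<Rightarrow> ennreal"
  assumes "\<And>n. a n \<le> b n" "b \<longlonglongrightarrow> 0"
  shows "a \<longlonglongrightarrow> 0"
  by (rule tendsto_sandwich[of "\<lambda>_. 0" a sequentially b]) (use assms in auto)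

lemma integral_mult_tendsto_of_L1:
  fixes f :: "'a \<Rightarrow> real"
  assumes "\<And>n. integrable M (\<lambda>x. F n x * g x)" "integrable M (\<lambda>x. f x * g x)"
    and F: "\<And>n. F n \<in> borel_measurable M" and f: "f \<in> borel_measurable M"
    and g: "g \<in> borel_measurable M" "\<And>x. \<bar>g x\<bar> \<le> B"
    and conv: "(\<lambda>n. \<integral>\<^sup>+ x. ennreal \<bar>F n x - f x\<bar> \<partial>M) \<longlonglongrightarrow> 0"
  shows "(\<lambda>n. \<integral>x. F n x * g x \<partial>M) \<longlonglongrightarrow> (\<integral>x. f x * g x \<partial>M)"
proof (rule tendsto_L1_int)
  have "B \<ge> 0" using g(2)[of undefined] by linarith
  have "(\<integral>\<^sup>+ x. ennreal (norm (F n x * g x - f x * g x)) \<partial>M) \<le> ennreal B * (\<integral>\<^sup>+ x. ennreal \<bar>F n x - f x\<bar> \<partial>M)" for n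
  proof -
    have "(\<integral>\<^sup>+ x. ennreal (norm (F n x * g x - f x * g x)) \<partial>M) \<le> (\<integral>\<^sup>+ x. ennreal B * ennreal \<bar>F n x - f x\<bar> \<partial>M)"
    proof (rule nn_integral_mono)
      fix x
      have "norm (F n x * g x - f x * g x) = \<bar>g x\<bar> * \<bar>F n x - f x\<bar>"
        by (metis abs_mult left_diff_distrib mult.commute real_norm_def)
      also have "\<dots> \<le> B * \<bar>F n x - f x\<bar>" using g(2) by (intro mult_right_mono) auto
      finally show "ennreal (norm (F n x * g x - f x * g x)) \<le> ennreal B * ennreal \<bar>F n x - f x\<bar>"
        using \<open>B \<ge> 0\<close> by (simp flip: ennreal_mult)
    qed
    also have "\<dots> \<le> ennreal B * (\<integral>\<^sup>+ x. ennreal \<bar>F n x - f x\<bar> \<partial>M)"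
      using F f by (subst nn_integral_cmult) auto
    finally show ?thesis .
  qed
  moreover have "(\<lambda>n. ennreal B * (\<integral>\<^sup>+ x. ennreal \<bar>F n x - f x\<bar> \<partial>M)) \<longlonglongrightarrow> ennreal B * 0"
    by (intro tendsto_intros conv) auto
  ultimately show "(\<lambda>n. \<integral>\<^sup>+ x. ennreal (norm (F n x * g x - f x * g x)) \<partial>M) \<longlonglongrightarrow> 0"
    by - (rule ennreal_tendsto_0_le, auto)
qed (use assms in auto)

text \<open>Test functions and their gradients are bounded, so convergence in mean suffices to pass
  to the limit in the defining identity.\<close>

lemma weak_grad_limit:
  fixes u :: "'a::euclidean_space \<Rightarrow> real"
  assumes wg: "\<And>n. weak_grad \<Omega> (U n) (G n)"
    and meas: "u \<in> borel_measurable (lebesgue_on \<Omega>)" "g \<in> borel_measurable (lebesgue_on \<Omega>)"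
    and U: "(\<lambda>n. \<integral>\<^sup>+ x. ennreal \<bar>U n x - u x\<bar> \<partial>lebesgue_on \<Omega>) \<longlonglongrightarrow> 0"
    and G: "(\<lambda>n. \<integral>\<^sup>+ x. ennreal (norm (G n x - g x)) \<partial>lebesgue_on \<Omega>) \<longlonglongrightarrow> 0"
  shows "weak_grad \<Omega> u g"
proof -
  note [measurable] = meas weak_gradD(1,2)[OF wg]
  \<comment> \<open>One index at finite distance is enough: the integrability demanded by
    \<open>weak_grad\<close> is inherited by u from that U n.\<close>
  have U_le: "\<exists>n. integrable (lebesgue_on \<Omega>) (\<lambda>x. U n x - u x)"
  proof -
    have "eventually (\<lambda>n. (\<integral>\<^sup>+ x. ennreal \<bar>U n x - u x\<bar> \<partial>lebesgue_on \<Omega>) < \<infinity>) sequentially"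
      using order_tendstoD(2)[OF U, of \<infinity>] by simp
    then show ?thesis
      by (auto simp: eventually_sequentially integrable_iff_bounded)
  qed
  have Gi: "(\<lambda>n. \<integral>\<^sup>+ x. ennreal \<bar>G n x \<bullet> i - g x \<bullet> i\<bar> \<partial>lebesgue_on \<Omega>) \<longlonglongrightarrow> 0" if "i \<in> Basis" for i
    by (rule ennreal_tendsto_0_le[OF _ G])
      (auto intro!: nn_integral_mono ennreal_leI Basis_le_norm[OF that] simp flip: inner_diff_left)
  have G_le: "\<exists>n. integrable (lebesgue_on \<Omega>) (\<lambda>x. G n x \<bullet> i - g x \<bullet> i)" if "i \<in> Basis" for i
  proof -
    have "eventually (\<lambda>n. (\<integral>\<^sup>+ x. ennreal \<bar>G n x \<bullet> i - g x \<bullet> i\<bar> \<partial>lebesgue_on \<Omega>) < \<infinity>) sequentially"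
      using order_tendstoD(2)[OF Gi[OF that], of \<infinity>] by simp
    then show ?thesis
      by (auto simp: eventually_sequentially integrable_iff_bounded)
  qed
  show ?thesis unfolding weak_grad_def
  proof (intro conjI allI impI; (elim conjE)?)
    fix \<phi> :: "'a \<Rightarrow> real" and i :: 'a assume \<phi>: "test_fun \<Omega> \<phi>" and i: "i \<in> Basis"
    obtain B where B: "\<And>x. \<bar>\<phi> x\<bar> \<le> B" "\<And>x. norm (grad \<phi> x) \<le> B" using test_fun_bounded[OF \<phi>] by metis
    have B': "\<bar>frechet_derivative \<phi> (at x) i\<bar> \<le> B" for x
      using B(2)[of x] Basis_le_norm[OF i, of "grad \<phi> x"] inner_grad[OF i, of \<phi> x] by auto
    note [measurable] = test_fun_measurable[OF \<phi>]
    have Dm[measurable]: "(\<lambda>x. frechet_derivative \<phi> (at x) i) \<in> borel_measurable (lebesgue_on \<Omega>)"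
      using inner_grad[OF i] by (simp flip: inner_grad[OF i])
    obtain n where "integrable (lebesgue_on \<Omega>) (\<lambda>x. U n x - u x)" using U_le by blast
    from Bochner_Integration.integrable_diff[OF weak_gradD(3)[OF wg \<phi> i, of n] integrable_mult_bounded[OF this Dm B']]
    show ui: "integrable (lebesgue_on \<Omega>) (\<lambda>x. u x * frechet_derivative \<phi> (at x) i)"
      by (simp add: algebra_simps)
    obtain n where "integrable (lebesgue_on \<Omega>) (\<lambda>x. G n x \<bullet> i - g x \<bullet> i)" using G_le[OF i] by blast
    from Bochner_Integration.integrable_diff[OF weak_gradD(4)[OF wg \<phi> i, of n] integrable_mult_bounded[OF this test_fun_measurable(1)[OF \<phi>] B(1)]]
    show gi: "integrable (lebesgue_on \<Omega>) (\<lambda>x. (g x \<bullet> i) * \<phi> x)"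
      by (simp add: algebra_simps)
    have "(\<lambda>n. \<integral>x. U n x * frechet_derivative \<phi> (at x) i \<partial>lebesgue_on \<Omega>)
        \<longlonglongrightarrow> (\<integral>x. u x * frechet_derivative \<phi> (at x) i \<partial>lebesgue_on \<Omega>)"
      by (rule integral_mult_tendsto_of_L1[OF weak_gradD(3)[OF wg \<phi> i] ui _ _ _ B' U]) measurable
    moreover have "(\<lambda>n. \<integral>x. (G n x \<bullet> i) * \<phi> x \<partial>lebesgue_on \<Omega>)
        \<longlonglongrightarrow> (\<integral>x. (g x \<bullet> i) * \<phi> x \<partial>lebesgue_on \<Omega>)"
      by (rule integral_mult_tendsto_of_L1[OF weak_gradD(4)[OF wg \<phi> i] gi _ _ _ B(1) Gi[OF i]]) measurable
    then have "(\<lambda>n. \<integral>x. U n x * frechet_derivative \<phi> (at x) i \<partial>lebesgue_on \<Omega>)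
        \<longlonglongrightarrow> - (\<integral>x. (g x \<bullet> i) * \<phi> x \<partial>lebesgue_on \<Omega>)"
      unfolding weak_gradD(5)[OF wg \<phi> i] by (rule tendsto_minus)
    ultimately show "(\<integral>x. u x * frechet_derivative \<phi> (at x) i \<partial>lebesgue_on \<Omega>) =
        - (\<integral>x. (g x \<bullet> i) * \<phi> x \<partial>lebesgue_on \<Omega>)"
      by (rule LIMSEQ_unique)
  qed measurable
qed

subsection \<open>Modulars\<close>

text \<open>Uniform bounds make a scalar factor change the modular by a controlled power of that
  factor. This is what relates norm and modular convergence and drives every rescaling argument
  below.\<close>

definition bdd_exponent :: "'a::euclidean_space set \<Rightarrow> ('a \<Rightarrow> real) \<Rightarrow> real \<Rightarrow> real \<Rightarrow> bool" where
  "bdd_exponent \<Omega> p l m \<longleftrightarrow> 1 < l \<and> l \<le> m \<and> p \<in> borel_measurable (lebesgue_on \<Omega>) \<and> (\<forall>x\<in>\<Omega>. l \<le> p x \<and> p x \<le> m)"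

lemma modular_cong_AE:
  assumes "AE x in lebesgue_on \<Omega>. \<bar>u x\<bar> = \<bar>v x\<bar>"
  shows "modular \<Omega> p u = modular \<Omega> p v"
  unfolding modular_def using assms by (intro nn_integral_cong_AE) auto

lemma powr_add_le:
  fixes a b p m :: real
  assumes "0 \<le> a" "0 \<le> b" "0 < p" "p \<le> m"
  shows "(a + b) powr p \<le> 2 powr m * (a powr p + b powr p)"
proof -
  have "(a + b) powr p \<le> (2 * max a b) powr p" using assms by (intro powr_mono2) auto
  also have "\<dots> = 2 powr p * max a b powr p" using assms by (simp add: powr_mult)
  also have "\<dots> \<le> 2 powr m * (a powr p + b powr p)"
    using assms by (intro mult_mono powr_mono) (auto simp: max_def)
  finally show ?thesis .
qed

text \<open>A modular is not subadditive; doubling the argument costs the factor 2^m. Stating it for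
  a dominated w lets it serve norms of vector fields as well as sums.\<close>

lemma modular_triangle:
  assumes p: "bdd_exponent \<Omega> p l m"
    and meas: "u \<in> borel_measurable (lebesgue_on \<Omega>)" "v \<in> borel_measurable (lebesgue_on \<Omega>)"
    and le: "\<And>x. x \<in> \<Omega> \<Longrightarrow> \<bar>w x\<bar> \<le> \<bar>u x\<bar> + \<bar>v x\<bar>"
  shows "modular \<Omega> p w \<le> ennreal (2 powr m) * (modular \<Omega> p u + modular \<Omega> p v)"
proof -
  have [measurable]: "p \<in> borel_measurable (lebesgue_on \<Omega>)" using p by (simp add: bdd_exponent_def)
  note [measurable] = meas
  have "modular \<Omega> p w \<le> (\<integral>\<^sup>+ x. ennreal (2 powr m) * (ennreal (\<bar>u x\<bar> powr p x) + ennreal (\<bar>v x\<bar> powr p x)) \<partial>lebesgue_on \<Omega>)"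
    unfolding modular_def
  proof (rule nn_integral_mono)
    fix x assume "x \<in> space (lebesgue_on \<Omega>)"
    then have x: "x \<in> \<Omega>" by simp
    with p have px: "0 < p x" "p x \<le> m" by (auto simp: bdd_exponent_def)
    have "\<bar>w x\<bar> powr p x \<le> (\<bar>u x\<bar> + \<bar>v x\<bar>) powr p x" using le[OF x] px by (intro powr_mono2) auto
    also have "\<dots> \<le> 2 powr m * (\<bar>u x\<bar> powr p x + \<bar>v x\<bar> powr p x)" using px by (intro powr_add_le) auto
    finally show "ennreal (\<bar>w x\<bar> powr p x) \<le> ennreal (2 powr m) * (ennreal (\<bar>u x\<bar> powr p x) + ennreal (\<bar>v x\<bar> powr p x))"
      by (simp flip: ennreal_mult ennreal_plus)
  qed
  also have "\<dots> = ennreal (2 powr m) * (modular \<Omega> p u + modular \<Omega> p v)"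
    unfolding modular_def by (simp add: nn_integral_cmult nn_integral_add)
  finally show ?thesis .
qed

lemma modular_scale:
  assumes p: "bdd_exponent \<Omega> p l m" and meas: "u \<in> borel_measurable (lebesgue_on \<Omega>)"
    and c: "c \<ge> 0" and K: "\<And>x. x \<in> \<Omega> \<Longrightarrow> c powr p x \<le> K"
  shows "modular \<Omega> p (\<lambda>x. c * u x) \<le> ennreal K * modular \<Omega> p u"
\<comment> \<open>Nonnegativity of K comes from a point of the domain, hence the separate empty
  case.\<close>
proof (cases "\<Omega> = {}")
  case True
  then have "space (lebesgue_on \<Omega>) = {}" by simp
  then show ?thesis unfolding modular_def by (simp add: nn_integral_empty)
next
  case False
  then have "K \<ge> 0" using K powr_ge_zero order_trans by blast
  have [measurable]: "p \<in> borel_measurable (lebesgue_on \<Omega>)" using p by (simp add: bdd_exponent_def)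
  note [measurable] = meas
  have "modular \<Omega> p (\<lambda>x. c * u x) \<le> (\<integral>\<^sup>+ x. ennreal K * ennreal (\<bar>u x\<bar> powr p x) \<partial>lebesgue_on \<Omega>)"
    unfolding modular_def using c K \<open>K \<ge> 0\<close>
    by (intro nn_integral_mono) (auto simp: abs_mult powr_mult simp flip: ennreal_mult intro!: ennreal_leI mult_right_mono)
  also have "\<dots> = ennreal K * modular \<Omega> p u"
    unfolding modular_def by (simp add: nn_integral_cmult)
  finally show ?thesis .
qed

lemma modular_scale_ge_1:
  assumes "bdd_exponent \<Omega> p l m" "u \<in> borel_measurable (lebesgue_on \<Omega>)" "c \<ge> 1"
  shows "modular \<Omega> p (\<lambda>x. c * u x) \<le> ennreal (c powr m) * modular \<Omega> p u"
  using assms by (intro modular_scale) (auto simp: bdd_exponent_def intro!: powr_mono)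

lemma modular_scale_le_1:
  assumes "bdd_exponent \<Omega> p l m" "u \<in> borel_measurable (lebesgue_on \<Omega>)" "0 < c" "c \<le> 1"
  shows "modular \<Omega> p (\<lambda>x. c * u x) \<le> ennreal (c powr l) * modular \<Omega> p u"
  using assms by (intro modular_scale) (auto simp: bdd_exponent_def intro!: powr_mono')

text \<open>Where |u| <= e the constant term pays; elsewhere |u|/e >= 1, and raising it to the power
  p x only enlarges it. The free parameter e makes the constant term small in limits.\<close>

lemma modular_L1_bound:
  assumes p: "bdd_exponent \<Omega> p l m" and meas: "u \<in> borel_measurable (lebesgue_on \<Omega>)"
    and e: "0 < e" "e \<le> 1"
  shows "(\<integral>\<^sup>+ x. ennreal \<bar>u x\<bar> \<partial>lebesgue_on \<Omega>)
    \<le> ennreal e * emeasure (lebesgue_on \<Omega>) \<Omega> + ennreal (e powr (1 - m)) * modular \<Omega> p u"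
proof -
  have [measurable]: "p \<in> borel_measurable (lebesgue_on \<Omega>)" using p by (simp add: bdd_exponent_def)
  note [measurable] = meas
  have "(\<integral>\<^sup>+ x. ennreal \<bar>u x\<bar> \<partial>lebesgue_on \<Omega>)
    \<le> (\<integral>\<^sup>+ x. ennreal e + ennreal (e powr (1 - m)) * ennreal (\<bar>u x\<bar> powr p x) \<partial>lebesgue_on \<Omega>)"
  proof (rule nn_integral_mono)
    fix x assume "x \<in> space (lebesgue_on \<Omega>)"
    with p have px: "1 < p x" "p x \<le> m" by (auto simp: bdd_exponent_def)
    have "\<bar>u x\<bar> \<le> e + e powr (1 - m) * \<bar>u x\<bar> powr p x"
    proof (cases "\<bar>u x\<bar> \<le> e")
      case False
      then have "1 \<le> \<bar>u x\<bar> / e" using e by (simp add: field_simps)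
      then have "(\<bar>u x\<bar> / e) powr 1 \<le> (\<bar>u x\<bar> / e) powr p x" using px by (intro powr_mono) auto
      then have "\<bar>u x\<bar> \<le> e * (\<bar>u x\<bar> / e) powr p x" using e by (simp add: field_simps)
      also have "\<dots> = e powr (1 - p x) * \<bar>u x\<bar> powr p x"
        using e by (simp add: powr_divide powr_diff)
      also have "\<dots> \<le> e powr (1 - m) * \<bar>u x\<bar> powr p x"
        using e px by (intro mult_right_mono powr_mono') auto
      finally show ?thesis using e by simp
    qed (simp add: add_increasing2)
    then show "ennreal \<bar>u x\<bar> \<le> ennreal e + ennreal (e powr (1 - m)) * ennreal (\<bar>u x\<bar> powr p x)"
      using e by (simp flip: ennreal_mult ennreal_plus)
  qed
  also have "\<dots> = ennreal e * emeasure (lebesgue_on \<Omega>) \<Omega> + ennreal (e powr (1 - m)) * modular \<Omega> p u"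
    unfolding modular_def by (subst nn_integral_add) (auto simp: nn_integral_cmult)
  finally show ?thesis .
qed

text \<open>In \<open>modular_L1_bound\<close> first e is chosen to make the constant term small,
  then n to make the modular term small.\<close>

lemma modular_tendsto_0_imp_L1:
  assumes p: "bdd_exponent \<Omega> p l m" and meas: "\<And>n. u n \<in> borel_measurable (lebesgue_on \<Omega>)"
    and fin: "emeasure (lebesgue_on \<Omega>) \<Omega> < \<infinity>"
    and lim: "(\<lambda>n. modular \<Omega> p (u n)) \<longlonglongrightarrow> 0"
  shows "(\<lambda>n. \<integral>\<^sup>+ x. ennreal \<bar>u n x\<bar> \<partial>lebesgue_on \<Omega>) \<longlonglongrightarrow> 0"
proof (rule order_tendstoI)
  fix a :: ennreal assume "0 < a"
  define V where "V = emeasure (lebesgue_on \<Omega>) \<Omega>"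
  obtain e :: real where e: "0 < e" "e \<le> 1" "ennreal e * V < a"
  proof -
    have "((\<lambda>e. ennreal e * V) \<longlongrightarrow> ennreal 0 * V) (at_right 0)"
      using fin by (intro tendsto_intros tendsto_ennrealI) (auto simp: V_def)
    then have "eventually (\<lambda>e. ennreal e * V < a) (at_right (0::real))"
      using \<open>0 < a\<close> by (auto dest: order_tendstoD(2))
    moreover have "eventually (\<lambda>e. e \<in> {0<..<1}) (at_right (0::real))"
      by (rule eventually_at_right_real) simp
    ultimately have "eventually (\<lambda>e. ennreal e * V < a \<and> e \<in> {0<..<1}) (at_right (0::real))"
      by eventually_elim auto
    then obtain e where "ennreal e * V < a" "e \<in> {0<..<1}"
      using eventually_happens trivial_limit_at_right_real by blast
    then show ?thesis by (intro that[of e]) auto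
  qed
  have "(\<lambda>n. ennreal e * V + ennreal (e powr (1 - m)) * modular \<Omega> p (u n))
      \<longlonglongrightarrow> ennreal e * V + ennreal (e powr (1 - m)) * 0"
    by (intro tendsto_intros lim) auto
  then have "eventually (\<lambda>n. ennreal e * V + ennreal (e powr (1 - m)) * modular \<Omega> p (u n) < a) sequentially"
    using e(3) by (auto dest: order_tendstoD(2))
  then show "eventually (\<lambda>n. (\<integral>\<^sup>+ x. ennreal \<bar>u n x\<bar> \<partial>lebesgue_on \<Omega>) < a) sequentially"
    by eventually_elim (use modular_L1_bound[OF p meas e(1,2)] in \<open>auto simp: V_def intro: le_less_trans\<close>)
qed auto

lemma modular_lincomb_bound:
  assumes p: "bdd_exponent \<Omega> p l m"
    and meas: "u \<in> borel_measurable (lebesgue_on \<Omega>)" "v \<in> borel_measurable (lebesgue_on \<Omega>)"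
    and le: "\<And>x. x \<in> \<Omega> \<Longrightarrow> \<bar>w x\<bar> \<le> c * \<bar>u x\<bar> + c * \<bar>v x\<bar>" and c: "c \<ge> 1"
  shows "modular \<Omega> p w \<le> ennreal ((2 * c) powr m) * (modular \<Omega> p u + modular \<Omega> p v)"
proof -
  have "modular \<Omega> p w \<le> ennreal (2 powr m) * (modular \<Omega> p (\<lambda>x. c * u x) + modular \<Omega> p (\<lambda>x. c * v x))"
    using meas le c by (intro modular_triangle[OF p]) (auto simp: abs_mult)
  also have "\<dots> \<le> ennreal (2 powr m) * (ennreal (c powr m) * modular \<Omega> p u + ennreal (c powr m) * modular \<Omega> p v)"
    using meas c by (intro mult_left_mono add_mono modular_scale_ge_1[OF p]) auto
  also have "\<dots> = ennreal ((2 * c) powr m) * (modular \<Omega> p u + modular \<Omega> p v)"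
    using c by (simp add: powr_mult ennreal_mult distrib_left mult.assoc)
  finally show ?thesis .
qed

subsection \<open>Luxemburg norms and modular convergence\<close>

text \<open>Guarantees that the real infimum in \<open>lux_norm\<close> is that of a nonempty set
  bounded below by 0, so that it is a meaningful norm.\<close>

lemma lux_norm_set_nonempty:
  assumes p: "bdd_exponent \<Omega> p l m" and u: "u \<in> Lp_var \<Omega> p"
  shows "{t::real. t > 0 \<and> modular \<Omega> p (\<lambda>x. u x / t) \<le> 1} \<noteq> {}"
proof -
  have fin: "modular \<Omega> p u < \<infinity>" and meas: "u \<in> borel_measurable (lebesgue_on \<Omega>)"
    using u by (auto simp: Lp_var_def)
  then obtain r where r: "r \<ge> 0" "modular \<Omega> p u = ennreal r" by (cases "modular \<Omega> p u") auto
  \<comment> \<open>With t >= 1 and l > 1, dividing by t multiplies the modular r by at most t^(-l)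
    <= 1/t, and r/t <= 1.\<close>
  define t where "t = max 1 r"
  have t: "t \<ge> 1" "r \<le> t" by (auto simp: t_def)
  have l: "l > 1" using p by (simp add: bdd_exponent_def)
  have "modular \<Omega> p (\<lambda>x. (1/t) * u x) \<le> ennreal ((1/t) powr l) * ennreal r"
    using modular_scale_le_1[OF p meas, of "1/t"] t r by simp
  also have "\<dots> \<le> ennreal ((1/t) powr 1) * ennreal r"
    using t l by (intro mult_right_mono ennreal_leI powr_mono') auto
  also have "\<dots> \<le> 1" using t r by (simp flip: ennreal_mult add: field_simps)
  finally have "modular \<Omega> p (\<lambda>x. u x / t) \<le> 1" by simp
  then show ?thesis using t by (auto intro!: exI[of _ t])
qed

lemma lux_norm_nonneg:
  assumes "bdd_exponent \<Omega> p l m" "u \<in> Lp_var \<Omega> p"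
  shows "lux_norm \<Omega> p u \<ge> 0"
  unfolding lux_norm_def by (rule cInf_greatest[OF lux_norm_set_nonempty[OF assms]]) auto

lemma modular_le_of_lux_norm_less:
  assumes p: "bdd_exponent \<Omega> p l m" and u: "u \<in> Lp_var \<Omega> p" and e: "lux_norm \<Omega> p u < e" "e \<le> 1"
  shows "modular \<Omega> p u \<le> ennreal e"
proof -
  obtain t where t: "t > 0" "modular \<Omega> p (\<lambda>x. u x / t) \<le> 1" "t < e"
    using cInf_lessD[OF lux_norm_set_nonempty[OF p u]] e(1) unfolding lux_norm_def by blast
  have l: "l > 1" using p by (simp add: bdd_exponent_def)
  have "modular \<Omega> p (\<lambda>x. t * (u x / t)) \<le> ennreal (t powr l) * modular \<Omega> p (\<lambda>x. u x / t)"
    using t e u by (intro modular_scale_le_1[OF p]) (auto simp: Lp_var_def)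
  also have "\<dots> \<le> ennreal (t powr l) * 1" using t by (intro mult_left_mono) auto
  also have "\<dots> \<le> ennreal e"
    using powr_mono'[of 1 l t] t e l by (auto intro!: ennreal_leI)
  finally show ?thesis using t by simp
qed

lemma lux_norm_le_of_modular_le:
  assumes p: "bdd_exponent \<Omega> p l m" and u: "u \<in> Lp_var \<Omega> p"
    and e: "0 < e" "e \<le> 1" "modular \<Omega> p u \<le> ennreal (e powr m)"
  shows "lux_norm \<Omega> p u \<le> e"
proof -
  have "modular \<Omega> p (\<lambda>x. (1/e) * u x) \<le> ennreal ((1/e) powr m) * modular \<Omega> p u"
    using u e by (intro modular_scale_ge_1[OF p]) (auto simp: Lp_var_def)
  also have "\<dots> \<le> ennreal ((1/e) powr m) * ennreal (e powr m)" using e by (intro mult_left_mono) auto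
  also have "\<dots> = 1" using e by (simp add: powr_divide flip: ennreal_mult)
  finally show ?thesis
    unfolding lux_norm_def using e by (intro cInf_lower bdd_belowI[of _ 0]) auto
qed

lemma ennreal_pos_obtain_real:
  fixes a :: ennreal assumes "0 < a"
  obtains b :: real where "0 < b" "ennreal b < a" "b \<le> 1"
proof -
  obtain c where c: "0 < c" "c < min a 1" using dense[of 0 "min a 1"] \<open>0 < a\<close> by auto
  then have "c < top" by (metis ennreal_one_less_top less_trans min_less_iff_conj)
  then obtain b where "b \<ge> 0" "c = ennreal b" by (cases c) auto
  with c show ?thesis by (intro that[of b]) auto
qed

text \<open>For e <= 1, a norm below e forces the modular below e, and a modular below e^m forces
  the norm below e. From here on \<open>W0\<close> can be handled through modulars, which are plain
  integrals.\<close>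

lemma lux_norm_tendsto_0_iff:
  assumes p: "bdd_exponent \<Omega> p l m" and u: "\<And>k. u k \<in> Lp_var \<Omega> p"
  shows "(\<lambda>k. lux_norm \<Omega> p (u k)) \<longlonglongrightarrow> 0 \<longleftrightarrow> (\<lambda>k. modular \<Omega> p (u k)) \<longlonglongrightarrow> 0"
proof
  assume L: "(\<lambda>k. lux_norm \<Omega> p (u k)) \<longlonglongrightarrow> 0"
  show "(\<lambda>k. modular \<Omega> p (u k)) \<longlonglongrightarrow> 0"
  proof (rule order_tendstoI)
    fix a :: ennreal assume "0 < a"
    then obtain b where b: "0 < b" "ennreal b < a" "b \<le> 1" by (rule ennreal_pos_obtain_real)
    have "eventually (\<lambda>k. lux_norm \<Omega> p (u k) < b) sequentially"
      using L b(1) by (rule order_tendstoD(2))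
    then show "eventually (\<lambda>k. modular \<Omega> p (u k) < a) sequentially"
      by eventually_elim (use modular_le_of_lux_norm_less[OF p u] b in \<open>meson le_less_trans\<close>)
  qed auto
next
  assume L: "(\<lambda>k. modular \<Omega> p (u k)) \<longlonglongrightarrow> 0"
  show "(\<lambda>k. lux_norm \<Omega> p (u k)) \<longlonglongrightarrow> 0"
  proof (rule order_tendstoI)
    fix a :: real assume "a < 0"
    then show "eventually (\<lambda>k. a < lux_norm \<Omega> p (u k)) sequentially"
      using lux_norm_nonneg[OF p u] by (auto intro!: always_eventually intro: less_le_trans)
  next
    fix a :: real assume "0 < a"
    define e where "e = min 1 (a / 2)"
    have e: "0 < e" "e \<le> 1" "e < a" using \<open>0 < a\<close> by (auto simp: e_def)
    have "eventually (\<lambda>k. modular \<Omega> p (u k) < ennreal (e powr m)) sequentially"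
      using L by (rule order_tendstoD(2)) (use e in auto)
    then show "eventually (\<lambda>k. lux_norm \<Omega> p (u k) < a) sequentially"
      by eventually_elim (rule le_less_trans[OF lux_norm_le_of_modular_le[OF p u e(1,2) less_imp_le] e(3)])
  qed
qed

subsection \<open>The spaces W0\<close>

locale bounded_domain =
  fixes \<Omega> :: "'a::euclidean_space set"
  assumes open_\<Omega>: "open \<Omega>" and bounded_\<Omega>: "bounded \<Omega>"
begin

abbreviation "M \<equiv> lebesgue_on \<Omega>"

lemma lmeasurable_\<Omega>: "\<Omega> \<in> lmeasurable"
  using open_\<Omega> bounded_\<Omega> by (simp add: lmeasurable_open)

sublocale finite_measure M
  using lmeasurable_\<Omega> by (rule finite_measure_lebesgue_on)

lemma emeasure_\<Omega>_finite: "emeasure M \<Omega> < \<infinity>"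
  by (metis emeasure_finite infinity_ennreal_def less_top)

lemma continuous_on_imp_measurable: "continuous_on \<Omega> f \<Longrightarrow> f \<in> borel_measurable M"
  using open_\<Omega> by (intro continuous_imp_measurable_on_sets_lebesgue) auto

lemma bounded_imp_Lp_var:
  assumes p: "bdd_exponent \<Omega> p l m" and u: "u \<in> borel_measurable M" "\<And>x. \<bar>u x\<bar> \<le> B"
  shows "u \<in> Lp_var \<Omega> p"
proof -
  have "modular \<Omega> p u \<le> (\<integral>\<^sup>+ x. ennreal (max 1 B powr m) \<partial>M)"
    unfolding modular_def
  proof (rule nn_integral_mono)
    fix x assume "x \<in> space M"
    with p have px: "1 < p x" "p x \<le> m" by (auto simp: bdd_exponent_def)
    have "\<bar>u x\<bar> powr p x \<le> max 1 B powr p x" using px u(2)[of x] by (intro powr_mono2) auto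
    also have "\<dots> \<le> max 1 B powr m" using px by (intro powr_mono) auto
    finally show "ennreal (\<bar>u x\<bar> powr p x) \<le> ennreal (max 1 B powr m)" by (rule ennreal_leI)
  qed
  also have "\<dots> < \<infinity>" using emeasure_\<Omega>_finite by (simp add: ennreal_mult_less_top)
  finally show ?thesis using u by (simp add: Lp_var_def)
qed

lemma Lp_var_lincomb_le:
  assumes p: "bdd_exponent \<Omega> p l m" and "u \<in> Lp_var \<Omega> p" "v \<in> Lp_var \<Omega> p" "w \<in> borel_measurable M"
    and "\<And>x. x \<in> \<Omega> \<Longrightarrow> \<bar>w x\<bar> \<le> c * \<bar>u x\<bar> + c * \<bar>v x\<bar>" "c \<ge> 1"
  shows "w \<in> Lp_var \<Omega> p"
proof -
  have "modular \<Omega> p w \<le> ennreal ((2 * c) powr m) * (modular \<Omega> p u + modular \<Omega> p v)"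
    using assms by (intro modular_lincomb_bound[OF p]) (auto simp: Lp_var_def)
  also have "\<dots> < \<infinity>" using assms by (auto simp: Lp_var_def ennreal_mult_less_top)
  finally show ?thesis using assms by (simp add: Lp_var_def)
qed

definition modular_approx :: "('a \<Rightarrow> real) \<Rightarrow> ('a \<Rightarrow> real) \<Rightarrow> ('a \<Rightarrow> 'a) \<Rightarrow> (nat \<Rightarrow> 'a \<Rightarrow> real) \<Rightarrow> bool" where
  "modular_approx p u g \<phi> \<longleftrightarrow> (\<forall>k. test_fun \<Omega> (\<phi> k)) \<and>
     (\<lambda>k. modular \<Omega> p (\<lambda>x. \<phi> k x - u x)) \<longlonglongrightarrow> 0 \<and> (\<lambda>k. modular \<Omega> p (\<lambda>x. norm (grad (\<phi> k) x - g x))) \<longlonglongrightarrow> 0"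

text \<open>Splitting the null sequence of sums into two null sequences uses nonnegativity of each
  norm. That needs all differences in the variable Lebesgue space, where test functions lie because
  they are bounded.\<close>

lemma W0_grad_iff:
  assumes p: "bdd_exponent \<Omega> p l m"
  shows "W0_grad \<Omega> p u g \<longleftrightarrow> weak_grad \<Omega> u g \<and> u \<in> Lp_var \<Omega> p \<and> (\<lambda>x. norm (g x)) \<in> Lp_var \<Omega> p \<and>
     (\<exists>\<phi>. modular_approx p u g \<phi>)"
proof -
  have "((\<lambda>k. lux_norm \<Omega> p (\<lambda>x. \<phi> k x - u x) + lux_norm \<Omega> p (\<lambda>x. norm (grad (\<phi> k) x - g x))) \<longlonglongrightarrow> 0)
      \<longleftrightarrow> (\<lambda>k. modular \<Omega> p (\<lambda>x. \<phi> k x - u x)) \<longlonglongrightarrow> 0 \<and> (\<lambda>k. modular \<Omega> p (\<lambda>x. norm (grad (\<phi> k) x - g x))) \<longlonglongrightarrow> 0"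
    (is "?L \<longleftrightarrow> _")
    if wg: "weak_grad \<Omega> u g" and u: "u \<in> Lp_var \<Omega> p" and g: "(\<lambda>x. norm (g x)) \<in> Lp_var \<Omega> p"
      and \<phi>: "\<forall>k. test_fun \<Omega> (\<phi> k)" for \<phi>
  proof -
    note \<phi>m = test_fun_measurable[OF \<phi>[rule_format]]
    note [measurable] = weak_gradD(1,2)[OF wg] \<phi>m
    have 1: "(\<lambda>x. \<phi> k x - u x) \<in> Lp_var \<Omega> p" for k
    proof -
      obtain B where "\<And>x. \<bar>\<phi> k x\<bar> \<le> B" using test_fun_bounded \<phi> by metis
      then have "\<phi> k \<in> Lp_var \<Omega> p" by (intro bounded_imp_Lp_var[OF p] \<phi>m)
      then show ?thesis using u by (rule Lp_var_lincomb_le[OF p, where c=1]) auto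
    qed
    have 2: "(\<lambda>x. norm (grad (\<phi> k) x - g x)) \<in> Lp_var \<Omega> p" for k
    proof -
      obtain B where "\<And>x. norm (grad (\<phi> k) x) \<le> B" using test_fun_bounded \<phi> by metis
      then have "(\<lambda>x. norm (grad (\<phi> k) x)) \<in> Lp_var \<Omega> p" by (intro bounded_imp_Lp_var[OF p, of _ B]) auto
      then show ?thesis using g by (rule Lp_var_lincomb_le[OF p, where c=1]) (auto simp: norm_triangle_ineq4)
    qed
    have "?L \<longleftrightarrow> (\<lambda>k. lux_norm \<Omega> p (\<lambda>x. \<phi> k x - u x)) \<longlonglongrightarrow> 0 \<and> (\<lambda>k. lux_norm \<Omega> p (\<lambda>x. norm (grad (\<phi> k) x - g x))) \<longlonglongrightarrow> 0"
    proof
      assume L: ?L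
      show "(\<lambda>k. lux_norm \<Omega> p (\<lambda>x. \<phi> k x - u x)) \<longlonglongrightarrow> 0 \<and> (\<lambda>k. lux_norm \<Omega> p (\<lambda>x. norm (grad (\<phi> k) x - g x))) \<longlonglongrightarrow> 0"
      proof (intro conjI)
        show "(\<lambda>k. lux_norm \<Omega> p (\<lambda>x. \<phi> k x - u x)) \<longlonglongrightarrow> 0"
          by (rule tendsto_sandwich[OF _ _ tendsto_const L])
            (auto intro!: always_eventually lux_norm_nonneg[OF p 1] lux_norm_nonneg[OF p 2])
        show "(\<lambda>k. lux_norm \<Omega> p (\<lambda>x. norm (grad (\<phi> k) x - g x))) \<longlonglongrightarrow> 0"
          by (rule tendsto_sandwich[OF _ _ tendsto_const L])
            (auto intro!: always_eventually lux_norm_nonneg[OF p 1] lux_norm_nonneg[OF p 2])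
      qed
    next
      assume "(\<lambda>k. lux_norm \<Omega> p (\<lambda>x. \<phi> k x - u x)) \<longlonglongrightarrow> 0 \<and> (\<lambda>k. lux_norm \<Omega> p (\<lambda>x. norm (grad (\<phi> k) x - g x))) \<longlonglongrightarrow> 0"
      then show ?L using tendsto_add[of _ 0 sequentially _ 0] by fastforce
    qed
    also have "\<dots> \<longleftrightarrow> (\<lambda>k. modular \<Omega> p (\<lambda>x. \<phi> k x - u x)) \<longlonglongrightarrow> 0 \<and> (\<lambda>k. modular \<Omega> p (\<lambda>x. norm (grad (\<phi> k) x - g x))) \<longlonglongrightarrow> 0"
      using lux_norm_tendsto_0_iff[OF p 1] lux_norm_tendsto_0_iff[OF p 2] by simp
    finally show ?thesis .
  qed
  then show ?thesis unfolding W0_grad_def modular_approx_def by blast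
qed

lemma W0_gradD:
  assumes "W0_grad \<Omega> p u g"
  shows "weak_grad \<Omega> u g" "u \<in> borel_measurable M" "g \<in> borel_measurable M"
    "u \<in> Lp_var \<Omega> p" "(\<lambda>x. norm (g x)) \<in> Lp_var \<Omega> p"
  using assms weak_gradD(1,2) by (auto simp: W0_grad_def)

lemma W0_grad_0:
  assumes p: "bdd_exponent \<Omega> p l m" shows "W0_grad \<Omega> p (\<lambda>_. 0) (\<lambda>_. 0)"
proof -
  have "modular_approx p (\<lambda>_. 0) (\<lambda>_. 0) (\<lambda>_ _. 0)"
    by (simp add: modular_approx_def test_fun_0 modular_def grad_def)
  then show ?thesis
    by (auto simp: W0_grad_iff[OF p] weak_grad_0 Lp_var_def modular_def)
qed

lemma modular_tendsto_0_lincomb_le: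
  assumes p: "bdd_exponent \<Omega> p l m"
    and meas: "\<And>n. u n \<in> borel_measurable M" "\<And>n. v n \<in> borel_measurable M"
    and lim: "(\<lambda>n. modular \<Omega> p (u n)) \<longlonglongrightarrow> 0" "(\<lambda>n. modular \<Omega> p (v n)) \<longlonglongrightarrow> 0"
    and le: "\<And>n x. x \<in> \<Omega> \<Longrightarrow> \<bar>w n x\<bar> \<le> c * \<bar>u n x\<bar> + c * \<bar>v n x\<bar>" and c: "c \<ge> 1"
  shows "(\<lambda>n. modular \<Omega> p (w n)) \<longlonglongrightarrow> 0"
proof (rule ennreal_tendsto_0_le)
  show "modular \<Omega> p (w n) \<le> ennreal ((2 * c) powr m) * (modular \<Omega> p (u n) + modular \<Omega> p (v n))" for n
    by (intro modular_lincomb_bound[OF p] meas le c)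
  have "(\<lambda>n. ennreal ((2 * c) powr m) * (modular \<Omega> p (u n) + modular \<Omega> p (v n))) \<longlonglongrightarrow> ennreal ((2 * c) powr m) * (0 + 0)"
    by (intro tendsto_intros lim) auto
  then show "(\<lambda>n. ennreal ((2 * c) powr m) * (modular \<Omega> p (u n) + modular \<Omega> p (v n))) \<longlonglongrightarrow> 0" by simp
qed

lemma W0_grad_lincomb:
  assumes p: "bdd_exponent \<Omega> p l m" and u: "W0_grad \<Omega> p u g" and v: "W0_grad \<Omega> p v h"
  shows "W0_grad \<Omega> p (\<lambda>x. c * u x + d * v x) (\<lambda>x. c *\<^sub>R g x + d *\<^sub>R h x)"
proof -
  note [measurable] = W0_gradD(2,3)[OF u] W0_gradD(2,3)[OF v]
  \<comment> \<open>The lower bound 1 is there because \<open>modular_lincomb_bound\<close> asks for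
    a factor c >= 1.\<close>
  define e where "e = max 1 (max \<bar>c\<bar> \<bar>d\<bar>)"
  have e: "e \<ge> 1" "\<bar>c\<bar> \<le> e" "\<bar>d\<bar> \<le> e" by (auto simp: e_def)
  have le: "\<bar>c * a + d * b\<bar> \<le> e * \<bar>a\<bar> + e * \<bar>b\<bar>" for a b :: real
    using e by (intro order_trans[OF abs_triangle_ineq] add_mono) (auto simp: abs_mult intro!: mult_right_mono)
  have len: "norm (c *\<^sub>R a + d *\<^sub>R b) \<le> e * norm a + e * norm b" for a b :: 'a
    using e by (intro order_trans[OF norm_triangle_ineq] add_mono) (auto intro!: mult_right_mono)
  obtain \<phi> \<psi> where \<phi>: "modular_approx p u g \<phi>" and \<psi>: "modular_approx p v h \<psi>"
    using u v by (auto simp: W0_grad_iff[OF p])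
  have tf: "test_fun \<Omega> (\<phi> k)" "test_fun \<Omega> (\<psi> k)" for k using \<phi> \<psi> by (auto simp: modular_approx_def)
  note [measurable] = test_fun_measurable[OF tf(1)] test_fun_measurable[OF tf(2)]
  have sm: "smooth_on UNIV (\<phi> k)" "smooth_on UNIV (\<psi> k)" for k using tf by (auto simp: test_fun_def)
  let ?\<chi> = "\<lambda>k x. c * \<phi> k x + d * \<psi> k x"
  have "modular_approx p (\<lambda>x. c * u x + d * v x) (\<lambda>x. c *\<^sub>R g x + d *\<^sub>R h x) ?\<chi>"
    unfolding modular_approx_def
  proof (intro conjI allI)
    show "test_fun \<Omega> (?\<chi> k)" for k by (intro test_fun_lincomb tf)
    show "(\<lambda>k. modular \<Omega> p (\<lambda>x. ?\<chi> k x - (c * u x + d * v x))) \<longlonglongrightarrow> 0"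
    proof (rule modular_tendsto_0_lincomb_le[OF p, where c=e and u="\<lambda>k x. \<phi> k x - u x" and v="\<lambda>k x. \<psi> k x - v x"])
      show "\<bar>?\<chi> n x - (c * u x + d * v x)\<bar> \<le> e * \<bar>\<phi> n x - u x\<bar> + e * \<bar>\<psi> n x - v x\<bar>" for n x
        using le[of "\<phi> n x - u x" "\<psi> n x - v x"] by (simp add: algebra_simps)
    qed (use \<phi> \<psi> e in \<open>auto simp: modular_approx_def\<close>)
    show "(\<lambda>k. modular \<Omega> p (\<lambda>x. norm (grad (?\<chi> k) x - (c *\<^sub>R g x + d *\<^sub>R h x)))) \<longlonglongrightarrow> 0"
    proof (rule modular_tendsto_0_lincomb_le[OF p, where c=e and u="\<lambda>k x. norm (grad (\<phi> k) x - g x)" and v="\<lambda>k x. norm (grad (\<psi> k) x - h x)"])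
      show "\<bar>norm (grad (?\<chi> n) x - (c *\<^sub>R g x + d *\<^sub>R h x))\<bar> \<le> e * \<bar>norm (grad (\<phi> n) x - g x)\<bar> + e * \<bar>norm (grad (\<psi> n) x - h x)\<bar>" for n x
        using len[of "grad (\<phi> n) x - g x" "grad (\<psi> n) x - h x"] by (simp add: grad_lincomb[OF sm] algebra_simps)
    qed (use \<phi> \<psi> e in \<open>auto simp: modular_approx_def\<close>)
  qed
  moreover have "(\<lambda>x. c * u x + d * v x) \<in> Lp_var \<Omega> p"
    using W0_gradD(4)[OF u] W0_gradD(4)[OF v] by (rule Lp_var_lincomb_le[OF p, where c=e]) (auto intro: le e)
  moreover have "(\<lambda>x. norm (c *\<^sub>R g x + d *\<^sub>R h x)) \<in> Lp_var \<Omega> p"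
    using W0_gradD(5)[OF u] W0_gradD(5)[OF v] by (rule Lp_var_lincomb_le[OF p, where c=e]) (auto intro: len e)
  ultimately show ?thesis
    using weak_grad_lincomb[OF W0_gradD(1)[OF u] W0_gradD(1)[OF v]] by (auto simp: W0_grad_iff[OF p])
qed

text \<open>Membership in the two spaces comes with two gradients a priori; this lets a single weak
  gradient serve both exponents.\<close>

lemma W0_grad_weak_grad:
  assumes p: "bdd_exponent \<Omega> p l m" and u: "W0_grad \<Omega> p u g" and h: "weak_grad \<Omega> u h"
  shows "W0_grad \<Omega> p u h"
proof -
  have AE: "AE x in M. g x = h x" using weak_grad_unique[OF open_\<Omega> W0_gradD(1)[OF u] h] .
  have "modular \<Omega> p (\<lambda>x. norm (grad \<phi> x - g x)) = modular \<Omega> p (\<lambda>x. norm (grad \<phi> x - h x))" for \<phi>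
    using AE by (intro modular_cong_AE) auto
  moreover have "modular \<Omega> p (\<lambda>x. norm (g x)) = modular \<Omega> p (\<lambda>x. norm (h x))"
    using AE by (intro modular_cong_AE) auto
  ultimately show ?thesis
    using u h weak_gradD(2)[OF h] by (auto simp: W0_grad_iff[OF p] modular_approx_def Lp_var_def)
qed

lemma W0_grad_approx:
  assumes p: "bdd_exponent \<Omega> p l m" and u: "W0_grad \<Omega> p u g" and e: "e > 0"
  obtains \<phi> where "test_fun \<Omega> \<phi>" "modular \<Omega> p (\<lambda>x. \<phi> x - u x) < e" "modular \<Omega> p (\<lambda>x. norm (grad \<phi> x - g x)) < e"
proof -
  obtain \<phi> where \<phi>: "modular_approx p u g \<phi>"
    using u by (auto simp: W0_grad_iff[OF p])
  then have "eventually (\<lambda>k. modular \<Omega> p (\<lambda>x. \<phi> k x - u x) < e) sequentially"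
    "eventually (\<lambda>k. modular \<Omega> p (\<lambda>x. norm (grad (\<phi> k) x - g x)) < e) sequentially"
    unfolding modular_approx_def using e by (auto intro: order_tendstoD(2))
  then have "eventually (\<lambda>k. modular \<Omega> p (\<lambda>x. \<phi> k x - u x) < e \<and> modular \<Omega> p (\<lambda>x. norm (grad (\<phi> k) x - g x)) < e) sequentially"
    by (rule eventually_conj)
  then obtain k where "modular \<Omega> p (\<lambda>x. \<phi> k x - u x) < e \<and> modular \<Omega> p (\<lambda>x. norm (grad (\<phi> k) x - g x)) < e"
    using eventually_happens by fastforce
  with \<phi> show ?thesis by (intro that[of "\<phi> k"]) (auto simp: modular_approx_def)
qed

text \<open>The space is closed: a test function is picked within 1/(n+1) of the n-th term, and the
  two errors are added.\<close>

lemma W0_grad_limit: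
  assumes p: "bdd_exponent \<Omega> p l m" and W: "\<And>n. W0_grad \<Omega> p (U n) (G n)"
    and meas: "u \<in> borel_measurable M" "g \<in> borel_measurable M"
    and U: "(\<lambda>n. modular \<Omega> p (\<lambda>x. U n x - u x)) \<longlonglongrightarrow> 0"
    and G: "(\<lambda>n. modular \<Omega> p (\<lambda>x. norm (G n x - g x))) \<longlonglongrightarrow> 0"
  shows "W0_grad \<Omega> p u g"
proof -
  note [measurable] = meas W0_gradD(2,3)[OF W]
  have wg: "weak_grad \<Omega> u g"
  proof (rule weak_grad_limit[OF W0_gradD(1)[OF W] meas])
    show "(\<lambda>n. \<integral>\<^sup>+ x. ennreal \<bar>U n x - u x\<bar> \<partial>M) \<longlonglongrightarrow> 0"
      using U by (intro modular_tendsto_0_imp_L1[OF p _ emeasure_\<Omega>_finite]) auto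
    show "(\<lambda>n. \<integral>\<^sup>+ x. ennreal (norm (G n x - g x)) \<partial>M) \<longlonglongrightarrow> 0"
      using modular_tendsto_0_imp_L1[OF p _ emeasure_\<Omega>_finite G] by simp
  qed
  have "eventually (\<lambda>n. modular \<Omega> p (\<lambda>x. U n x - u x) < \<infinity>) sequentially"
    "eventually (\<lambda>n. modular \<Omega> p (\<lambda>x. norm (G n x - g x)) < \<infinity>) sequentially"
    using order_tendstoD(2)[OF U, of \<infinity>] order_tendstoD(2)[OF G, of \<infinity>] by auto
  then obtain n where n: "modular \<Omega> p (\<lambda>x. U n x - u x) < \<infinity>" "modular \<Omega> p (\<lambda>x. norm (G n x - g x)) < \<infinity>"
    using eventually_happens[OF eventually_conj] by fastforce
  have Lu: "u \<in> Lp_var \<Omega> p"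
    by (rule Lp_var_lincomb_le[OF p, where c=1 and u="U n" and v="\<lambda>x. U n x - u x"])
      (use n W0_gradD(4)[OF W] in \<open>auto simp: Lp_var_def\<close>)
  have Lg: "(\<lambda>x. norm (g x)) \<in> Lp_var \<Omega> p"
    by (rule Lp_var_lincomb_le[OF p, where c=1 and u="\<lambda>x. norm (G n x)" and v="\<lambda>x. norm (G n x - g x)"])
      (use n W0_gradD(5)[OF W] norm_triangle_ineq3 in \<open>auto simp: Lp_var_def norm_triangle_sub norm_minus_commute\<close>)
  have "\<exists>\<phi>. test_fun \<Omega> \<phi> \<and> modular \<Omega> p (\<lambda>x. \<phi> x - U n x) < ennreal (1 / real (Suc n))
      \<and> modular \<Omega> p (\<lambda>x. norm (grad \<phi> x - G n x)) < ennreal (1 / real (Suc n))" for n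
    using W0_grad_approx[OF p W, of "ennreal (1 / real (Suc n))" n] by auto
  then obtain \<phi> where \<phi>: "\<And>n. test_fun \<Omega> (\<phi> n)"
    "\<And>n. modular \<Omega> p (\<lambda>x. \<phi> n x - U n x) < ennreal (1 / real (Suc n))"
    "\<And>n. modular \<Omega> p (\<lambda>x. norm (grad (\<phi> n) x - G n x)) < ennreal (1 / real (Suc n))"
    by metis
  note [measurable] = test_fun_measurable[OF \<phi>(1)]
  have inv: "(\<lambda>n. ennreal (1 / real (Suc n))) \<longlonglongrightarrow> 0"
    using tendsto_ennrealI[OF LIMSEQ_inverse_real_of_nat] by (simp add: inverse_eq_divide)
  have \<phi>U: "(\<lambda>n. modular \<Omega> p (\<lambda>x. \<phi> n x - U n x)) \<longlonglongrightarrow> 0"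
    by (rule ennreal_tendsto_0_le[OF _ inv]) (use \<phi> in \<open>auto intro: less_imp_le\<close>)
  have \<phi>G: "(\<lambda>n. modular \<Omega> p (\<lambda>x. norm (grad (\<phi> n) x - G n x))) \<longlonglongrightarrow> 0"
    by (rule ennreal_tendsto_0_le[OF _ inv]) (use \<phi> in \<open>auto intro: less_imp_le\<close>)
  have "modular_approx p u g \<phi>"
    unfolding modular_approx_def
  proof (intro conjI allI \<phi>)
    show "(\<lambda>k. modular \<Omega> p (\<lambda>x. \<phi> k x - u x)) \<longlonglongrightarrow> 0"
      by (rule modular_tendsto_0_lincomb_le[OF p _ _ \<phi>U U, where c=1]) auto
    show "(\<lambda>k. modular \<Omega> p (\<lambda>x. norm (grad (\<phi> k) x - g x))) \<longlonglongrightarrow> 0"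
    proof (rule modular_tendsto_0_lincomb_le[OF p _ _ \<phi>G G, where c=1])
      show "\<bar>norm (grad (\<phi> n) x - g x)\<bar> \<le> 1 * \<bar>norm (grad (\<phi> n) x - G n x)\<bar> + 1 * \<bar>norm (G n x - g x)\<bar>" for n x
        using norm_triangle_ineq[of "grad (\<phi> n) x - G n x" "G n x - g x"] by simp
    qed auto
  qed
  with wg Lu Lg show ?thesis by (auto simp: W0_grad_iff[OF p])
qed

lemma W0_grad_L1_approx:
  assumes p: "bdd_exponent \<Omega> p l m" and u: "W0_grad \<Omega> p u g"
  obtains \<phi> where "\<And>k. test_fun \<Omega> (\<phi> k)"
    "(\<lambda>k. \<integral>\<^sup>+ x. ennreal \<bar>\<phi> k x - u x\<bar> \<partial>M) \<longlonglongrightarrow> 0"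
    "(\<lambda>k. \<integral>\<^sup>+ x. ennreal (norm (grad (\<phi> k) x - g x)) \<partial>M) \<longlonglongrightarrow> 0"
proof -
  note [measurable] = W0_gradD(2,3)[OF u]
  obtain \<phi> where \<phi>: "modular_approx p u g \<phi>" using u by (auto simp: W0_grad_iff[OF p])
  then have tf: "test_fun \<Omega> (\<phi> k)" for k by (simp add: modular_approx_def)
  note [measurable] = test_fun_measurable[OF tf]
  show ?thesis
  proof (rule that[OF tf])
    show "(\<lambda>k. \<integral>\<^sup>+ x. ennreal \<bar>\<phi> k x - u x\<bar> \<partial>M) \<longlonglongrightarrow> 0"
      using \<phi> by (intro modular_tendsto_0_imp_L1[OF p _ emeasure_\<Omega>_finite]) (auto simp: modular_approx_def)
    show "(\<lambda>k. \<integral>\<^sup>+ x. ennreal (norm (grad (\<phi> k) x - g x)) \<partial>M) \<longlonglongrightarrow> 0"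
      using modular_tendsto_0_imp_L1[OF p _ emeasure_\<Omega>_finite, of "\<lambda>k x. norm (grad (\<phi> k) x - g x)"] \<phi>
      by (auto simp: modular_approx_def)
  qed
qed

end

subsection \<open>The potential estimate\<close>

text \<open>The Riesz kernel of order one. By the convention 0 powr a = 0 it vanishes at the origin,
  also in dimension one, where it is 1 elsewhere.\<close>

definition kern :: "'a::euclidean_space \<Rightarrow> real" where
  "kern w = norm w powr (1 - real DIM('a))"

lemma kern_nonneg: "kern w \<ge> 0" by (simp add: kern_def)

lemma kern_measurable[measurable]: "kern \<in> borel_measurable borel"
  unfolding kern_def[abs_def] by measurable

lemma kern_minus_commute: "kern (x - y) = kern (y - x)"
  by (simp add: kern_def norm_minus_commute)

text \<open>The interval has length r and the integrand is at most r^(-N) on it; the exponent 1 - N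
  of \<open>kern\<close> originates here.\<close>

lemma nn_integral_powr_annulus_le:
  fixes r :: real assumes "r \<ge> 0"
  shows "(\<integral>\<^sup>+t. indicator {r<..<2*r} t * ennreal (1 / t ^ N) \<partial>lborel) \<le> ennreal (r powr (1 - real N))"
proof (cases "r = 0")
  case False
  with assms have r: "r > 0" by simp
  have "(\<integral>\<^sup>+t. indicator {r<..<2*r} t * ennreal (1 / t ^ N) \<partial>lborel) \<le> (\<integral>\<^sup>+t. ennreal (1 / r ^ N) * indicator {r<..<2*r} t \<partial>lborel)"
    using r by (intro nn_integral_mono) (auto simp: indicator_def intro!: ennreal_leI divide_left_mono power_mono)
  also have "\<dots> = ennreal (1 / r ^ N) * ennreal r"
    using r by (simp add: nn_integral_cmult_indicator)
  also have "\<dots> = ennreal (r powr (1 - real N))"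
    using r by (simp add: powr_diff powr_realpow flip: ennreal_mult)
  finally show ?thesis .
qed simp

text \<open>Integrating over rays through an annulus of directions and substituting \<open>y = x + t z\<close>
  produces the Riesz kernel without polar coordinates.\<close>

lemma nn_integral_annulus_rays_le:
  fixes x :: "'a::euclidean_space" and n :: "'a \<Rightarrow> ennreal"
  assumes [measurable]: "n \<in> borel_measurable borel"
  shows "(\<integral>\<^sup>+z. indicator {z. 1/2 < norm z \<and> norm z < 1} z *
      (\<integral>\<^sup>+t. indicator {0<..T} t * n (x + t *\<^sub>R z) \<partial>lborel) \<partial>lborel)
    \<le> (\<integral>\<^sup>+y. n y * ennreal (kern (x - y)) \<partial>lborel)"
proof -
  let ?D = "{z::'a. 1/2 < norm z \<and> norm z < 1}"
  have D[measurable]: "?D \<in> sets borel" by measurable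
  \<comment> \<open>For fixed t the substitution y = x + t z has Jacobian t^N, and the condition 1/2
    < |z| < 1 becomes |x - y| < t < 2 |x - y|.\<close>
  have subst: "(\<integral>\<^sup>+z. indicator ?D z * n (x + t *\<^sub>R z) \<partial>lborel)
      = (\<integral>\<^sup>+y. ennreal (1 / t ^ DIM('a)) * (indicator {norm (x - y)<..<2 * norm (x - y)} t * n y) \<partial>lborel)" if t: "t > 0" for t
  proof -
    have ind: "indicator {norm (x - (x + t *\<^sub>R z))<..<2 * norm (x - (x + t *\<^sub>R z))} t = (indicator ?D z :: ennreal)" for z
      using t by (auto simp: indicator_def field_simps)
    have "(\<integral>\<^sup>+y. ennreal (1 / t ^ DIM('a)) * (indicator {norm (x - y)<..<2 * norm (x - y)} t * n y) \<partial>lborel)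
      = (\<integral>\<^sup>+z. ennreal (\<bar>t\<bar> ^ DIM('a)) * (ennreal (1 / t ^ DIM('a)) *
          (indicator {norm (x - (x + t *\<^sub>R z))<..<2 * norm (x - (x + t *\<^sub>R z))} t * n (x + t *\<^sub>R z))) \<partial>lborel)"
      by (subst lborel_affine[of t x])
        (use t in \<open>simp_all add: nn_integral_density nn_integral_distr indicator_def\<close>)
    also have "\<dots> = (\<integral>\<^sup>+z. indicator ?D z * n (x + t *\<^sub>R z) \<partial>lborel)"
      using t unfolding ind by (intro nn_integral_cong) (simp flip: ennreal_mult mult.assoc)
    finally show ?thesis by simp
  qed
  have "(\<integral>\<^sup>+z. indicator ?D z * (\<integral>\<^sup>+t. indicator {0<..T} t * n (x + t *\<^sub>R z) \<partial>lborel) \<partial>lborel)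
      = (\<integral>\<^sup>+z. \<integral>\<^sup>+t. indicator ?D z * (indicator {0<..T} t * n (x + t *\<^sub>R z)) \<partial>lborel \<partial>lborel)"
    by (simp add: nn_integral_cmult)
  also have "\<dots> = (\<integral>\<^sup>+t. \<integral>\<^sup>+z. indicator ?D z * (indicator {0<..T} t * n (x + t *\<^sub>R z)) \<partial>lborel \<partial>lborel)"
    by (rule lborel_pair.Fubini') measurable
  also have "\<dots> = (\<integral>\<^sup>+t. \<integral>\<^sup>+z. indicator {0<..T} t * (indicator ?D z * n (x + t *\<^sub>R z)) \<partial>lborel \<partial>lborel)"
    by (simp add: mult_ac)
  also have "\<dots> = (\<integral>\<^sup>+t. indicator {0<..T} t * (\<integral>\<^sup>+z. indicator ?D z * n (x + t *\<^sub>R z) \<partial>lborel) \<partial>lborel)"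
    by (simp add: nn_integral_cmult)
  also have "\<dots> = (\<integral>\<^sup>+t. indicator {0<..T} t * (\<integral>\<^sup>+y. ennreal (1 / t ^ DIM('a)) *
      (indicator {norm (x - y)<..<2 * norm (x - y)} t * n y) \<partial>lborel) \<partial>lborel)"
  proof (rule nn_integral_cong)
    fix t
    show "indicator {0<..T} t * (\<integral>\<^sup>+z. indicator ?D z * n (x + t *\<^sub>R z) \<partial>lborel) =
      indicator {0<..T} t * (\<integral>\<^sup>+y. ennreal (1 / t ^ DIM('a)) *
        (indicator {norm (x - y)<..<2 * norm (x - y)} t * n y) \<partial>lborel)"
      by (cases "t \<in> {0<..T}") (subst subst, auto)
  qed
  \<comment> \<open>The cut-off at T is dropped, so the final bound does not depend on the length of
    the rays.\<close>
  also have "\<dots> \<le> (\<integral>\<^sup>+t. (\<integral>\<^sup>+y. ennreal (1 / t ^ DIM('a)) *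
      (indicator {norm (x - y)<..<2 * norm (x - y)} t * n y) \<partial>lborel) \<partial>lborel)"
    by (intro nn_integral_mono) (auto simp: indicator_def)
  also have "\<dots> = (\<integral>\<^sup>+y. (\<integral>\<^sup>+t. ennreal (1 / t ^ DIM('a)) *
      (indicator {norm (x - y)<..<2 * norm (x - y)} t * n y) \<partial>lborel) \<partial>lborel)"
    unfolding indicator_def greaterThanLessThan_iff by (rule lborel_pair.Fubini') measurable
  also have "\<dots> = (\<integral>\<^sup>+y. n y * (\<integral>\<^sup>+t. indicator {norm (x - y)<..<2 * norm (x - y)} t *
      ennreal (1 / t ^ DIM('a)) \<partial>lborel) \<partial>lborel)"
    by (simp add: mult_ac flip: nn_integral_cmult)
  also have "\<dots> \<le> (\<integral>\<^sup>+y. n y * ennreal (kern (x - y)) \<partial>lborel)"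
    unfolding kern_def by (intro nn_integral_mono mult_left_mono nn_integral_powr_annulus_le) auto
  finally show ?thesis .
qed

lemma nn_integral_lebesgue_on_eq_lborel:
  assumes "S \<in> sets borel"
  shows "(\<integral>\<^sup>+x. f x \<partial>lebesgue_on S) = (\<integral>\<^sup>+x. f x * indicator S x \<partial>lborel)"
  using assms by (simp add: nn_integral_restrict_space nn_integral_completion)

text \<open>The normalising constant of the potential estimate. Averaging over an annulus of
  directions instead of a sphere keeps everything within Lebesgue measure.\<close>

definition annulus_vol :: "'a::euclidean_space itself \<Rightarrow> real" where
  "annulus_vol _ = measure lborel {z::'a. 1/2 < norm z \<and> norm z < 1}"

lemma emeasure_annulus:
  "emeasure lborel {z::'a::euclidean_space. 1/2 < norm z \<and> norm z < 1} = ennreal (annulus_vol TYPE('a))"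
  "annulus_vol TYPE('a) > 0"
proof -
  let ?D = "{z::'a. 1/2 < norm z \<and> norm z < 1}"
  have op: "open ?D" by (intro open_Collect_conj open_Collect_less continuous_intros)
  have "?D \<subseteq> ball 0 1" by auto
  then have "bounded ?D" using bounded_ball bounded_subset by blast
  then have fin: "?D \<in> fmeasurable lborel" using op
    by (metis borel_open emeasure_bounded_finite fmeasurableI sets_lborel)
  then show 1: "emeasure lborel ?D = ennreal (annulus_vol TYPE('a))"
    unfolding annulus_vol_def by (simp add: emeasure_eq_measure2 fmeasurableD2)
  obtain b :: 'a where "b \<in> Basis" using nonempty_Basis by blast
  \<comment> \<open>Points within 1/8 of a vector of norm 3/4 have norm between 5/8 and 7/8.\<close>
  then have "ball ((3/4) *\<^sub>R b) (1/8) \<subseteq> ?D"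
  proof (intro subsetI)
    fix z assume "z \<in> ball ((3/4) *\<^sub>R b) (1/8)"
    then show "z \<in> ?D"
      using \<open>b \<in> Basis\<close> norm_triangle_ineq3[of "(3/4) *\<^sub>R b" z] by (auto simp: dist_norm)
  qed
  then have "emeasure lborel (ball ((3/4) *\<^sub>R b) (1/8)) \<le> emeasure lborel ?D"
    using op by (intro emeasure_mono) auto
  moreover have "emeasure lborel (ball ((3/4) *\<^sub>R b) (1/8)) > 0"
    by (simp add: emeasure_ball)
  ultimately show "annulus_vol TYPE('a) > 0" using 1
    by (metis ennreal_less_zero_iff less_le_trans)
qed

text \<open>At parameter 4 R the ray has left the domain, since |z| > 1/2, so \<phi> vanishes at its
  end. The fundamental theorem of calculus along the ray and |z| < 1 give the bound.\<close>

lemma (in bounded_domain) test_fun_le_ray_integral: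
  assumes \<phi>: "test_fun \<Omega> \<phi>" and R: "R > 0" "\<Omega> \<subseteq> ball 0 R" and x: "x \<in> \<Omega>" and z: "1/2 < norm z" "norm z < 1"
  shows "ennreal \<bar>\<phi> x\<bar> \<le> (\<integral>\<^sup>+t. indicator {0<..4*R} t * ennreal (norm (grad \<phi> (x + t *\<^sub>R z))) \<partial>lborel)"
proof -
  have sm: "smooth_on UNIV \<phi>" using \<phi> by (simp add: test_fun_def)
  have "R = 4 * R * (1/2) - R" by simp
  also have "\<dots> \<le> 4 * R * norm z - norm x"
    using R x z by (intro diff_mono mult_left_mono) auto
  also have "\<dots> \<le> norm ((4*R) *\<^sub>R z + x)"
    using norm_diff_ineq[of "(4*R) *\<^sub>R z" x] R by simp
  finally have "x + (4*R) *\<^sub>R z \<notin> \<Omega>" using R(2) by (auto simp: add.commute)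
  then have end0: "\<phi> (x + (4*R) *\<^sub>R z) = 0" by (rule test_fun_eq_0[OF \<phi>])
  define F where "F t = grad \<phi> (x + t *\<^sub>R z) \<bullet> z" for t
  have F: "continuous_on {0..4*R} F" unfolding F_def
    by (intro continuous_intros continuous_on_compose2[OF smooth_on_continuous_grad[OF sm]]) auto
  have "((\<lambda>t. \<phi> (x + t *\<^sub>R z)) has_vector_derivative F t) (at t within {0..4*R})" for t
  proof -
    have "((\<lambda>t. \<phi> (x + t *\<^sub>R z)) has_derivative (\<lambda>s. frechet_derivative \<phi> (at (x + t *\<^sub>R z)) (s *\<^sub>R z))) (at t within {0..4*R})"
      by (rule has_derivative_compose[where g=\<phi>, OF _ smooth_on_has_derivative[OF sm]])
        (auto intro!: derivative_eq_intros)
    then show ?thesis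
      by (simp add: has_vector_derivative_def F_def frechet_derivative_eq_inner_grad[OF sm])
  qed
  then have "has_bochner_integral lborel (\<lambda>t. indicator {0..4*R} t *\<^sub>R F t) (\<phi> (x + (4*R) *\<^sub>R z) - \<phi> (x + 0 *\<^sub>R z))"
    using R F by (intro has_bochner_integral_FTC_Icc) auto
  then have "norm (\<phi> (x + (4*R) *\<^sub>R z) - \<phi> (x + 0 *\<^sub>R z)) \<le> (\<integral>\<^sup>+t. norm (indicator {0..4*R} t *\<^sub>R F t) \<partial>lborel)"
    by (rule has_bochner_integral_norm_bound)
  also have "\<dots> \<le> (\<integral>\<^sup>+t. indicator {0<..4*R} t * ennreal (norm (grad \<phi> (x + t *\<^sub>R z))) \<partial>lborel)"
  proof (rule nn_integral_mono_AE)
    \<comment> \<open>The endpoint 0 is removed because the substitution in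
      \<open>nn_integral_annulus_rays_le\<close> needs t > 0.\<close>
    have "AE t in lborel. t \<noteq> (0::real)" by (rule AE_lborel_singleton)
    then show "AE t in lborel. ennreal (norm (indicator {0..4*R} t *\<^sub>R F t)) \<le> indicator {0<..4*R} t * ennreal (norm (grad \<phi> (x + t *\<^sub>R z)))"
    proof eventually_elim
      case (elim t)
      have "\<bar>F t\<bar> \<le> norm (grad \<phi> (x + t *\<^sub>R z)) * norm z"
        unfolding F_def by (rule Cauchy_Schwarz_ineq2)
      also have "\<dots> \<le> norm (grad \<phi> (x + t *\<^sub>R z))" using z by (simp add: mult_left_le)
      finally show ?case using elim by (auto simp: indicator_def)
    qed
  qed
  finally show ?thesis using end0 by simp
qed

text \<open>The ray bound is integrated over the annulus of directions z, which produces the factor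
  \<open>annulus_vol\<close> on the left and the kernel on the right.\<close>

lemma (in bounded_domain) test_fun_le_potential:
  assumes \<phi>: "test_fun \<Omega> \<phi>" and x: "x \<in> \<Omega>"
  shows "ennreal (annulus_vol TYPE('a)) * ennreal \<bar>\<phi> x\<bar> \<le> (\<integral>\<^sup>+y. ennreal (norm (grad \<phi> y)) * ennreal (kern (x - y)) \<partial>M)"
proof -
  let ?D = "{z::'a. 1/2 < norm z \<and> norm z < 1}"
  have sm: "smooth_on UNIV \<phi>" using \<phi> by (simp add: test_fun_def)
  have [measurable]: "grad \<phi> \<in> borel_measurable borel"
    using smooth_on_continuous_grad[OF sm] by (rule borel_measurable_continuous_onI)
  have D: "?D \<in> sets lborel" by measurable
  obtain R where R: "R > 0" "\<Omega> \<subseteq> ball 0 R" using bounded_\<Omega> bounded_subset_ballD by blast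
  have "ennreal (annulus_vol TYPE('a)) * ennreal \<bar>\<phi> x\<bar> = (\<integral>\<^sup>+z. ennreal \<bar>\<phi> x\<bar> * indicator ?D z \<partial>lborel)"
    by (subst nn_integral_cmult_indicator[OF D], subst emeasure_annulus) (rule mult.commute)
  also have "\<dots> \<le> (\<integral>\<^sup>+z. indicator ?D z *
      (\<integral>\<^sup>+t. indicator {0<..4*R} t * ennreal (norm (grad \<phi> (x + t *\<^sub>R z))) \<partial>lborel) \<partial>lborel)"
    using test_fun_le_ray_integral[OF \<phi> R x] by (intro nn_integral_mono) (auto simp: indicator_def)
  also have "\<dots> \<le> (\<integral>\<^sup>+y. ennreal (norm (grad \<phi> y)) * ennreal (kern (x - y)) \<partial>lborel)"
    by (rule nn_integral_annulus_rays_le[of "\<lambda>y. ennreal (norm (grad \<phi> y))"]) measurable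
  also have "\<dots> = (\<integral>\<^sup>+y. ennreal (norm (grad \<phi> y)) * ennreal (kern (x - y)) \<partial>M)"
    using open_\<Omega> test_fun_grad_eq_0_outside[OF \<phi>]
    by (subst nn_integral_lebesgue_on_eq_lborel) (auto intro!: nn_integral_cong simp: indicator_def)
  finally show ?thesis .
qed

section \<open>Integrability of the Riesz kernel and bounds for its potential\<close>

lemma ennreal_le_suminf: fixes a :: "nat \<Rightarrow> ennreal" shows "a j \<le> suminf a"
  using sum_le_suminf[of a "{j}"] by simp

text \<open>Dyadic decomposition: where R 2^(-k-1) <= |w| < R 2^(-k) the integrand is at most (R
  2^(-k-1))^(-\<gamma>), while the ball of radius R 2^(-k) has volume proportional to 2^(-k N). The
  resulting series is geometric with ratio 2^(\<gamma> - N) < 1.\<close>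

lemma nn_integral_norm_powr_ball_finite:
  fixes \<gamma> R :: real
  assumes \<gamma>: "0 \<le> \<gamma>" "\<gamma> < real DIM('a::euclidean_space)" and R: "R > 0"
  shows "(\<integral>\<^sup>+w. indicator (ball 0 R) w * ennreal (norm w powr (- \<gamma>)) \<partial>(lborel :: 'a measure)) < \<infinity>"
proof -
  define r where "r k = R * (1/2) ^ k" for k :: nat
  have r: "r k > 0" for k using R by (simp add: r_def)
  define q where "q = 2 powr \<gamma> * (1/2) ^ DIM('a)"
  have q: "0 \<le> q" "q < 1"
  proof -
    have "2 powr \<gamma> < 2 powr real DIM('a)" using \<gamma> by (intro powr_less_mono) auto
    then show "q < 1" by (simp add: q_def powr_realpow field_simps power_divide)
  qed (simp add: q_def)
  define C where "C = unit_ball_vol (real DIM('a)) * R ^ DIM('a) * (R / 2) powr (- \<gamma>)"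
  have C: "C \<ge> 0" using R by (simp add: C_def)
  have "(\<integral>\<^sup>+w. indicator (ball 0 R) w * ennreal (norm w powr (- \<gamma>)) \<partial>(lborel :: 'a measure))
      \<le> (\<integral>\<^sup>+w. (\<Sum>k. ennreal (r (Suc k) powr (- \<gamma>)) * indicator (ball 0 (r k)) w) \<partial>(lborel :: 'a measure))"
  proof (rule nn_integral_mono)
    fix w :: 'a
    show "indicator (ball 0 R) w * ennreal (norm w powr (- \<gamma>)) \<le> (\<Sum>k. ennreal (r (Suc k) powr (- \<gamma>)) * indicator (ball 0 (r k)) w)"
    proof (cases "w \<in> ball 0 R \<and> w \<noteq> 0")
      case True
      have "r \<longlonglongrightarrow> R * 0" unfolding r_def by (intro tendsto_intros LIMSEQ_realpow_zero) auto
      then have "r \<longlonglongrightarrow> 0" by simp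
      then have "eventually (\<lambda>k. r k < norm w) sequentially"
        by (rule order_tendstoD(2)) (use True in auto)
      then have ex: "\<exists>k. r k \<le> norm w" by (auto simp: eventually_sequentially intro: less_imp_le)
      \<comment> \<open>The first dyadic radius not exceeding |w|. It is not the radius R itself, so
        its predecessor j exists and w lies in the shell between the two.\<close>
      define k where "k = (LEAST k. r k \<le> norm w)"
      have k: "r k \<le> norm w" unfolding k_def using ex by (rule LeastI_ex)
      have "k \<noteq> 0" by (rule notI) (use k True in \<open>simp add: r_def\<close>)
      then obtain j where j: "k = Suc j" by (cases k) auto
      have "norm w < r j" using not_less_Least[of j "\<lambda>k. r k \<le> norm w"] j by (auto simp: k_def)
      then have "indicator (ball 0 R) w * ennreal (norm w powr (- \<gamma>)) \<le> ennreal (r (Suc j) powr (- \<gamma>)) * indicator (ball 0 (r j)) w"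
        using True k j \<gamma> r[of k] by (auto intro!: ennreal_leI powr_mono2')
      also have "\<dots> \<le> (\<Sum>k. ennreal (r (Suc k) powr (- \<gamma>)) * indicator (ball 0 (r k)) w)"
        by (rule ennreal_le_suminf)
      finally show ?thesis .
    next
      case False
      \<comment> \<open>At the singularity w = 0 the convention 0 powr a = 0 applies.\<close>
      then have "indicator (ball 0 R) w * ennreal (norm w powr (- \<gamma>)) = 0" by (cases "w = 0") auto
      then show ?thesis by (metis zero_le)
    qed
  qed
  also have "\<dots> = (\<Sum>k. \<integral>\<^sup>+w. ennreal (r (Suc k) powr (- \<gamma>)) * indicator (ball 0 (r k)) w \<partial>(lborel :: 'a measure))"
    by (rule nn_integral_suminf, intro borel_measurable_times_ennreal borel_measurable_const borel_measurable_indicator) simp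
  also have "\<dots> = (\<Sum>k. ennreal (C * q ^ k))"
  proof (rule suminf_cong)
    fix k
    have "r (Suc k) powr (- \<gamma>) = (R / 2) powr (- \<gamma>) * (2 powr \<gamma>) ^ k"
    proof -
      have "r (Suc k) = (R / 2) * (1/2) ^ k" by (simp add: r_def)
      then have "r (Suc k) powr (- \<gamma>) = (R / 2) powr (- \<gamma>) * ((1/2) ^ k) powr (- \<gamma>)"
        using R by (simp only: powr_mult)
      also have "(1/2::real) ^ k = 2 powr (- real k)"
        by (simp add: powr_minus powr_realpow power_one_over inverse_eq_divide)
      also have "(2 powr (- real k)) powr (- \<gamma>) = (2 powr \<gamma>) ^ k"
        by (simp add: powr_powr powr_power mult.commute)
      finally show ?thesis .
    qed
    then have "r (Suc k) powr (- \<gamma>) * (unit_ball_vol (real DIM('a)) * r k ^ DIM('a)) = C * q ^ k"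
      by (simp add: C_def q_def r_def power_mult_distrib power_commutes mult_ac flip: power_mult)
    then show "(\<integral>\<^sup>+w. ennreal (r (Suc k) powr (- \<gamma>)) * indicator (ball 0 (r k)) w \<partial>(lborel :: 'a measure)) = ennreal (C * q ^ k)"
      using r[of k] by (simp add: nn_integral_cmult_indicator emeasure_ball flip: ennreal_mult)
  qed
  also have "\<dots> < \<infinity>"
    using q C by (subst suminf_ennreal2) (auto intro!: summable_mult summable_geometric)
  finally show ?thesis .
qed

context bounded_domain
begin

sublocale MM: pair_sigma_finite M M ..

text \<open>M carries the Lebesgue sets while \<open>kern\<close> is a Borel function; Borel
  measurability of the projections makes x - y, hence the kernel, measurable for the
  product.\<close>

lemma fst_snd_borel_measurable:
  "fst \<in> borel_measurable (M \<Otimes>\<^sub>M M)" "snd \<in> borel_measurable (M \<Otimes>\<^sub>M M)"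
proof -
  have "(\<lambda>x. x) \<in> borel_measurable M"
    by (intro continuous_imp_measurable_lebesgue_on continuous_on_id)
  from measurable_compose[OF measurable_fst this] measurable_compose[OF measurable_snd this]
  show "fst \<in> borel_measurable (M \<Otimes>\<^sub>M M)" "snd \<in> borel_measurable (M \<Otimes>\<^sub>M M)" by blast+
qed

lemma kern_diff_measurable[measurable]:
  "(\<lambda>z. kern (fst z - snd z)) \<in> borel_measurable (M \<Otimes>\<^sub>M M)"
  "(\<lambda>z. kern (snd z - fst z)) \<in> borel_measurable (M \<Otimes>\<^sub>M M)"
  by (intro measurable_compose[OF borel_measurable_diff kern_measurable] fst_snd_borel_measurable)+

lemma kern_diff_measurable_M[measurable]:
  "(\<lambda>y. kern (x - y)) \<in> borel_measurable M" "(\<lambda>y. kern (y - x)) \<in> borel_measurable M"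
proof -
  have "(\<lambda>x. x) \<in> borel_measurable M"
    by (intro continuous_imp_measurable_lebesgue_on continuous_on_id)
  then show "(\<lambda>y. kern (x - y)) \<in> borel_measurable M" "(\<lambda>y. kern (y - x)) \<in> borel_measurable M"
    by (intro measurable_compose[OF borel_measurable_diff kern_measurable] borel_measurable_const; simp)+
qed

text \<open>The condition on S is integrability of kern^S at its singularity. Translating x to the
  origin moves the domain into the ball of radius 2 R, so the bound is uniform in x.\<close>

lemma nn_integral_kern_powr_bound:
  assumes S: "0 \<le> S" "(real DIM('a) - 1) * S < real DIM('a)"
  obtains C where "C \<ge> 0" "\<And>x. x \<in> \<Omega> \<Longrightarrow> (\<integral>\<^sup>+y. ennreal (kern (x - y) powr S) \<partial>M) \<le> ennreal C"
proof -
  obtain R where R: "R > 0" "\<Omega> \<subseteq> ball 0 R" using bounded_\<Omega> bounded_subset_ballD by blast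
  define \<gamma> where "\<gamma> = (real DIM('a) - 1) * S"
  have \<gamma>: "0 \<le> \<gamma>" "\<gamma> < real DIM('a)" using S DIM_positive[where 'a='a] by (auto simp: \<gamma>_def)
  have kS: "kern w powr S = norm w powr (- \<gamma>)" for w :: 'a
    by (simp add: kern_def powr_powr \<gamma>_def algebra_simps)
  let ?I = "\<integral>\<^sup>+w. indicator (ball 0 (2*R)) w * ennreal (norm w powr (- \<gamma>)) \<partial>(lborel :: 'a measure)"
  have "?I < \<infinity>" using R by (intro nn_integral_norm_powr_ball_finite \<gamma>) auto
  then obtain C where C: "C \<ge> 0" "?I = ennreal C" by (cases ?I) auto
  have "(\<integral>\<^sup>+y. ennreal (kern (x - y) powr S) \<partial>M) \<le> ennreal C" if x: "x \<in> \<Omega>" for x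
  proof -
    have "(\<integral>\<^sup>+y. ennreal (kern (x - y) powr S) \<partial>M) = (\<integral>\<^sup>+y. ennreal (kern (x - y) powr S) * indicator \<Omega> y \<partial>lborel)"
      using open_\<Omega> by (intro nn_integral_lebesgue_on_eq_lborel) auto
    also have "\<dots> \<le> (\<integral>\<^sup>+y. indicator (ball 0 (2*R)) (y - x) * ennreal (norm (y - x) powr (- \<gamma>)) \<partial>lborel)"
    proof (rule nn_integral_mono)
      fix y
      have "norm (y - x) < 2 * R" if "y \<in> \<Omega>"
      proof -
        have "norm y < R" "norm x < R" using R(2) x that by auto
        then show ?thesis using norm_triangle_ineq4[of y x] by linarith
      qed
      then show "ennreal (kern (x - y) powr S) * indicator \<Omega> y \<le> indicator (ball 0 (2*R)) (y - x) * ennreal (norm (y - x) powr (- \<gamma>))"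
        by (auto simp: indicator_def kS norm_minus_commute)
    qed
    also have "\<dots> = ?I"
    proof -
      have "?I = (\<integral>\<^sup>+w. indicator (ball 0 (2*R)) w * ennreal (norm w powr (- \<gamma>)) \<partial>distr lborel borel ((+) (- x)))"
        by (simp add: lborel_distr_plus)
      also have "\<dots> = (\<integral>\<^sup>+y. indicator (ball 0 (2*R)) (- x + y) * ennreal (norm (- x + y) powr (- \<gamma>)) \<partial>lborel)"
      proof -
        have [measurable]: "ball (0::'a) (2*R) \<in> sets borel" by simp
        have "(\<lambda>w::'a. indicator (ball 0 (2*R)) w * ennreal (norm w powr (- \<gamma>))) \<in> borel_measurable borel"
          by (intro borel_measurable_times_ennreal borel_measurable_indicator) measurable
        then show ?thesis by (intro nn_integral_distr) auto
      qed
      finally show ?thesis by simp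
    qed
    finally show ?thesis using C by simp
  qed
  with C(1) show ?thesis by (rule that[of C])
qed

definition potential :: "('a \<Rightarrow> 'a) \<Rightarrow> 'a \<Rightarrow> ennreal" where
  "potential g x = (\<integral>\<^sup>+y. ennreal (norm (g y)) * ennreal (kern (x - y)) \<partial>M)"

lemma potential_measurable[measurable (raw)]:
  assumes [measurable]: "g \<in> borel_measurable M"
  shows "potential g \<in> borel_measurable M"
  unfolding potential_def[abs_def] by measurable

text \<open>Fubini's theorem and the kernel bound with S = 1. It carries convergence of gradients in
  mean over to their potentials.\<close>

lemma potential_L1_bound:
  obtains C where "C \<ge> 0" "\<And>g :: 'a \<Rightarrow> 'a. g \<in> borel_measurable M \<Longrightarrow>
    (\<integral>\<^sup>+x. potential g x \<partial>M) \<le> ennreal C * (\<integral>\<^sup>+y. ennreal (norm (g y)) \<partial>M)"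
proof -
  obtain C where C: "C \<ge> 0" "\<And>x. x \<in> \<Omega> \<Longrightarrow> (\<integral>\<^sup>+y. ennreal (kern (x - y) powr 1) \<partial>M) \<le> ennreal C"
    using nn_integral_kern_powr_bound[of 1] by auto
  show ?thesis
  proof (rule that[OF C(1)])
    fix g :: "'a \<Rightarrow> 'a" assume [measurable]: "g \<in> borel_measurable M"
    have "(\<integral>\<^sup>+x. potential g x \<partial>M) = (\<integral>\<^sup>+y. \<integral>\<^sup>+x. ennreal (norm (g y)) * ennreal (kern (x - y)) \<partial>M \<partial>M)"
      unfolding potential_def by (rule MM.Fubini') measurable
    also have "\<dots> = (\<integral>\<^sup>+y. ennreal (norm (g y)) * (\<integral>\<^sup>+x. ennreal (kern (y - x)) \<partial>M) \<partial>M)"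
      by (intro nn_integral_cong, subst nn_integral_cmult[symmetric]) (auto simp: kern_minus_commute)
    also have "\<dots> \<le> (\<integral>\<^sup>+y. ennreal (norm (g y)) * ennreal C \<partial>M)"
      using C(2) by (intro nn_integral_mono mult_left_mono) (auto simp: kern_nonneg)
    also have "\<dots> = ennreal C * (\<integral>\<^sup>+y. ennreal (norm (g y)) \<partial>M)"
      by (subst nn_integral_multc) (auto simp: mult.commute)
    finally show "(\<integral>\<^sup>+x. potential g x \<partial>M) \<le> ennreal C * (\<integral>\<^sup>+y. ennreal (norm (g y)) \<partial>M)" .
  qed
qed

lemma potential_add_le:
  assumes [measurable]: "g \<in> borel_measurable M" "h \<in> borel_measurable M"
  shows "potential (\<lambda>x. g x + h x) x \<le> potential g x + potential h x"
proof -
  have "potential (\<lambda>x. g x + h x) x \<le> (\<integral>\<^sup>+y. ennreal (norm (g y)) * ennreal (kern (x - y)) + ennreal (norm (h y)) * ennreal (kern (x - y)) \<partial>M)"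
    unfolding potential_def
    by (intro nn_integral_mono) (auto simp flip: distrib_right ennreal_plus intro!: mult_right_mono ennreal_leI norm_triangle_ineq)
  also have "\<dots> = potential g x + potential h x"
    unfolding potential_def by (rule nn_integral_add) measurable
  finally show ?thesis .
qed

text \<open>Subtraction in \<open>ennreal\<close> truncates at zero, so the claim says that the
  truncated defect vanishes almost everywhere. Its integral is at most the sum of the two
  approximation errors of a test function, for every k, hence zero.\<close>

lemma W0_grad_le_potential:
  assumes p: "bdd_exponent \<Omega> p l m" and u: "W0_grad \<Omega> p u g"
  shows "AE x in M. ennreal (annulus_vol TYPE('a)) * ennreal \<bar>u x\<bar> \<le> potential g x"
proof -
  define A where "A = annulus_vol TYPE('a)"
  have A: "A > 0" using emeasure_annulus(2) by (simp add: A_def)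
  note [measurable] = W0_gradD(2,3)[OF u]
  obtain \<phi> where \<phi>: "\<And>k. test_fun \<Omega> (\<phi> k)"
    "(\<lambda>k. \<integral>\<^sup>+ x. ennreal \<bar>\<phi> k x - u x\<bar> \<partial>M) \<longlonglongrightarrow> 0"
    "(\<lambda>k. \<integral>\<^sup>+ x. ennreal (norm (grad (\<phi> k) x - g x)) \<partial>M) \<longlonglongrightarrow> 0"
    using W0_grad_L1_approx[OF p u] by blast
  note [measurable] = test_fun_measurable[OF \<phi>(1)]
  obtain C where C: "C \<ge> 0" "\<And>g :: 'a \<Rightarrow> 'a. g \<in> borel_measurable M \<Longrightarrow>
    (\<integral>\<^sup>+x. potential g x \<partial>M) \<le> ennreal C * (\<integral>\<^sup>+y. ennreal (norm (g y)) \<partial>M)"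
    using potential_L1_bound by blast
  let ?I = "\<integral>\<^sup>+x. ennreal A * ennreal \<bar>u x\<bar> - potential g x \<partial>M"
  have "?I \<le> ennreal A * (\<integral>\<^sup>+ x. ennreal \<bar>\<phi> k x - u x\<bar> \<partial>M) + ennreal C * (\<integral>\<^sup>+ x. ennreal (norm (grad (\<phi> k) x - g x)) \<partial>M)" for k
  proof -
    have "?I \<le> (\<integral>\<^sup>+x. ennreal A * ennreal \<bar>\<phi> k x - u x\<bar> + potential (\<lambda>x. grad (\<phi> k) x - g x) x \<partial>M)"
    proof (rule nn_integral_mono)
      fix x assume "x \<in> space M"
      then have x: "x \<in> \<Omega>" by simp
      have "ennreal A * ennreal \<bar>u x\<bar> \<le> ennreal A * ennreal \<bar>\<phi> k x - u x\<bar> + ennreal A * ennreal \<bar>\<phi> k x\<bar>"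
        using A by (auto simp flip: ennreal_mult ennreal_plus distrib_left intro!: ennreal_leI mult_left_mono)
      also have "ennreal A * ennreal \<bar>\<phi> k x\<bar> \<le> potential (grad (\<phi> k)) x"
        unfolding A_def potential_def by (rule test_fun_le_potential[OF \<phi>(1) x])
      also have "potential (grad (\<phi> k)) x \<le> potential (\<lambda>x. grad (\<phi> k) x - g x) x + potential g x"
        using potential_add_le[of "\<lambda>x. grad (\<phi> k) x - g x" g x] by simp
      finally show "ennreal A * ennreal \<bar>u x\<bar> - potential g x \<le> ennreal A * ennreal \<bar>\<phi> k x - u x\<bar> + potential (\<lambda>x. grad (\<phi> k) x - g x) x"
        by (auto simp: ennreal_minus_le_iff add_ac ennreal_mult_eq_top_iff)
    qed
    also have "\<dots> = ennreal A * (\<integral>\<^sup>+ x. ennreal \<bar>\<phi> k x - u x\<bar> \<partial>M) + (\<integral>\<^sup>+ x. potential (\<lambda>x. grad (\<phi> k) x - g x) x \<partial>M)"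
      by (simp add: nn_integral_add nn_integral_cmult)
    also have "\<dots> \<le> ennreal A * (\<integral>\<^sup>+ x. ennreal \<bar>\<phi> k x - u x\<bar> \<partial>M) + ennreal C * (\<integral>\<^sup>+ x. ennreal (norm (grad (\<phi> k) x - g x)) \<partial>M)"
      by (intro add_left_mono C(2)) measurable
    finally show ?thesis .
  qed
  moreover have "(\<lambda>k. ennreal A * (\<integral>\<^sup>+ x. ennreal \<bar>\<phi> k x - u x\<bar> \<partial>M) + ennreal C * (\<integral>\<^sup>+ x. ennreal (norm (grad (\<phi> k) x - g x)) \<partial>M))
      \<longlonglongrightarrow> ennreal A * 0 + ennreal C * 0"
    by (intro tendsto_intros \<phi>) auto
  ultimately have "?I \<le> 0"
    by (intro LIMSEQ_le_const[where X="\<lambda>k. ennreal A * (\<integral>\<^sup>+ x. ennreal \<bar>\<phi> k x - u x\<bar> \<partial>M) + ennreal C * (\<integral>\<^sup>+ x. ennreal (norm (grad (\<phi> k) x - g x)) \<partial>M)"]) auto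
  then have "?I = 0" by simp
  then have "AE x in M. ennreal A * ennreal \<bar>u x\<bar> - potential g x = 0"
    by (subst (asm) nn_integral_0_iff_AE) auto
  then show ?thesis unfolding A_def[symmetric]
    by eventually_elim (auto simp: diff_eq_0_iff_ennreal)
qed

end

subsection \<open>A trilinear estimate\<close>

text \<open>The two larger numbers X, Y suffice: since the exponents sum to at most 2, the power of
  the smallest one is at most X^(1-s) Y^(1-t), which completes X^s Y^t to X Y. Products of only two
  factors can be integrated by Fubini's theorem.\<close>

lemma powr3_le_sum_products:
  fixes F G K :: real
  assumes "F \<ge> 1" "G \<ge> 1" "K \<ge> 1" "0 \<le> a" "a \<le> 1" "0 \<le> b" "b \<le> 1" "0 \<le> c" "c \<le> 1" "a + b + c \<le> 2"
  shows "F powr a * G powr b * K powr c \<le> F * G + F * K + G * K"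
proof -
  have key: "X powr s * Y powr t * Z powr r \<le> X * Y"
    if "1 \<le> Z" "Z \<le> X" "Z \<le> Y" "0 \<le> s" "s \<le> 1" "0 \<le> t" "t \<le> 1" "0 \<le> r" "s + t + r \<le> 2" for X Y Z s t r :: real
  proof -
    have "Z powr r \<le> Z powr ((1 - s) + (1 - t))" using that by (intro powr_mono) auto
    also have "\<dots> = Z powr (1 - s) * Z powr (1 - t)" by (rule powr_add)
    also have "\<dots> \<le> X powr (1 - s) * Y powr (1 - t)" using that by (intro mult_mono powr_mono2) auto
    finally have "X powr s * Y powr t * Z powr r \<le> X powr s * Y powr t * (X powr (1 - s) * Y powr (1 - t))"
      by (intro mult_left_mono) auto
    also have "\<dots> = (X powr s * X powr (1 - s)) * (Y powr t * Y powr (1 - t))" by (simp add: mult_ac)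
    also have "\<dots> = X * Y" using that by (simp flip: powr_add)
    finally show ?thesis .
  qed
  have pos: "F * G \<ge> 0" "F * K \<ge> 0" "G * K \<ge> 0" using assms by auto
  consider "K \<le> F \<and> K \<le> G" | "G \<le> F \<and> G \<le> K" | "F \<le> G \<and> F \<le> K" by linarith
  then show ?thesis
  proof cases
    case 1 then have "F powr a * G powr b * K powr c \<le> F * G" using key[of K F G a b c] assms pos by auto then show ?thesis using pos by linarith
  next
    case 2 then have "F powr a * G powr b * K powr c \<le> F * K" using key[of G F K a c b] assms pos by (auto simp: mult_ac) then show ?thesis using pos by linarith
  next
    case 3 then have "F powr a * G powr b * K powr c \<le> G * K" using key[of F G K b c a] assms pos by (auto simp: mult_ac) then show ?thesis using pos by linarith
  qed
qed

lemma le_one_plus_powr_powr: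
  fixes h a :: real assumes "h \<ge> 0" "a > 0" shows "h \<le> (1 + h powr a) powr (1 / a)"
proof -
  have "h = (h powr a) powr (1 / a)" using assms by (simp add: powr_powr)
  also have "\<dots> \<le> (1 + h powr a) powr (1 / a)" using assms by (intro powr_mono2) auto
  finally show ?thesis .
qed

lemma le_one_plus_powr:
  fixes h a :: real assumes "h \<ge> 0" "a \<ge> 1" shows "h \<le> 1 + h powr a"
proof -
  have "(1 + h powr a) powr (1 / a) \<le> (1 + h powr a) powr 1"
    using assms by (intro powr_mono) (auto simp: powr_ge_zero)
  also have "\<dots> = 1 + h powr a" using powr_ge_zero[of h a] by (subst powr_one) auto
  finally have "(1 + h powr a) powr (1 / a) \<le> 1 + h powr a" .
  with le_one_plus_powr_powr[of h a] assms show ?thesis by auto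
qed

context bounded_domain
begin

text \<open>Near the diagonal, 1/q y differs little from 1/q x, so the subcriticality at the single
  point x controls all three exponents. Away from the diagonal the kernel is bounded and exponents
  above 1 are enough. Plain uniform continuity of 1/q therefore suffices.\<close>

lemma trilinear_pointwise:
  assumes ne: "\<Omega> \<noteq> {}"
    and a: "continuous_on (closure \<Omega>) a" "\<And>x. x \<in> closure \<Omega> \<Longrightarrow> 1 < a x"
    and q: "continuous_on (closure \<Omega>) q" "\<And>x. x \<in> closure \<Omega> \<Longrightarrow> 1 < q x"
    and sub: "\<And>x. x \<in> closure \<Omega> \<Longrightarrow> 1 / a x + 1 / q x < 1 + 1 / real DIM('a)"
  obtains L S where "L \<ge> 1" "S > 0" "(real DIM('a) - 1) * S < real DIM('a)"
    "\<And>x y h g. x \<in> \<Omega> \<Longrightarrow> y \<in> \<Omega> \<Longrightarrow> 0 \<le> h \<Longrightarrow> 0 \<le> g \<Longrightarrow> h * (g * kern (x - y)) \<le>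
       L * ((1 + h powr a x) * (1 + g powr q y)) + (1 + h powr a x) * (1 + kern (x - y) powr S)
       + (1 + g powr q y) * (1 + kern (x - y) powr S)"
proof -
  define N where "N = real DIM('a)"
  have N: "N \<ge> 1" using DIM_positive[where 'a='a] by (simp add: N_def Suc_leI)
  have cpt: "compact (closure \<Omega>)" using bounded_\<Omega> by (simp add: compact_closure)
  have inv_q: "continuous_on (closure \<Omega>) (\<lambda>x. 1 / q x)"
    using q by (intro continuous_intros) fastforce+
  have "continuous_on (closure \<Omega>) (\<lambda>x. 1 / a x + 1 / q x)"
    using a q by (intro continuous_intros) fastforce+
  then obtain x0 where x0: "x0 \<in> closure \<Omega>" "\<And>x. x \<in> closure \<Omega> \<Longrightarrow> 1 / a x + 1 / q x \<le> 1 / a x0 + 1 / q x0"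
    using continuous_attains_sup[OF cpt, of "\<lambda>x. 1 / a x + 1 / q x"] ne by auto
  \<comment> \<open>Half of the smallest slack in the exponent condition: one e absorbs the
    oscillation of 1/q, the other lifts \<theta> = 1/S strictly above 1 - 1/N. The cap 1/N keeps
    \<theta> at most 1.\<close>
  define e where "e = min (1 / N) ((1 + 1 / N - (1 / a x0 + 1 / q x0)) / 2)"
  have e: "e > 0" "e \<le> 1 / N" using sub[OF x0(1)] N by (auto simp: e_def N_def)
  have e2: "1 / a x + 1 / q x + 2 * e \<le> 1 + 1 / N" if "x \<in> closure \<Omega>" for x
  proof -
    have "2 * e \<le> 1 + 1 / N - (1 / a x0 + 1 / q x0)" by (simp add: e_def min_def)
    with x0(2)[OF that] show ?thesis by linarith
  qed
  have "uniformly_continuous_on (closure \<Omega>) (\<lambda>x. 1 / q x)"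
    using inv_q cpt by (rule compact_uniformly_continuous)
  then obtain d where d: "d > 0" "\<And>x y. x \<in> closure \<Omega> \<Longrightarrow> y \<in> closure \<Omega> \<Longrightarrow> dist y x < d \<Longrightarrow> dist (1 / q y) (1 / q x) < e"
    unfolding uniformly_continuous_on_def using e(1) by meson
  define \<theta> where "\<theta> = 1 - 1 / N + e"
  have "1 / N \<le> 1" using N by simp
  with e have \<theta>: "\<theta> > 0" "\<theta> \<le> 1" "1 - 1 / N < \<theta>" unfolding \<theta>_def by linarith+
  \<comment> \<open>The power bounds the kernel at distance at least d; the summand 1 lets the same
    L serve near the diagonal.\<close>
  define L where "L = 1 + d powr (1 - N)"
  have L: "L \<ge> 1" by (simp add: L_def)
  show ?thesis
  proof (rule that[of L "1 / \<theta>"])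
    show "L \<ge> 1" "1 / \<theta> > 0" using L \<theta> by auto
    show "(real DIM('a) - 1) * (1 / \<theta>) < real DIM('a)"
      using \<theta> N unfolding N_def[symmetric] by (simp add: field_simps)
    fix x y and h g :: real assume xy: "x \<in> \<Omega>" "y \<in> \<Omega>" and hg: "0 \<le> h" "0 \<le> g"
    then have xyc: "x \<in> closure \<Omega>" "y \<in> closure \<Omega>" using closure_subset by auto
    define F where "F = 1 + h powr a x"
    define G where "G = 1 + g powr q y"
    define K where "K = 1 + kern (x - y) powr (1 / \<theta>)"
    have FGK: "F \<ge> 1" "G \<ge> 1" "K \<ge> 1" by (auto simp: F_def G_def K_def)
    have ax: "a x > 1" and qy: "q y > 1" using a(2) q(2) xyc by auto
    have "h * (g * kern (x - y)) \<le> L * (F * G) + F * K + G * K"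
    proof (cases "norm (y - x) < d")
      case True
      have "\<bar>1 / q y - 1 / q x\<bar> < e" using d(2)[OF xyc] True by (simp add: dist_norm)
      \<comment> \<open>Replacing 1/q x by 1/q y costs less than e, and \<theta> adds 1 - 1/N + e;
        the sum is at most (1 + 1/N) + (1 - 1/N).\<close>
      then have s: "1 / a x + 1 / q y + \<theta> \<le> 2" using e2[OF xyc(1)] by (auto simp: \<theta>_def)
      have "h \<le> F powr (1 / a x)" "g \<le> G powr (1 / q y)" "kern (x - y) \<le> K powr \<theta>"
        using le_one_plus_powr_powr[of h "a x"] le_one_plus_powr_powr[of g "q y"]
          le_one_plus_powr_powr[of "kern (x - y)" "1 / \<theta>"] hg ax qy \<theta> kern_nonneg[of "x - y"]
        by (auto simp: F_def G_def K_def)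
      then have "h * (g * kern (x - y)) \<le> F powr (1 / a x) * (G powr (1 / q y) * K powr \<theta>)"
        using hg kern_nonneg[of "x - y"] by (intro mult_mono) auto
      also have "\<dots> \<le> F * G + F * K + G * K"
        using powr3_le_sum_products[OF FGK, of "1 / a x" "1 / q y" \<theta>] s ax qy \<theta> by (simp add: mult.assoc)
      also have "F * G \<le> L * (F * G)" using L FGK mult_right_mono[of 1 L "F * G"] by simp
      finally show ?thesis by simp
    next
      case False
      have "kern (x - y) \<le> d powr (1 - N)"
        unfolding kern_def N_def[symmetric] using False d(1) N
        by (intro powr_mono2') (auto simp: norm_minus_commute)
      also have "\<dots> \<le> L" by (simp add: L_def)
      finally have k: "kern (x - y) \<le> L" .
      have "h \<le> F" "g \<le> G" using le_one_plus_powr[of h "a x"] le_one_plus_powr[of g "q y"] hg ax qy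
        by (auto simp: F_def G_def)
      with k have "h * (g * kern (x - y)) \<le> F * (G * L)"
        using hg kern_nonneg[of "x - y"] L FGK by (intro mult_mono) auto
      also have "\<dots> \<le> L * (F * G) + F * K + G * K" using FGK by (simp add: mult_ac)
      finally show ?thesis .
    qed
    then show "h * (g * kern (x - y)) \<le> L * ((1 + h powr a x) * (1 + g powr q y)) + (1 + h powr a x) * (1 + kern (x - y) powr (1 / \<theta>))
       + (1 + g powr q y) * (1 + kern (x - y) powr (1 / \<theta>))"
      by (simp add: F_def G_def K_def)
  qed
qed

text \<open>Each product on the right of \<open>trilinear_pointwise\<close> involves two factors, so
  one variable can be integrated out first; the kernel factor then leaves a constant uniform in the
  other variable.\<close>

lemma trilinear_bound:
  assumes ne: "\<Omega> \<noteq> {}"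
    and a: "continuous_on (closure \<Omega>) a" "\<And>x. x \<in> closure \<Omega> \<Longrightarrow> 1 < a x"
    and q: "continuous_on (closure \<Omega>) q" "\<And>x. x \<in> closure \<Omega> \<Longrightarrow> 1 < q x"
    and sub: "\<And>x. x \<in> closure \<Omega> \<Longrightarrow> 1 / a x + 1 / q x < 1 + 1 / real DIM('a)"
  obtains C where "C \<ge> 0" "\<And>h g. h \<in> borel_measurable M \<Longrightarrow> g \<in> borel_measurable M \<Longrightarrow>
    (\<integral>\<^sup>+x. ennreal \<bar>h x\<bar> * (\<integral>\<^sup>+y. ennreal \<bar>g y\<bar> * ennreal (kern (x - y)) \<partial>M) \<partial>M)
      \<le> ennreal C * ((1 + modular \<Omega> a h) * (1 + modular \<Omega> q g))"
proof -
  obtain L S where L: "L \<ge> 1" and S: "S > 0" "(real DIM('a) - 1) * S < real DIM('a)"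
    and pt: "\<And>x y h g. x \<in> \<Omega> \<Longrightarrow> y \<in> \<Omega> \<Longrightarrow> 0 \<le> h \<Longrightarrow> 0 \<le> g \<Longrightarrow> h * (g * kern (x - y)) \<le>
       L * ((1 + h powr a x) * (1 + g powr q y)) + (1 + h powr a x) * (1 + kern (x - y) powr S)
       + (1 + g powr q y) * (1 + kern (x - y) powr S)"
    using trilinear_pointwise[OF ne a q sub] by blast
  obtain c where c: "c \<ge> 0" "\<And>x. x \<in> \<Omega> \<Longrightarrow> (\<integral>\<^sup>+y. ennreal (kern (x - y) powr S) \<partial>M) \<le> ennreal c"
    using nn_integral_kern_powr_bound[of S] S by auto
  \<comment> \<open>Being at least 1, V can be factored out of volume plus modular.\<close>
  define V where "V = max 1 (measure M \<Omega>)"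
  have V: "V \<ge> 1" "emeasure M \<Omega> \<le> ennreal V"
    by (auto simp: V_def emeasure_eq_measure intro!: ennreal_leI)
  have [measurable]: "a \<in> borel_measurable M" "q \<in> borel_measurable M"
    using a(1) q(1) closure_subset by (auto intro!: continuous_on_imp_measurable intro: continuous_on_subset)
  define K where "K z = ennreal (1 + kern z powr S)" for z :: 'a
  have K[measurable]: "(\<lambda>z. K (fst z - snd z)) \<in> borel_measurable (M \<Otimes>\<^sub>M M)"
    "(\<lambda>z. K (snd z - fst z)) \<in> borel_measurable (M \<Otimes>\<^sub>M M)"
    "(\<lambda>y. K (x - y)) \<in> borel_measurable M" "(\<lambda>y. K (y - x)) \<in> borel_measurable M" for x
    unfolding K_def by measurable
  have Kint: "(\<integral>\<^sup>+y. K (x - y) \<partial>M) \<le> ennreal (V + c)" if "x \<in> \<Omega>" for x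
  proof -
    have "(\<integral>\<^sup>+y. K (x - y) \<partial>M) = emeasure M \<Omega> + (\<integral>\<^sup>+y. ennreal (kern (x - y) powr S) \<partial>M)"
      unfolding K_def by (simp add: nn_integral_add)
    also have "\<dots> \<le> ennreal V + ennreal c" using V(2) c(2)[OF that] by (rule add_mono)
    finally show ?thesis using V c by simp
  qed
  show ?thesis
  proof (rule that[of "L * V * V + (V + c) * V + (V + c) * V"])
    show "L * V * V + (V + c) * V + (V + c) * V \<ge> 0" using L V c by simp
    fix h g :: "'a \<Rightarrow> real" assume [measurable]: "h \<in> borel_measurable M" "g \<in> borel_measurable M"
    define F where "F x = ennreal (1 + \<bar>h x\<bar> powr a x)" for x
    define G where "G y = ennreal (1 + \<bar>g y\<bar> powr q y)" for y
    have [measurable]: "F \<in> borel_measurable M" "G \<in> borel_measurable M" unfolding F_def G_def by measurable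
    define A where "A = 1 + modular \<Omega> a h"
    define B where "B = 1 + modular \<Omega> q g"
    have AB: "A \<le> A * B" "B \<le> A * B"
      using mult_left_mono[of 1 B A] mult_right_mono[of 1 A B] by (auto simp: A_def B_def)
    have IF: "(\<integral>\<^sup>+x. F x \<partial>M) \<le> ennreal V * A"
    proof -
      have "(\<integral>\<^sup>+x. F x \<partial>M) = emeasure M \<Omega> + modular \<Omega> a h"
        unfolding F_def modular_def by (simp add: nn_integral_add)
      also have "\<dots> \<le> ennreal V * 1 + ennreal V * modular \<Omega> a h"
        using V mult_right_mono[of 1 "ennreal V" "modular \<Omega> a h"] by (intro add_mono) auto
      finally show ?thesis by (simp add: A_def distrib_left)
    qed
    have IG: "(\<integral>\<^sup>+x. G x \<partial>M) \<le> ennreal V * B"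
    proof -
      have "(\<integral>\<^sup>+x. G x \<partial>M) = emeasure M \<Omega> + modular \<Omega> q g"
        unfolding G_def modular_def by (simp add: nn_integral_add)
      also have "\<dots> \<le> ennreal V * 1 + ennreal V * modular \<Omega> q g"
        using V mult_right_mono[of 1 "ennreal V" "modular \<Omega> q g"] by (intro add_mono) auto
      finally show ?thesis by (simp add: B_def distrib_left)
    qed
    have "(\<integral>\<^sup>+x. ennreal \<bar>h x\<bar> * (\<integral>\<^sup>+y. ennreal \<bar>g y\<bar> * ennreal (kern (x - y)) \<partial>M) \<partial>M)
      = (\<integral>\<^sup>+x. \<integral>\<^sup>+y. ennreal \<bar>h x\<bar> * (ennreal \<bar>g y\<bar> * ennreal (kern (x - y))) \<partial>M \<partial>M)"
      by (intro nn_integral_cong nn_integral_cmult[symmetric]) measurable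
    also have "\<dots> \<le> (\<integral>\<^sup>+x. \<integral>\<^sup>+y. (ennreal L * F x * G y + F x * K (x - y)) + G y * K (x - y) \<partial>M \<partial>M)"
    proof (intro nn_integral_mono)
      fix x y assume "x \<in> space M" "y \<in> space M"
      then have "\<bar>h x\<bar> * (\<bar>g y\<bar> * kern (x - y)) \<le>
       L * ((1 + \<bar>h x\<bar> powr a x) * (1 + \<bar>g y\<bar> powr q y)) + (1 + \<bar>h x\<bar> powr a x) * (1 + kern (x - y) powr S)
       + (1 + \<bar>g y\<bar> powr q y) * (1 + kern (x - y) powr S)" by (intro pt) auto
      then show "ennreal \<bar>h x\<bar> * (ennreal \<bar>g y\<bar> * ennreal (kern (x - y))) \<le> (ennreal L * F x * G y + F x * K (x - y)) + G y * K (x - y)"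
        using L kern_nonneg[of "x - y"] unfolding F_def G_def K_def
        by (simp add: mult.assoc flip: ennreal_mult ennreal_plus)
    qed
    also have "\<dots> = (\<integral>\<^sup>+x. (ennreal L * F x * (\<integral>\<^sup>+y. G y \<partial>M) + F x * (\<integral>\<^sup>+y. K (x - y) \<partial>M)) + (\<integral>\<^sup>+y. G y * K (x - y) \<partial>M) \<partial>M)"
      by (simp add: nn_integral_add nn_integral_cmult)
    also have "\<dots> \<le> (\<integral>\<^sup>+x. (ennreal L * F x * (ennreal V * B) + F x * ennreal (V + c)) + (\<integral>\<^sup>+y. G y * K (x - y) \<partial>M) \<partial>M)"
      by (intro nn_integral_mono add_mono mult_left_mono IG Kint) auto
    also have "\<dots> = ennreal L * (\<integral>\<^sup>+x. F x \<partial>M) * (ennreal V * B) + (\<integral>\<^sup>+x. F x \<partial>M) * ennreal (V + c)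
        + (\<integral>\<^sup>+x. \<integral>\<^sup>+y. G y * K (x - y) \<partial>M \<partial>M)"
      by (simp add: nn_integral_add nn_integral_cmult nn_integral_multc)
    also have "(\<integral>\<^sup>+x. \<integral>\<^sup>+y. G y * K (x - y) \<partial>M \<partial>M) = (\<integral>\<^sup>+y. \<integral>\<^sup>+x. G y * K (x - y) \<partial>M \<partial>M)"
      by (rule MM.Fubini') measurable
    also have "\<dots> = (\<integral>\<^sup>+y. G y * (\<integral>\<^sup>+x. K (y - x) \<partial>M) \<partial>M)"
      by (intro nn_integral_cong, subst nn_integral_cmult[symmetric]) (auto simp: K_def kern_minus_commute)
    also have "\<dots> \<le> (\<integral>\<^sup>+y. G y * ennreal (V + c) \<partial>M)"
      by (intro nn_integral_mono mult_left_mono Kint) auto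
    also have "\<dots> = (\<integral>\<^sup>+y. G y \<partial>M) * ennreal (V + c)" by (simp add: nn_integral_multc)
    also have "ennreal L * (\<integral>\<^sup>+x. F x \<partial>M) * (ennreal V * B) + (\<integral>\<^sup>+x. F x \<partial>M) * ennreal (V + c) + (\<integral>\<^sup>+y. G y \<partial>M) * ennreal (V + c)
      \<le> ennreal L * (ennreal V * A) * (ennreal V * B) + (ennreal V * A) * ennreal (V + c) + (ennreal V * B) * ennreal (V + c)"
      by (intro add_mono mult_mono IF IG order_refl) auto
    also have "\<dots> = ennreal (L * V * V) * (A * B) + ennreal ((V + c) * V) * A + ennreal ((V + c) * V) * B"
      using L V c by (simp add: ennreal_mult mult_ac)
    also have "\<dots> \<le> ennreal (L * V * V) * (A * B) + ennreal ((V + c) * V) * (A * B) + ennreal ((V + c) * V) * (A * B)"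
      by (intro add_mono mult_left_mono AB order_refl) auto
    also have "\<dots> = ennreal (L * V * V + (V + c) * V + (V + c) * V) * (A * B)"
    proof -
      have "0 \<le> L * V * V" "0 \<le> (V + c) * V" using L V c by simp_all
      then show ?thesis by (simp only: ennreal_plus add_nonneg_nonneg distrib_right)
    qed
    finally show "(\<integral>\<^sup>+x. ennreal \<bar>h x\<bar> * (\<integral>\<^sup>+y. ennreal \<bar>g y\<bar> * ennreal (kern (x - y)) \<partial>M) \<partial>M)
      \<le> ennreal (L * V * V + (V + c) * V + (V + c) * V) * ((1 + modular \<Omega> a h) * (1 + modular \<Omega> q g))"
      unfolding A_def B_def by (simp add: add_left_mono)
  qed
qed

end

subsection \<open>Uniform convexity of powers of the norm\<close>

lemma powr_MVT:
  fixes p a b :: real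
  assumes p: "1 < p" and ab: "0 \<le> a" "a < b"
  shows "\<exists>z>a. z < b \<and> b powr p - a powr p = (b - a) * (p * z powr (p - 1))"
proof -
  have "\<exists>l z. a < z \<and> z < b \<and> DERIV (\<lambda>x. x powr p) z :> l \<and> b powr p - a powr p = (b - a) * l"
  proof (rule MVT[OF ab(2)])
    show "continuous_on {a..b} (\<lambda>x. x powr p)"
      using p ab by (intro continuous_on_powr' continuous_intros) auto
    show "(\<lambda>x. x powr p) differentiable at x" if "a < x" "x < b" for x
      using has_real_derivative_powr[of x p] that ab unfolding real_differentiable_def by auto
  qed
  then obtain l z where z: "a < z" "z < b" "DERIV (\<lambda>x. x powr p) z :> l" "b powr p - a powr p = (b - a) * l" by blast
  moreover have "l = p * z powr (p - 1)"
    using DERIV_unique[OF z(3) has_real_derivative_powr] z ab by auto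
  ultimately show ?thesis by blast
qed

text \<open>The mean slopes on the two halves of the interval are compared; p > 1 makes the
  derivative strictly increasing.\<close>

lemma powr_midpoint_strict:
  fixes p s t :: real
  assumes p: "1 < p" and st: "0 \<le> s" "s < t"
  shows "2 * ((s + t) / 2) powr p < s powr p + t powr p"
proof -
  define r where "r = (s + t) / 2"
  have r: "s < r" "r < t" "t - r = r - s" using st by (auto simp: r_def field_simps)
  obtain c where c: "s < c" "c < r" "r powr p - s powr p = (r - s) * (p * c powr (p - 1))" using powr_MVT[OF p, of s r] st r by blast
  obtain d where d: "r < d" "d < t" "t powr p - r powr p = (t - r) * (p * d powr (p - 1))" using powr_MVT[OF p, of r t] st r by auto
  have "c powr (p - 1) < d powr (p - 1)" using c d st p by (intro powr_less_mono2) auto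
  then have "(r - s) * (p * c powr (p - 1)) < (t - r) * (p * d powr (p - 1))"
    using r p by simp
  then show ?thesis using c(3) d(3) unfolding r_def by linarith
qed

lemma powr_midpoint:
  fixes p s t :: real
  assumes "1 < p" "0 \<le> s" "0 \<le> t"
  shows "2 * ((s + t) / 2) powr p \<le> s powr p + t powr p"
  using powr_midpoint_strict[of p s t] powr_midpoint_strict[of p t s] assms
  by (cases s t rule: linorder_cases) (auto simp: add.commute)

text \<open>The defect in midpoint convexity of the p-th power of the norm. The midpoint is written
  as a linear combination so that it matches \<open>X_lincomb\<close>.\<close>

definition convexity_gap :: "real \<Rightarrow> 'a::real_inner \<Rightarrow> 'a \<Rightarrow> real" where
  "convexity_gap p \<xi> \<eta> = (norm \<xi> powr p + norm \<eta> powr p) / 2 - norm ((1/2) *\<^sub>R \<xi> + (1/2) *\<^sub>R \<eta>) powr p"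

lemma norm_midpoint_powr_le:
  fixes \<xi> \<eta> :: "'a::real_inner"
  assumes "1 < p"
  shows "norm ((1/2) *\<^sub>R \<xi> + (1/2) *\<^sub>R \<eta>) powr p \<le> ((norm \<xi> + norm \<eta>) / 2) powr p"
  using assms norm_triangle_ineq[of "(1/2) *\<^sub>R \<xi>" "(1/2) *\<^sub>R \<eta>"] by (intro powr_mono2) (auto simp: field_simps)

lemma convexity_gap_nonneg: "1 < p \<Longrightarrow> convexity_gap p \<xi> \<eta> \<ge> 0"
  using norm_midpoint_powr_le[of p \<xi> \<eta>] powr_midpoint[of p "norm \<xi>" "norm \<eta>"]
  by (simp add: convexity_gap_def field_simps)

text \<open>Strict convexity of t^p forces equal norms. Then the midpoint has the same norm too, and
  the parallelogram law makes the difference zero.\<close>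

lemma convexity_gap_eq_0:
  fixes \<xi> \<eta> :: "'a::real_inner"
  assumes p: "1 < p" and 0: "convexity_gap p \<xi> \<eta> = 0"
  shows "\<xi> = \<eta>"
proof -
  have "norm \<xi> = norm \<eta>"
  proof (rule ccontr)
    assume "norm \<xi> \<noteq> norm \<eta>"
    then have "2 * ((norm \<xi> + norm \<eta>) / 2) powr p < norm \<xi> powr p + norm \<eta> powr p"
      using powr_midpoint_strict[of p "norm \<xi>" "norm \<eta>"] powr_midpoint_strict[of p "norm \<eta>" "norm \<xi>"] p
      by (cases "norm \<xi>" "norm \<eta>" rule: linorder_cases) (auto simp: add.commute)
    with norm_midpoint_powr_le[OF p, of \<xi> \<eta>] 0 show False by (simp add: convexity_gap_def)
  qed
  with 0 have "norm ((1/2) *\<^sub>R \<xi> + (1/2) *\<^sub>R \<eta>) powr p = norm \<eta> powr p"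
    by (simp add: convexity_gap_def)
  then have "(norm ((1/2) *\<^sub>R \<xi> + (1/2) *\<^sub>R \<eta>) powr p) powr (1/p) = (norm \<eta> powr p) powr (1/p)" by simp
  then have "norm ((1/2) *\<^sub>R \<xi> + (1/2) *\<^sub>R \<eta>) = norm \<eta>" using p by (simp add: powr_powr)
  then have "(norm ((1/2) *\<^sub>R \<xi> + (1/2) *\<^sub>R \<eta>))\<^sup>2 = (norm \<eta>)\<^sup>2" by simp
  moreover have "(norm \<xi>)\<^sup>2 = (norm \<eta>)\<^sup>2" using \<open>norm \<xi> = norm \<eta>\<close> by simp
  ultimately have "(norm (\<xi> - \<eta>))\<^sup>2 = 0"
    by (simp add: power2_norm_eq_inner inner_simps inner_commute algebra_simps)
  then show ?thesis by simp
qed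

lemma convexity_gap_scale:
  "r \<ge> 0 \<Longrightarrow> convexity_gap p (r *\<^sub>R \<xi>) (r *\<^sub>R \<eta>) = r powr p * convexity_gap p \<xi> \<eta>"
proof -
  assume "r \<ge> 0"
  have "(1/2) *\<^sub>R (r *\<^sub>R \<xi>) + (1/2) *\<^sub>R (r *\<^sub>R \<eta>) = r *\<^sub>R ((1/2) *\<^sub>R \<xi> + (1/2) *\<^sub>R \<eta>)"
    by (simp add: algebra_simps)
  with \<open>r \<ge> 0\<close> show ?thesis unfolding convexity_gap_def by (simp only: norm_scaleR powr_mult) (simp add: powr_mult algebra_simps)
qed

lemma continuous_on_norm_powr:
  fixes f :: "'b::topological_space \<Rightarrow> 'a::real_normed_vector"
  assumes "continuous_on S f" "continuous_on S p" "\<And>x. x \<in> S \<Longrightarrow> 0 < (p x :: real)"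
  shows "continuous_on S (\<lambda>x. norm (f x) powr p x)"
  using assms by (intro continuous_on_powr' continuous_intros) auto

text \<open>By homogeneity it suffices to treat unit pairs; there compactness makes the strict convexity
  uniform in the exponent.\<close>

lemma uniform_convexity:
  fixes e l m :: real
  assumes e: "e > 0" and l: "1 < l"
  obtains C where "C \<ge> 0" "\<And>p (\<xi>::'a::euclidean_space) \<eta>. l \<le> p \<Longrightarrow> p \<le> m \<Longrightarrow>
    norm (\<xi> - \<eta>) powr p \<le> e * (norm \<xi> powr p + norm \<eta> powr p) + C * convexity_gap p \<xi> \<eta>"
proof -
  define K where "K = {l..m} \<times> sphere (0::'a \<times> 'a) 1"
  define A where "A z = e * (norm (fst (snd z)) powr fst z + norm (snd (snd z)) powr fst z)
      - norm (fst (snd z) - snd (snd z)) powr fst z" for z :: "real \<times> 'a \<times> 'a"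
  define B where "B z = convexity_gap (fst z) (fst (snd z)) (snd (snd z))" for z :: "real \<times> 'a \<times> 'a"
  have pos: "0 < fst z" "1 < fst z" if "z \<in> K" for z using that l by (auto simp: K_def)
  have cA: "continuous_on K A" unfolding A_def
    by (intro continuous_intros continuous_on_norm_powr pos)
  have cB: "continuous_on K B" unfolding B_def convexity_gap_def
    by (intro continuous_intros continuous_on_norm_powr pos) auto
  have K: "compact K" unfolding K_def by (intro compact_Times compact_sphere) auto
  \<comment> \<open>Off this set the term with e suffices alone. On it the gap has a positive
    minimum: a zero gap means equal vectors, for which A is positive.\<close>
  define K' where "K' = {z \<in> K. A z \<le> 0}"
  have K': "compact K'"
  proof -
    have "closed (K \<inter> A -` {..0})" using cA K by (intro continuous_closed_preimage) (auto simp: compact_imp_closed)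
    then have "compact (K \<inter> (K \<inter> A -` {..0}))" using K by (rule compact_Int_closed[rotated])
    moreover have "K \<inter> (K \<inter> A -` {..0}) = K'" by (auto simp: K'_def)
    ultimately show ?thesis by simp
  qed
  have Bpos: "B z > 0" if z: "z \<in> K'" for z
  proof (rule ccontr)
    assume "\<not> B z > 0"
    have zK: "z \<in> K" using z by (simp add: K'_def)
    have "B z \<ge> 0" unfolding B_def by (rule convexity_gap_nonneg[OF pos(2)[OF zK]])
    with \<open>\<not> B z > 0\<close> have "B z = 0" by simp
    then have eq: "fst (snd z) = snd (snd z)" unfolding B_def by (rule convexity_gap_eq_0[OF pos(2)[OF zK]])
    have "norm (snd z) = 1" using z by (auto simp: K'_def K_def)
    then have "snd (snd z) \<noteq> 0" using eq by (metis norm_zero prod.collapse zero_neq_one zero_prod_def)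
    then have "A z > 0" using e eq unfolding A_def by simp
    with z show False by (simp add: K'_def)
  qed
  obtain b where b: "b > 0" "\<And>z. z \<in> K' \<Longrightarrow> b \<le> B z"
  proof (cases "K' = {}")
    case True then show ?thesis by (intro that[of 1]) auto
  next
    case False
    then obtain z where "z \<in> K'" "\<And>y. y \<in> K' \<Longrightarrow> B z \<le> B y"
      using continuous_attains_inf[OF K' False, of B] continuous_on_subset[OF cB, of K'] by (auto simp: K'_def)
    then show ?thesis using Bpos by (intro that[of "B z"]) auto
  qed
  \<comment> \<open>For a unit pair |\<xi> - \<eta>|^p is at most 2^m, so this C pays for it
    wherever the gap is at least b.\<close>
  define C where "C = 2 powr m / b"
  have C: "C \<ge> 0" using b by (simp add: C_def)
  have AB: "A z + C * B z \<ge> 0" if z: "z \<in> K" for z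
  proof (cases "A z \<le> 0")
    case False
    moreover have "C * B z \<ge> 0"
      unfolding B_def using C convexity_gap_nonneg[OF pos(2)[OF z]] by (intro mult_nonneg_nonneg)
    ultimately show ?thesis by linarith
  next
    case True
    then have "b \<le> B z" using b z by (auto simp: K'_def)
    then have "C * b \<le> C * B z" using C by (intro mult_left_mono)
    then have 1: "2 powr m \<le> C * B z" using b by (simp add: C_def)
    obtain p \<xi> \<eta> where zz: "z = (p, \<xi>, \<eta>)" by (cases z)
    have p: "l \<le> p" "p \<le> m" and n: "norm (\<xi>, \<eta>) = 1" using z by (auto simp: K_def zz)
    have "norm (\<xi> - \<eta>) \<le> 2"
      using norm_triangle_ineq4[of \<xi> \<eta>] norm_fst_le[of \<xi> \<eta>] norm_snd_le[of \<eta> \<xi>] n by linarith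
    then have "norm (\<xi> - \<eta>) powr p \<le> 2 powr p" using p l by (intro powr_mono2) auto
    also have "\<dots> \<le> 2 powr m" using p by (intro powr_mono) auto
    finally have "norm (\<xi> - \<eta>) powr p \<le> 2 powr m" .
    moreover have "A z \<ge> - (norm (\<xi> - \<eta>) powr p)" unfolding A_def zz using e by simp
    ultimately show ?thesis using 1 by linarith
  qed
  show ?thesis
  proof (rule that[OF C])
    fix p :: real and \<xi> \<eta> :: 'a assume p: "l \<le> p" "p \<le> m"
    show "norm (\<xi> - \<eta>) powr p \<le> e * (norm \<xi> powr p + norm \<eta> powr p) + C * convexity_gap p \<xi> \<eta>"
    proof (cases "norm (\<xi>, \<eta>) = 0")
      case True
      then have "\<xi> = 0" "\<eta> = 0" by (auto simp: zero_prod_def)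
      then show ?thesis by (simp add: convexity_gap_def)
    next
      case False
      define r where "r = norm (\<xi>, \<eta>)"
      have r: "r > 0" using False by (simp add: r_def)
      define \<xi>' \<eta>' where "\<xi>' = (1/r) *\<^sub>R \<xi>" and "\<eta>' = (1/r) *\<^sub>R \<eta>"
      have eqs: "\<xi> = r *\<^sub>R \<xi>'" "\<eta> = r *\<^sub>R \<eta>'" using r by (auto simp: \<xi>'_def \<eta>'_def)
      have "(\<xi>', \<eta>') = (1/r) *\<^sub>R (\<xi>, \<eta>)" by (simp add: \<xi>'_def \<eta>'_def)
      then have "norm (\<xi>', \<eta>') = \<bar>1/r\<bar> * r" unfolding r_def by (simp only: norm_scaleR)
      then have "norm (\<xi>', \<eta>') = 1" using r by simp
      then have "(p, \<xi>', \<eta>') \<in> K" using p by (simp add: K_def)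
      from AB[OF this] have "norm (\<xi>' - \<eta>') powr p \<le> e * (norm \<xi>' powr p + norm \<eta>' powr p) + C * convexity_gap p \<xi>' \<eta>'"
        by (simp add: A_def B_def)
      then have "r powr p * norm (\<xi>' - \<eta>') powr p \<le> r powr p * (e * (norm \<xi>' powr p + norm \<eta>' powr p) + C * convexity_gap p \<xi>' \<eta>')"
        by (intro mult_left_mono) auto
      moreover have "norm (\<xi> - \<eta>) powr p = r powr p * norm (\<xi>' - \<eta>') powr p"
        unfolding eqs using r by (simp add: powr_mult flip: scaleR_diff_right)
      moreover have "norm \<xi> powr p = r powr p * norm \<xi>' powr p" "norm \<eta> powr p = r powr p * norm \<eta>' powr p"
        unfolding eqs using r by (simp_all add: powr_mult)
      moreover have "convexity_gap p \<xi> \<eta> = r powr p * convexity_gap p \<xi>' \<eta>'"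
        unfolding eqs using r by (intro convexity_gap_scale) auto
      ultimately show ?thesis by (simp add: algebra_simps)
    qed
  qed
qed

subsection \<open>Poincare inequality and continuity of the load\<close>

lemma C_plus_bdd_exponent:
  assumes "C_plus \<Omega> p" "bounded \<Omega>" "open \<Omega>" "\<Omega> \<noteq> {}"
  obtains l m where "bdd_exponent \<Omega> p l m"
proof -
  have cont: "continuous_on (closure \<Omega>) p" and gt: "\<And>x. x \<in> closure \<Omega> \<Longrightarrow> p x > 1"
    using assms(1) by (auto simp: C_plus_def)
  have cpt: "compact (closure \<Omega>)" "closure \<Omega> \<noteq> {}" using assms by (auto simp: compact_closure)
  obtain x where x: "x \<in> closure \<Omega>" "\<And>y. y \<in> closure \<Omega> \<Longrightarrow> p x \<le> p y" using continuous_attains_inf[OF cpt cont] by blast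
  obtain z where z: "z \<in> closure \<Omega>" "\<And>y. y \<in> closure \<Omega> \<Longrightarrow> p y \<le> p z" using continuous_attains_sup[OF cpt cont] by blast
  have "p \<in> borel_measurable (lebesgue_on \<Omega>)"
    using assms(3) cont closure_subset
    by (intro continuous_imp_measurable_on_sets_lebesgue) (auto intro: continuous_on_subset)
  with x z gt[OF x(1)] show ?thesis
    using closure_subset[of \<Omega>] by (intro that[of "p x" "p z"]) (auto simp: bdd_exponent_def subset_iff)
qed

context bounded_domain
begin

text \<open>The potential estimate is multiplied by |u|^(p-1) = s h, and the trilinear bound is
  applied to h and |g| with conjugate exponents, whose reciprocals sum to 1 < 1 + 1/N. Dividing by s
  shrinks the modular of h faster than 1/s, so a large s lets the left side absorb the modular of
  u.\<close>

lemma modular_poincare: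
  assumes ne: "\<Omega> \<noteq> {}" and Cp: "C_plus \<Omega> p" and p: "bdd_exponent \<Omega> p l m"
  obtains C where "C \<ge> 0" "\<And>u g. W0_grad \<Omega> p u g \<Longrightarrow> modular \<Omega> p (\<lambda>x. norm (g x)) \<le> 1 \<Longrightarrow> modular \<Omega> p u \<le> ennreal C"
proof -
  have cont: "continuous_on (closure \<Omega>) p" and gt: "\<And>x. x \<in> closure \<Omega> \<Longrightarrow> p x > 1"
    using Cp by (auto simp: C_plus_def)
  have lm: "1 < l" "l \<le> m" and px: "\<And>x. x \<in> \<Omega> \<Longrightarrow> l \<le> p x \<and> p x \<le> m"
    and pm[measurable]: "p \<in> borel_measurable M"
    using p by (auto simp: bdd_exponent_def)
  define A where "A = annulus_vol TYPE('a)"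
  have A: "A > 0" using emeasure_annulus(2) by (simp add: A_def)
  define a where "a x = p x / (p x - 1)" for x
  have ca: "continuous_on (closure \<Omega>) a" unfolding a_def
    using cont gt by (intro continuous_intros) fastforce+
  have a1: "1 < a x" if "x \<in> closure \<Omega>" for x using gt[OF that] by (simp add: a_def field_simps)
  have asum: "1 / a x + 1 / p x < 1 + 1 / real DIM('a)" if "x \<in> closure \<Omega>" for x
    using gt[OF that] DIM_positive[where 'a='a] by (simp add: a_def field_simps)
  have [measurable]: "a \<in> borel_measurable M" unfolding a_def by measurable
  obtain c where c: "c \<ge> 0" "\<And>h g. h \<in> borel_measurable M \<Longrightarrow> g \<in> borel_measurable M \<Longrightarrow>
    (\<integral>\<^sup>+x. ennreal \<bar>h x\<bar> * (\<integral>\<^sup>+y. ennreal \<bar>g y\<bar> * ennreal (kern (x - y)) \<partial>M) \<partial>M)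
      \<le> ennreal c * ((1 + modular \<Omega> a h) * (1 + modular \<Omega> p g))"
    using trilinear_bound[OF ne ca a1 cont gt asum] by blast
  \<comment> \<open>A lower bound for a x - 1 = 1/(p x - 1): the modular of h gains s^(-1-\<kappa>),
    of which s^(-\<kappa>) survives multiplication by s.\<close>
  define \<kappa> where "\<kappa> = 1 / (m - 1)"
  have \<kappa>: "\<kappa> > 0" using lm by (simp add: \<kappa>_def)
  \<comment> \<open>Chosen so that 2 c s^(-\<kappa>) <= A/2, which absorbs half of the left
    side.\<close>
  define s where "s = (max 1 (4 * c / A)) powr (m - 1)"
  have s1: "s \<ge> 1" unfolding s_def using lm by (intro ge_one_powr_ge_zero) auto
  have "s powr \<kappa> = max 1 (4 * c / A)" unfolding s_def \<kappa>_def using lm by (simp add: powr_powr)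
  then have s2: "4 * c \<le> A * s powr \<kappa>" using A by (simp add: field_simps max_def)
  show ?thesis
  proof (rule that[of "4 * c * s / A"])
    show "4 * c * s / A \<ge> 0" using c s1 A by simp
    fix u g assume W: "W0_grad \<Omega> p u g" and g: "modular \<Omega> p (\<lambda>x. norm (g x)) \<le> 1"
    note [measurable] = W0_gradD(2,3)[OF W]
    have "modular \<Omega> p u < \<infinity>" using W0_gradD(4)[OF W] by (simp add: Lp_var_def)
    \<comment> \<open>The absorption is legitimate because the modular of u is finite.\<close>
    then obtain \<mu> where \<mu>: "\<mu> \<ge> 0" "modular \<Omega> p u = ennreal \<mu>" by (cases "modular \<Omega> p u") auto
    define h where "h x = \<bar>u x\<bar> powr (p x - 1) / s" for x
    have [measurable]: "h \<in> borel_measurable M" unfolding h_def by measurable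
    have "modular \<Omega> a h \<le> (\<integral>\<^sup>+x. ennreal (s powr (- (1 + \<kappa>))) * ennreal (\<bar>u x\<bar> powr p x) \<partial>M)"
      unfolding modular_def
    proof (rule nn_integral_mono)
      fix x assume "x \<in> space M"
      then have x: "l \<le> p x" "p x \<le> m" using px by auto
      have "\<bar>h x\<bar> powr a x = (\<bar>u x\<bar> powr (p x - 1)) powr a x / s powr a x"
        using s1 by (simp add: h_def powr_divide)
      also have "(\<bar>u x\<bar> powr (p x - 1)) powr a x = \<bar>u x\<bar> powr p x" using x lm by (simp add: powr_powr a_def)
      also have "\<bar>u x\<bar> powr p x / s powr a x = s powr (- a x) * \<bar>u x\<bar> powr p x"
        by (simp add: powr_minus field_simps)
      also have "\<dots> \<le> s powr (- (1 + \<kappa>)) * \<bar>u x\<bar> powr p x"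
      proof (intro mult_right_mono powr_mono)
        have "a x = 1 + 1 / (p x - 1)" using x lm by (simp add: a_def field_simps)
        moreover have "\<kappa> \<le> 1 / (p x - 1)" unfolding \<kappa>_def using x lm by (intro divide_left_mono) auto
        ultimately show "- a x \<le> - (1 + \<kappa>)" by simp
      qed (use s1 in auto)
      finally show "ennreal (\<bar>h x\<bar> powr a x) \<le> ennreal (s powr (- (1 + \<kappa>))) * ennreal (\<bar>u x\<bar> powr p x)"
        by (simp flip: ennreal_mult)
    qed
    also have "\<dots> = ennreal (s powr (- (1 + \<kappa>))) * modular \<Omega> p u" unfolding modular_def by (simp add: nn_integral_cmult)
    finally have mh: "modular \<Omega> a h \<le> ennreal (s powr (- (1 + \<kappa>)) * \<mu>)" using \<mu> by (simp add: ennreal_mult)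
    have "ennreal A * modular \<Omega> p u = (\<integral>\<^sup>+x. ennreal A * ennreal (\<bar>u x\<bar> powr p x) \<partial>M)"
      unfolding modular_def by (simp add: nn_integral_cmult)
    also have "\<dots> \<le> (\<integral>\<^sup>+x. ennreal s * (ennreal \<bar>h x\<bar> * potential g x) \<partial>M)"
    proof (rule nn_integral_mono_AE)
      show "AE x in M. ennreal A * ennreal (\<bar>u x\<bar> powr p x) \<le> ennreal s * (ennreal \<bar>h x\<bar> * potential g x)"
        using W0_grad_le_potential[OF p W] AE_space
      proof eventually_elim
        case (elim x)
        have "\<bar>u x\<bar> powr p x = s * \<bar>h x\<bar> * \<bar>u x\<bar>"
          using s1 powr_add[of "\<bar>u x\<bar>" "p x - 1" 1] by (cases "u x = 0") (auto simp: h_def)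
        then have "ennreal A * ennreal (\<bar>u x\<bar> powr p x) = ennreal s * (ennreal \<bar>h x\<bar> * (ennreal A * ennreal \<bar>u x\<bar>))"
          using s1 A by (simp add: mult_ac flip: ennreal_mult)
        also have "\<dots> \<le> ennreal s * (ennreal \<bar>h x\<bar> * potential g x)"
          using elim by (intro mult_left_mono) (auto simp: A_def)
        finally show ?case .
      qed
    qed
    also have "\<dots> = ennreal s * (\<integral>\<^sup>+x. ennreal \<bar>h x\<bar> * (\<integral>\<^sup>+y. ennreal \<bar>norm (g y)\<bar> * ennreal (kern (x - y)) \<partial>M) \<partial>M)"
      by (simp add: nn_integral_cmult flip: potential_def)
    also have "\<dots> \<le> ennreal s * (ennreal c * ((1 + modular \<Omega> a h) * (1 + modular \<Omega> p (\<lambda>x. norm (g x)))))"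
      by (intro mult_left_mono c(2)) auto
    also have "\<dots> \<le> ennreal s * (ennreal c * ((1 + ennreal (s powr (- (1 + \<kappa>)) * \<mu>)) * (1 + 1)))"
      using mh g by (intro mult_left_mono mult_mono add_left_mono) auto
    also have "\<dots> = ennreal (s * (c * ((1 + s powr (- (1 + \<kappa>)) * \<mu>) * 2)))"
    proof -
      have 0: "0 \<le> s" "0 \<le> 1 + s powr (- (1 + \<kappa>)) * \<mu>" using s1 \<mu> by auto
      have 2: "(1::ennreal) + 1 = ennreal 2" by simp
      have 1: "1 + ennreal (s powr (- (1 + \<kappa>)) * \<mu>) = ennreal (1 + s powr (- (1 + \<kappa>)) * \<mu>)"
        using \<mu> by simp
      show ?thesis unfolding 1 2 ennreal_mult'[OF 0(1)] ennreal_mult'[OF c(1)] ennreal_mult'[OF 0(2)] ..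
    qed
    finally have "A * \<mu> \<le> s * (c * ((1 + s powr (- (1 + \<kappa>)) * \<mu>) * 2))"
      using A \<mu> c s1 by (simp flip: ennreal_mult)
    also have "\<dots> = 2 * c * s + 2 * c * \<mu> * (s * s powr (- (1 + \<kappa>)))" by (simp add: algebra_simps)
    also have "s * s powr (- (1 + \<kappa>)) = s powr (- \<kappa>)"
      using s1 powr_add[of s 1 "- (1 + \<kappa>)"] by simp
    also have "2 * c * \<mu> * s powr (- \<kappa>) \<le> A * \<mu> / 2"
    proof -
      have "2 * c * s powr (- \<kappa>) \<le> A / 2" using s2 s1 by (simp add: powr_minus field_simps)
      then have "2 * c * s powr (- \<kappa>) * \<mu> \<le> A / 2 * \<mu>" using \<mu> by (intro mult_right_mono) auto
      then show ?thesis by (simp add: mult_ac)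
    qed
    finally have "\<mu> \<le> 4 * c * s / A" using A by (simp add: field_simps)
    then show "modular \<Omega> p u \<le> ennreal (4 * c * s / A)" using \<mu> by (simp add: ennreal_leI)
  qed
qed

end

context bounded_domain
begin

text \<open>\<open>modular_poincare\<close> is not homogeneous, so it is applied to t U n for large
  fixed t. Undoing the scaling turns its constant C into C/t.\<close>

lemma W0_modular_tendsto_0:
  assumes ne: "\<Omega> \<noteq> {}" and Cp: "C_plus \<Omega> p" and p: "bdd_exponent \<Omega> p l m"
    and W: "\<And>n. W0_grad \<Omega> p (U n) (G n)"
    and lim: "(\<lambda>n. modular \<Omega> p (\<lambda>x. norm (G n x))) \<longlonglongrightarrow> 0"
  shows "(\<lambda>n. modular \<Omega> p (U n)) \<longlonglongrightarrow> 0"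
proof (rule order_tendstoI)
  obtain C where C: "C \<ge> 0" "\<And>u g. W0_grad \<Omega> p u g \<Longrightarrow> modular \<Omega> p (\<lambda>x. norm (g x)) \<le> 1 \<Longrightarrow> modular \<Omega> p u \<le> ennreal C"
    using modular_poincare[OF ne Cp p] by blast
  have lm: "1 < l" "l \<le> m" using p by (auto simp: bdd_exponent_def)
  fix b :: ennreal assume "0 < b"
  obtain t :: real where t: "t \<ge> 1" "ennreal (C / t) < b"
  proof -
    have "((\<lambda>t. ennreal (C * inverse t)) \<longlongrightarrow> ennreal (C * 0)) at_top"
      by (intro tendsto_ennrealI tendsto_intros tendsto_inverse_0_at_top filterlim_ident)
    then have "eventually (\<lambda>t. ennreal (C * inverse t) < b) at_top"
      using \<open>0 < b\<close> by (intro order_tendstoD(2)) auto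
    then have "eventually (\<lambda>t. ennreal (C * inverse t) < b \<and> t \<ge> 1) at_top"
      using eventually_ge_at_top by (rule eventually_conj)
    then obtain t where "ennreal (C * inverse t) < b" "t \<ge> 1"
      using eventually_happens by fastforce
    then show ?thesis by (intro that[of t]) (auto simp: divide_inverse)
  qed
  \<comment> \<open>Scaling by t costs at most t^m, so this threshold keeps the modular of t G n at
    most 1.\<close>
  have "eventually (\<lambda>n. modular \<Omega> p (\<lambda>x. norm (G n x)) < ennreal (t powr (- m))) sequentially"
    using lim by (rule order_tendstoD(2)) (use t in auto)
  then show "eventually (\<lambda>n. modular \<Omega> p (U n) < b) sequentially"
  proof eventually_elim
    case (elim n)
    note [measurable] = W0_gradD(2,3)[OF W[of n]]
    have "W0_grad \<Omega> p (\<lambda>x. t * U n x) (\<lambda>x. t *\<^sub>R G n x)"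
      using W0_grad_lincomb[OF p W W0_grad_0[OF p], of t n 0] by simp
    moreover have "modular \<Omega> p (\<lambda>x. norm (t *\<^sub>R G n x)) \<le> 1"
    proof -
      have "modular \<Omega> p (\<lambda>x. norm (t *\<^sub>R G n x)) = modular \<Omega> p (\<lambda>x. t * norm (G n x))" using t by simp
      also have "\<dots> \<le> ennreal (t powr m) * modular \<Omega> p (\<lambda>x. norm (G n x))"
        using t by (intro modular_scale_ge_1[OF p]) auto
      also have "\<dots> \<le> ennreal (t powr m) * ennreal (t powr (- m))" using elim by (intro mult_left_mono) auto
      also have "\<dots> = 1" using t by (simp flip: ennreal_mult powr_add)
      finally show ?thesis .
    qed
    ultimately have CU: "modular \<Omega> p (\<lambda>x. t * U n x) \<le> ennreal C" by (rule C(2))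
    have "modular \<Omega> p (U n) = modular \<Omega> p (\<lambda>x. (1/t) * (t * U n x))" using t by simp
    also have "\<dots> \<le> ennreal ((1/t) powr l) * modular \<Omega> p (\<lambda>x. t * U n x)"
      using t by (intro modular_scale_le_1[OF p]) auto
    also have "\<dots> \<le> ennreal ((1/t) powr 1) * ennreal C"
      using t lm by (intro mult_mono CU ennreal_leI powr_mono') auto
    also have "\<dots> = ennreal (C / t)" using t C by (simp flip: ennreal_mult)
    finally show ?case using t by simp
  qed
qed auto

text \<open>Two exponents are kept apart: p only provides the pointwise potential estimate for u,
  while q is the exponent in which the gradient is measured. Later q is the maximum of p1 and p2
  although u is approximated for p1 alone.\<close>

lemma load_bound:
  assumes ne: "\<Omega> \<noteq> {}" and \<alpha>: "C_plus \<Omega> \<alpha>" and q: "C_plus \<Omega> q" and p: "bdd_exponent \<Omega> p l m"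
    and sub: "\<And>x. x \<in> closure \<Omega> \<Longrightarrow> 1 / \<alpha> x + 1 / q x < 1 + 1 / real DIM('a)"
    and f: "f \<in> Lp_var \<Omega> \<alpha>"
  obtains C where "C \<ge> 0" "\<And>u g. W0_grad \<Omega> p u g \<Longrightarrow>
    (\<integral>\<^sup>+x. ennreal \<bar>f x * u x\<bar> \<partial>M) \<le> ennreal C * (1 + modular \<Omega> q (\<lambda>x. norm (g x)))"
proof -
  obtain c where c: "c \<ge> 0" "\<And>h g. h \<in> borel_measurable M \<Longrightarrow> g \<in> borel_measurable M \<Longrightarrow>
    (\<integral>\<^sup>+x. ennreal \<bar>h x\<bar> * (\<integral>\<^sup>+y. ennreal \<bar>g y\<bar> * ennreal (kern (x - y)) \<partial>M) \<partial>M)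
      \<le> ennreal c * ((1 + modular \<Omega> \<alpha> h) * (1 + modular \<Omega> q g))"
    using trilinear_bound[OF ne, of \<alpha> q] \<alpha> q sub unfolding C_plus_def by blast
  define A where "A = annulus_vol TYPE('a)"
  have A: "A > 0" using emeasure_annulus(2) by (simp add: A_def)
  have [measurable]: "f \<in> borel_measurable M" using f by (simp add: Lp_var_def)
  obtain \<mu> where \<mu>: "\<mu> \<ge> 0" "modular \<Omega> \<alpha> f = ennreal \<mu>"
    using f by (cases "modular \<Omega> \<alpha> f") (auto simp: Lp_var_def)
  show ?thesis
  proof (rule that[of "(1 / A) * (c * (1 + \<mu>))"])
    show "(1 / A) * (c * (1 + \<mu>)) \<ge> 0" using A c \<mu> by simp
    fix u g assume W: "W0_grad \<Omega> p u g"
    note [measurable] = W0_gradD(2,3)[OF W]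
    have "(\<integral>\<^sup>+x. ennreal \<bar>f x * u x\<bar> \<partial>M) \<le> (\<integral>\<^sup>+x. ennreal (1 / A) * (ennreal \<bar>f x\<bar> * potential g x) \<partial>M)"
    proof (rule nn_integral_mono_AE)
      show "AE x in M. ennreal \<bar>f x * u x\<bar> \<le> ennreal (1 / A) * (ennreal \<bar>f x\<bar> * potential g x)"
        using W0_grad_le_potential[OF p W]
      proof eventually_elim
        case (elim x)
        have "ennreal \<bar>f x * u x\<bar> = ennreal (1 / A) * (ennreal \<bar>f x\<bar> * (ennreal A * ennreal \<bar>u x\<bar>))"
          using A by (simp add: abs_mult flip: ennreal_mult)
        also have "\<dots> \<le> ennreal (1 / A) * (ennreal \<bar>f x\<bar> * potential g x)"
          using elim by (intro mult_left_mono) (auto simp: A_def)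
        finally show ?case .
      qed
    qed
    also have "\<dots> = ennreal (1 / A) * (\<integral>\<^sup>+x. ennreal \<bar>f x\<bar> * (\<integral>\<^sup>+y. ennreal \<bar>norm (g y)\<bar> * ennreal (kern (x - y)) \<partial>M) \<partial>M)"
      by (simp add: nn_integral_cmult flip: potential_def)
    also have "\<dots> \<le> ennreal (1 / A) * (ennreal c * ((1 + modular \<Omega> \<alpha> f) * (1 + modular \<Omega> q (\<lambda>x. norm (g x)))))"
      by (intro mult_left_mono c(2)) auto
    also have "\<dots> = ennreal ((1 / A) * (c * (1 + \<mu>))) * (1 + modular \<Omega> q (\<lambda>x. norm (g x)))"
    proof -
      have 0: "0 \<le> 1 / A" using A by simp
      have 1: "1 + modular \<Omega> \<alpha> f = ennreal (1 + \<mu>)" using \<mu> by simp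
      show ?thesis unfolding 1 ennreal_mult'[OF 0] ennreal_mult'[OF c(1)] by (simp add: mult.assoc)
    qed
    finally show "(\<integral>\<^sup>+x. ennreal \<bar>f x * u x\<bar> \<partial>M) \<le> ennreal ((1 / A) * (c * (1 + \<mu>))) * (1 + modular \<Omega> q (\<lambda>x. norm (g x)))" .
  qed
qed

text \<open>Pointwise the maximum is one of the two exponents. Thus gradients from the intersection
  space are controlled at exponent p_M.\<close>

lemma modular_max_le:
  assumes "bdd_exponent \<Omega> p1 l1 m1" "bdd_exponent \<Omega> p2 l2 m2" "v \<in> borel_measurable M"
  shows "modular \<Omega> (\<lambda>x. max (p1 x) (p2 x)) v \<le> modular \<Omega> p1 v + modular \<Omega> p2 v"
proof -
  have [measurable]: "p1 \<in> borel_measurable M" "p2 \<in> borel_measurable M" "v \<in> borel_measurable M"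
    using assms by (auto simp: bdd_exponent_def)
  have "modular \<Omega> (\<lambda>x. max (p1 x) (p2 x)) v \<le> (\<integral>\<^sup>+x. ennreal (\<bar>v x\<bar> powr p1 x) + ennreal (\<bar>v x\<bar> powr p2 x) \<partial>M)"
    unfolding modular_def by (intro nn_integral_mono) (auto simp: max_def simp flip: ennreal_plus)
  also have "\<dots> = modular \<Omega> p1 v + modular \<Omega> p2 v" unfolding modular_def by (rule nn_integral_add) auto
  finally show ?thesis .
qed

text \<open>Modular Cauchy sequences are Cauchy in \<open>L\<^sup>1\<close>; the limit of an almost everywhere convergent
  subsequence is the modular limit by Fatou's lemma.\<close>

lemma modular_complete:
  fixes s :: "nat \<Rightarrow> 'a \<Rightarrow> 'b::euclidean_space"
  assumes p: "bdd_exponent \<Omega> p1 l1 m1" "bdd_exponent \<Omega> p2 l2 m2"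
    and meas: "\<And>n. s n \<in> borel_measurable M" and Lp: "\<And>n. (\<lambda>x. norm (s n x)) \<in> Lp_var \<Omega> p1"
    and C1: "\<And>e. e > 0 \<Longrightarrow> \<exists>N. \<forall>i\<ge>N. \<forall>j\<ge>N. modular \<Omega> p1 (\<lambda>x. norm (s i x - s j x)) \<le> ennreal e"
    and C2: "\<And>e. e > 0 \<Longrightarrow> \<exists>N. \<forall>i\<ge>N. \<forall>j\<ge>N. modular \<Omega> p2 (\<lambda>x. norm (s i x - s j x)) \<le> ennreal e"
  obtains t r where "t \<in> borel_measurable M" "strict_mono r" "AE x in M. (\<lambda>k. s (r k) x) \<longlonglongrightarrow> t x"
    "(\<lambda>n. modular \<Omega> p1 (\<lambda>x. norm (s n x - t x))) \<longlonglongrightarrow> 0"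
    "(\<lambda>n. modular \<Omega> p2 (\<lambda>x. norm (s n x - t x))) \<longlonglongrightarrow> 0"
proof -
  note [measurable] = meas
  have int: "integrable M (s n)" for n
  proof (rule integrableI_bounded)
    have "(\<integral>\<^sup>+x. ennreal (norm (s n x)) \<partial>M) \<le> ennreal 1 * emeasure M \<Omega> + ennreal (1 powr (1 - m1)) * modular \<Omega> p1 (\<lambda>x. norm (s n x))"
      using modular_L1_bound[OF p(1), of "\<lambda>x. norm (s n x)" 1] by simp
    also have "\<dots> < \<infinity>" using Lp[of n] emeasure_\<Omega>_finite by (simp add: Lp_var_def)
    finally show "(\<integral>\<^sup>+x. ennreal (norm (s n x)) \<partial>M) < \<infinity>" .
  qed measurable
  \<comment> \<open>If this failed, index pairs beyond every N would have distance at least e in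
    mean while their modulars tend to zero.\<close>
  have CL1: "\<exists>N. \<forall>i\<ge>N. \<forall>j\<ge>N. (\<integral>x. norm (s i x - s j x) \<partial>M) < e" if "e > 0" for e
  proof (rule ccontr)
    assume "\<not> ?thesis"
    then have "\<forall>N. \<exists>i j. i \<ge> N \<and> j \<ge> N \<and> (\<integral>x. norm (s i x - s j x) \<partial>M) \<ge> e" by (meson not_less)
    then obtain I J where IJ: "\<And>N. I N \<ge> N" "\<And>N. J N \<ge> N" "\<And>N. (\<integral>x. norm (s (I N) x - s (J N) x) \<partial>M) \<ge> e" by metis
    have "(\<lambda>N. modular \<Omega> p1 (\<lambda>x. norm (s (I N) x - s (J N) x))) \<longlonglongrightarrow> 0"
    proof (rule order_tendstoI)
      fix b :: ennreal assume "0 < b"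
      then obtain d where d: "d > 0" "ennreal d < b" by (rule ennreal_pos_obtain_real)
      then obtain N where "\<forall>i\<ge>N. \<forall>j\<ge>N. modular \<Omega> p1 (\<lambda>x. norm (s i x - s j x)) \<le> ennreal d" using C1 by blast
      then have "\<forall>n\<ge>N. modular \<Omega> p1 (\<lambda>x. norm (s (I n) x - s (J n) x)) < b"
        using IJ(1,2) d by (meson le_less_trans le_trans)
      then show "eventually (\<lambda>n. modular \<Omega> p1 (\<lambda>x. norm (s (I n) x - s (J n) x)) < b) sequentially"
        by (auto simp: eventually_sequentially)
    qed auto
    then have "(\<lambda>N. \<integral>\<^sup>+ x. ennreal \<bar>norm (s (I N) x - s (J N) x)\<bar> \<partial>M) \<longlonglongrightarrow> 0"
      by (intro modular_tendsto_0_imp_L1[OF p(1) _ emeasure_\<Omega>_finite]) auto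
    then have "eventually (\<lambda>N. (\<integral>\<^sup>+ x. ennreal \<bar>norm (s (I N) x - s (J N) x)\<bar> \<partial>M) < ennreal e) sequentially"
      by (rule order_tendstoD(2)) (use \<open>e > 0\<close> in auto)
    then obtain N where N: "(\<integral>\<^sup>+ x. ennreal \<bar>norm (s (I N) x - s (J N) x)\<bar> \<partial>M) < ennreal e"
      using eventually_happens by fastforce
    have "(\<integral>\<^sup>+ x. ennreal (norm (s (I N) x - s (J N) x)) \<partial>M) = ennreal (\<integral>x. norm (s (I N) x - s (J N) x) \<partial>M)"
      by (rule nn_integral_eq_integral) (auto intro!: integrable_norm Bochner_Integration.integrable_diff int)
    with N IJ(3)[of N] \<open>e > 0\<close> show False by (simp add: ennreal_less_iff not_less integral_nonneg)
  qed
  obtain r where r: "strict_mono r" "AE x in M. Cauchy (\<lambda>i. s (r i) x)"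
    using cauchy_L1_AE_cauchy_subseq[of M s] int CL1 by blast
  define t where "t x = lim (\<lambda>i. s (r i) x)" for x
  have t_meas[measurable]: "t \<in> borel_measurable M" unfolding t_def by (rule borel_measurable_lim_metric) measurable
  have AEt: "AE x in M. (\<lambda>k. s (r k) x) \<longlonglongrightarrow> t x"
    using r(2) by eventually_elim (auto simp: t_def Cauchy_convergent_iff convergent_LIMSEQ_iff)
  have lim: "(\<lambda>n. modular \<Omega> p (\<lambda>x. norm (s n x - t x))) \<longlonglongrightarrow> 0"
    if p: "bdd_exponent \<Omega> p l m" and
      C: "\<And>e. e > 0 \<Longrightarrow> \<exists>N. \<forall>i\<ge>N. \<forall>j\<ge>N. modular \<Omega> p (\<lambda>x. norm (s i x - s j x)) \<le> ennreal e" for p l m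
  proof (rule order_tendstoI)
    have [measurable]: "p \<in> borel_measurable M" using p by (simp add: bdd_exponent_def)
    fix b :: ennreal assume "0 < b"
    then obtain d where d: "d > 0" "ennreal d < b" by (rule ennreal_pos_obtain_real)
    then obtain N where N: "\<forall>i\<ge>N. \<forall>j\<ge>N. modular \<Omega> p (\<lambda>x. norm (s i x - s j x)) \<le> ennreal d" using C by blast
    have "modular \<Omega> p (\<lambda>x. norm (s n x - t x)) \<le> ennreal d" if n: "n \<ge> N" for n
    proof -
      have "modular \<Omega> p (\<lambda>x. norm (s n x - t x)) = (\<integral>\<^sup>+x. liminf (\<lambda>k. ennreal (\<bar>norm (s n x - s (r k) x)\<bar> powr p x)) \<partial>M)"
        unfolding modular_def
      proof (rule nn_integral_cong_AE)
        show "AE x in M. ennreal (\<bar>norm (s n x - t x)\<bar> powr p x) = liminf (\<lambda>k. ennreal (\<bar>norm (s n x - s (r k) x)\<bar> powr p x))"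
          using AEt AE_space
        proof eventually_elim
          case (elim x)
          then have "p x > 0" using p by (auto simp: bdd_exponent_def)
          then have "(\<lambda>k. ennreal (\<bar>norm (s n x - s (r k) x)\<bar> powr p x)) \<longlonglongrightarrow> ennreal (\<bar>norm (s n x - t x)\<bar> powr p x)"
            using elim by (intro tendsto_ennrealI tendsto_powr2 tendsto_intros) auto
          then show ?case by (intro lim_imp_Liminf[symmetric]) auto
        qed
      qed
      also have "\<dots> \<le> liminf (\<lambda>k. modular \<Omega> p (\<lambda>x. norm (s n x - s (r k) x)))"
        unfolding modular_def by (rule nn_integral_liminf) measurable
      also have "\<dots> \<le> ennreal d"
      proof (rule Liminf_le)
        have "modular \<Omega> p (\<lambda>x. norm (s n x - s (r k) x)) \<le> ennreal d" if "k \<ge> N" for k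
          using N n that seq_suble[OF r(1), of k] by auto
        then show "eventually (\<lambda>k. modular \<Omega> p (\<lambda>x. norm (s n x - s (r k) x)) \<le> ennreal d) sequentially"
          by (auto simp: eventually_sequentially)
      qed simp
      finally show ?thesis .
    qed
    then show "eventually (\<lambda>n. modular \<Omega> p (\<lambda>x. norm (s n x - t x)) < b) sequentially"
      using d by (auto simp: eventually_sequentially intro: le_less_trans)
  qed auto
  show ?thesis
    by (rule that[OF t_meas r(1) AEt lim[OF p(1) C1] lim[OF p(2) C2]])
qed

end

subsection \<open>The energy\<close>

lemma powr_diff_le:
  fixes a b p c :: real
  assumes p: "1 < p" and ab: "0 \<le> a" "0 \<le> b" "a \<le> c" "b \<le> c"
  shows "\<bar>b powr p - a powr p\<bar> \<le> p * c powr (p - 1) * \<bar>b - a\<bar>"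
proof -
  have *: "\<bar>y powr p - x powr p\<bar> \<le> p * c powr (p - 1) * \<bar>y - x\<bar>" if xy: "0 \<le> x" "x < y" "y \<le> c" for x y
  proof -
    obtain z where z: "x < z" "z < y" "y powr p - x powr p = (y - x) * (p * z powr (p - 1))"
      using powr_MVT[OF p xy(1,2)] by blast
    have "z powr (p - 1) \<le> c powr (p - 1)" using z xy p by (intro powr_mono2) auto
    then have "(y - x) * (p * z powr (p - 1)) \<le> (y - x) * (p * c powr (p - 1))"
      using xy p by (intro mult_left_mono) auto
    moreover have "(y - x) * (p * z powr (p - 1)) \<ge> 0" using xy p by auto
    ultimately show ?thesis using z xy by (simp add: mult_ac)
  qed
  show ?thesis using *[of a b] *[of b a] ab
    by (cases a b rule: linorder_cases) (auto simp: abs_minus_commute)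
qed

text \<open>A crude Young inequality: both factors are replaced by the larger of a and b.\<close>

lemma powr_minus1_mult_le:
  fixes a b p :: real assumes "1 < p" "0 \<le> a" "0 \<le> b"
  shows "a powr (p - 1) * b \<le> a powr p + b powr p"
proof -
  define c where "c = max a b"
  have "a powr (p - 1) * b \<le> c powr (p - 1) * c" using assms by (intro mult_mono powr_mono2) (auto simp: c_def)
  also have "\<dots> = c powr p" using powr_add[of c "p - 1" 1] assms by (cases "c = 0") (auto simp: c_def max_def)
  also have "\<dots> \<le> a powr p + b powr p" by (auto simp: c_def max_def)
  finally show ?thesis .
qed

text \<open>For \<xi> = 0 both sides vanish, also when p < 2, by the convention 0 powr a = 0; the
  flux needs no case distinction at zeros of the gradient.\<close>

lemma norm_powr_minus2:
  fixes \<xi> :: "'a::real_inner"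
  shows "norm \<xi> powr (p - 2) * (\<xi> \<bullet> \<xi>) = norm \<xi> powr p"
proof (cases "\<xi> = 0")
  case False
  then show ?thesis using powr_add[of "norm \<xi>" "p - 2" 2]
    by (simp add: power2_norm_eq_inner[symmetric] powr_numeral)
qed simp

lemma abs_norm_powr_minus2_inner_le:
  fixes \<xi> \<eta> :: "'a::real_inner"
  shows "\<bar>norm \<xi> powr (p - 2) * (\<xi> \<bullet> \<eta>)\<bar> \<le> norm \<xi> powr (p - 1) * norm \<eta>"
proof (cases "\<xi> = 0")
  case False
  have "\<bar>norm \<xi> powr (p - 2) * (\<xi> \<bullet> \<eta>)\<bar> \<le> norm \<xi> powr (p - 2) * (norm \<xi> * norm \<eta>)"
    by (simp add: abs_mult mult_left_mono Cauchy_Schwarz_ineq2)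
  also have "\<dots> = norm \<xi> powr (p - 1) * norm \<eta>"
    using False powr_add[of "norm \<xi>" "p - 2" 1] by simp
  finally show ?thesis .
qed simp

text \<open>For \<xi> nonzero the norm to the power p is the power p/2 of a quadratic polynomial
  positive at 0. For \<xi> = 0 the quotient has absolute value a constant times |t|^(p-1), which
  tends to 0 because p > 1.\<close>

lemma norm_line_powr_has_real_derivative:
  fixes \<xi> \<eta> :: "'a::real_inner"
  assumes p: "1 < p"
  shows "((\<lambda>t. norm (\<xi> + t *\<^sub>R \<eta>) powr p / p) has_real_derivative norm \<xi> powr (p - 2) * (\<xi> \<bullet> \<eta>)) (at 0)"
proof (cases "\<xi> = 0")
  case False
  define q where "q t = \<xi> \<bullet> \<xi> + 2 * t * (\<xi> \<bullet> \<eta>) + t^2 * (\<eta> \<bullet> \<eta>)" for t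
  have q: "norm (\<xi> + t *\<^sub>R \<eta>) powr p = q t powr (p / 2)" for t
  proof -
    have "q t = (norm (\<xi> + t *\<^sub>R \<eta>))\<^sup>2"
      unfolding power2_norm_eq_inner q_def
      by (simp add: inner_add_left inner_add_right inner_commute[of \<eta> \<xi>] power2_eq_square algebra_simps)
    also have "\<dots> = norm (\<xi> + t *\<^sub>R \<eta>) powr 2" by (simp add: powr_numeral)
    finally have "q t = norm (\<xi> + t *\<^sub>R \<eta>) powr 2" .
    then show ?thesis by (simp only: powr_powr) simp
  qed
  have q0: "q 0 = norm \<xi> powr 2" "q 0 > 0" using False by (auto simp: q_def powr_numeral power2_norm_eq_inner)
  have "(q has_real_derivative 2 * (\<xi> \<bullet> \<eta>)) (at 0)"
    unfolding q_def by (auto intro!: derivative_eq_intros)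
  then have "((\<lambda>t. q t powr (p / 2)) has_real_derivative (p / 2) * q 0 powr (p / 2 - 1) * (2 * (\<xi> \<bullet> \<eta>))) (at 0)"
    using q0(2) by (auto intro!: derivative_eq_intros)
  then have "((\<lambda>t. q t powr (p / 2) / p) has_real_derivative (p / 2) * q 0 powr (p / 2 - 1) * (2 * (\<xi> \<bullet> \<eta>)) / p) (at 0)"
    by (rule DERIV_cdivide)
  also have "(p / 2) * q 0 powr (p / 2 - 1) * (2 * (\<xi> \<bullet> \<eta>)) / p = norm \<xi> powr (p - 2) * (\<xi> \<bullet> \<eta>)"
  proof -
    have "2 * (p / 2 - 1) = p - 2" by simp
    then have "q 0 powr (p / 2 - 1) = norm \<xi> powr (p - 2)" by (simp only: q0(1) powr_powr)
    with p show ?thesis by simp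
  qed
  finally show ?thesis by (simp only: q)
next
  case True
  have "((\<lambda>h. norm \<eta> powr p * (\<bar>h\<bar> powr p / h) / p) \<longlongrightarrow> norm \<eta> powr p * 0 / p) (at 0)"
  proof (intro tendsto_intros)
    have "((\<lambda>h::real. \<bar>h\<bar> powr (p - 1)) \<longlongrightarrow> \<bar>0\<bar> powr (p - 1)) (at 0)"
      using p by (intro tendsto_powr2 tendsto_intros) auto
    then have L: "((\<lambda>h::real. \<bar>h\<bar> powr (p - 1)) \<longlongrightarrow> 0) (at 0)" by simp
    show "((\<lambda>h::real. \<bar>h\<bar> powr p / h) \<longlongrightarrow> 0) (at 0)"
    proof (rule Lim_null_comparison[OF _ L])
      show "eventually (\<lambda>h::real. norm (\<bar>h\<bar> powr p / h) \<le> \<bar>h\<bar> powr (p - 1)) (at 0)"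
        by (intro always_eventually) (auto simp: powr_diff)
    qed
  qed (use p in auto)
  then show ?thesis using True by (simp add: DERIV_def powr_mult mult.commute)
qed

lemma Lp_var_integrable:
  assumes p: "p \<in> borel_measurable (lebesgue_on \<Omega>)" and v: "v \<in> Lp_var \<Omega> p"
  shows "integrable (lebesgue_on \<Omega>) (\<lambda>x. \<bar>v x\<bar> powr p x)"
    "modular \<Omega> p v = ennreal (\<integral>x. \<bar>v x\<bar> powr p x \<partial>lebesgue_on \<Omega>)"
proof -
  note [measurable] = p
  have [measurable]: "v \<in> borel_measurable (lebesgue_on \<Omega>)" using v by (simp add: Lp_var_def)
  show "integrable (lebesgue_on \<Omega>) (\<lambda>x. \<bar>v x\<bar> powr p x)"
    using v by (intro integrableI_bounded) (auto simp: Lp_var_def modular_def)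
  then show "modular \<Omega> p v = ennreal (\<integral>x. \<bar>v x\<bar> powr p x \<partial>lebesgue_on \<Omega>)"
    unfolding modular_def by (intro nn_integral_eq_integral) auto
qed

locale pq_problem = bounded_domain \<Omega> for \<Omega> :: "'a::euclidean_space set" +
  fixes p1 p2 \<alpha> f :: "'a \<Rightarrow> real" and l m :: real
  assumes ne: "\<Omega> \<noteq> {}" and Cp: "C_plus \<Omega> p1" "C_plus \<Omega> p2" and C\<alpha>: "C_plus \<Omega> \<alpha>"
    and p1: "bdd_exponent \<Omega> p1 l m" and p2: "bdd_exponent \<Omega> p2 l m"
    and sub: "\<And>x. x \<in> closure \<Omega> \<Longrightarrow> 1 / \<alpha> x + 1 / max (p1 x) (p2 x) < 1 + 1 / real DIM('a)"
    and f: "f \<in> Lp_var \<Omega> \<alpha>"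
begin

lemma lm: "1 < l" "l \<le> m" using p1 by (auto simp: bdd_exponent_def)

lemma p_bounds:
  assumes "x \<in> \<Omega>" shows "l \<le> p1 x" "p1 x \<le> m" "l \<le> p2 x" "p2 x \<le> m" "1 < p1 x" "1 < p2 x"
  using assms p1 p2 by (auto simp: bdd_exponent_def)

lemma p_measurable[measurable]: "p1 \<in> borel_measurable M" "p2 \<in> borel_measurable M"
  using p1 p2 by (auto simp: bdd_exponent_def)

lemma f_measurable[measurable]: "f \<in> borel_measurable M"
  using f by (auto simp: Lp_var_def)

text \<open>The intersection space, with the weak gradient carried as a second argument so that no
  gradient has to be chosen; one gradient serves both exponents.\<close>

definition X :: "('a \<Rightarrow> real) \<Rightarrow> ('a \<Rightarrow> 'a) \<Rightarrow> bool" where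
  "X u g \<longleftrightarrow> W0_grad \<Omega> p1 u g \<and> W0_grad \<Omega> p2 u g"

lemma X_iff: "X u g \<longleftrightarrow> u \<in> W0 \<Omega> p1 \<and> u \<in> W0 \<Omega> p2 \<and> weak_grad \<Omega> u g"
  using W0_grad_weak_grad[OF p1] W0_grad_weak_grad[OF p2] W0_gradD(1) by (auto simp: X_def W0_def)

lemma X_lincomb: "X u g \<Longrightarrow> X v h \<Longrightarrow> X (\<lambda>x. c * u x + d * v x) (\<lambda>x. c *\<^sub>R g x + d *\<^sub>R h x)"
  by (simp add: X_def W0_grad_lincomb[OF p1] W0_grad_lincomb[OF p2])

lemma X_0: "X (\<lambda>_. 0) (\<lambda>_. 0)"
  by (simp add: X_def W0_grad_0[OF p1] W0_grad_0[OF p2])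

lemma X_scale: "X u g \<Longrightarrow> X (\<lambda>x. c * u x) (\<lambda>x. c *\<^sub>R g x)"
  using X_lincomb[OF _ X_0, of u g c 0] by simp

lemma X_diff: "X u g \<Longrightarrow> X v h \<Longrightarrow> X (\<lambda>x. u x - v x) (\<lambda>x. g x - h x)"
  using X_lincomb[of u g v h 1 "- 1"] by simp

lemma X_measurable: "X u g \<Longrightarrow> u \<in> borel_measurable M" "X u g \<Longrightarrow> g \<in> borel_measurable M"
  using W0_gradD(2,3) by (auto simp: X_def)

text \<open>The gradient modular as a real number; on \<open>X\<close> it is finite and agrees with
  \<open>modular\<close>, see \<open>X_integrable\<close>.\<close>

definition \<rho> :: "('a \<Rightarrow> real) \<Rightarrow> ('a \<Rightarrow> 'a) \<Rightarrow> real" where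
  "\<rho> p g = (\<integral>x. norm (g x) powr p x \<partial>M)"

definition energy :: "('a \<Rightarrow> 'a) \<Rightarrow> real" where
  "energy g = (\<integral>x. norm (g x) powr p1 x / p1 x + norm (g x) powr p2 x / p2 x \<partial>M)"

definition load :: "('a \<Rightarrow> real) \<Rightarrow> real" where
  "load u = (\<integral>x. f x * u x \<partial>M)"

lemma \<rho>_nonneg: "\<rho> p g \<ge> 0" unfolding \<rho>_def by (intro Bochner_Integration.integral_nonneg) auto

lemma X_integrable:
  assumes "X u g"
  shows "integrable M (\<lambda>x. norm (g x) powr p1 x)" "integrable M (\<lambda>x. norm (g x) powr p2 x)"
    "modular \<Omega> p1 (\<lambda>x. norm (g x)) = ennreal (\<rho> p1 g)" "modular \<Omega> p2 (\<lambda>x. norm (g x)) = ennreal (\<rho> p2 g)"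
proof -
  have "(\<lambda>x. norm (g x)) \<in> Lp_var \<Omega> p1" "(\<lambda>x. norm (g x)) \<in> Lp_var \<Omega> p2"
    using assms W0_gradD(5) unfolding X_def by blast+
  from Lp_var_integrable[OF p_measurable(1) this(1)] Lp_var_integrable[OF p_measurable(2) this(2)]
  show "integrable M (\<lambda>x. norm (g x) powr p1 x)" "integrable M (\<lambda>x. norm (g x) powr p2 x)"
    "modular \<Omega> p1 (\<lambda>x. norm (g x)) = ennreal (\<rho> p1 g)" "modular \<Omega> p2 (\<lambda>x. norm (g x)) = ennreal (\<rho> p2 g)"
    unfolding \<rho>_def by simp_all
qed

lemma integrable_div_exponent:
  assumes "integrable M (w :: 'a \<Rightarrow> real)"
  shows "integrable M (\<lambda>x. w x / p1 x)" "integrable M (\<lambda>x. w x / p2 x)"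
proof -
  have *: "integrable M (\<lambda>x. w x / p x)" if [measurable]: "p \<in> borel_measurable M" and "\<And>x. x \<in> \<Omega> \<Longrightarrow> 1 < p x" for p
  proof (rule Bochner_Integration.integrable_bound[OF assms])
    show "(\<lambda>x. w x / p x) \<in> borel_measurable M" using borel_measurable_integrable[OF assms] by measurable
    show "AE x in M. norm (w x / p x) \<le> norm (w x)"
    proof (rule AE_I2)
      fix x assume "x \<in> space M"
      then have "1 < p x" using that by simp
      then show "norm (w x / p x) \<le> norm (w x)" by (simp add: divide_le_eq mult_left_le_one_le mult_le_cancel_left1)
    qed
  qed
  show "integrable M (\<lambda>x. w x / p1 x)" "integrable M (\<lambda>x. w x / p2 x)" using * p_bounds by auto
qed

lemma energy_integrable:
  assumes "X u g"
  shows "integrable M (\<lambda>x. norm (g x) powr p1 x / p1 x + norm (g x) powr p2 x / p2 x)"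
  using X_integrable(1,2)[OF assms] by (intro Bochner_Integration.integrable_add integrable_div_exponent)

lemma \<rho>_le_energy:
  assumes "X u g" shows "\<rho> p1 g \<le> m * energy g" "\<rho> p2 g \<le> m * energy g"
proof -
  have *: "norm (g x) powr p1 x \<le> m * (norm (g x) powr p1 x / p1 x + norm (g x) powr p2 x / p2 x)"
    "norm (g x) powr p2 x \<le> m * (norm (g x) powr p1 x / p1 x + norm (g x) powr p2 x / p2 x)" if "x \<in> \<Omega>" for x
  proof -
    note b = p_bounds[OF that]
    have "norm (g x) powr p1 x \<le> m * (norm (g x) powr p1 x / p1 x)" "norm (g x) powr p2 x \<le> m * (norm (g x) powr p2 x / p2 x)"
      using b by (simp_all add: field_simps mult_right_mono)
    moreover have "0 \<le> m * (norm (g x) powr p1 x / p1 x)" "0 \<le> m * (norm (g x) powr p2 x / p2 x)" using b by auto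
    ultimately show "norm (g x) powr p1 x \<le> m * (norm (g x) powr p1 x / p1 x + norm (g x) powr p2 x / p2 x)"
      "norm (g x) powr p2 x \<le> m * (norm (g x) powr p1 x / p1 x + norm (g x) powr p2 x / p2 x)"
      unfolding distrib_left by linarith+
  qed
  note int = integrable_mult_right[OF energy_integrable[OF assms], of m]
  have "\<rho> p1 g \<le> (\<integral>x. m * (norm (g x) powr p1 x / p1 x + norm (g x) powr p2 x / p2 x) \<partial>M)"
    unfolding \<rho>_def by (rule integral_mono[OF X_integrable(1)[OF assms] int]) (simp add: *)
  then show "\<rho> p1 g \<le> m * energy g" unfolding energy_def by simp
  have "\<rho> p2 g \<le> (\<integral>x. m * (norm (g x) powr p1 x / p1 x + norm (g x) powr p2 x / p2 x) \<partial>M)"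
    unfolding \<rho>_def by (rule integral_mono[OF X_integrable(2)[OF assms] int]) (simp add: *)
  then show "\<rho> p2 g \<le> m * energy g" unfolding energy_def by simp
qed

lemma energy_nonneg: "energy g \<ge> 0"
  unfolding energy_def
proof (intro Bochner_Integration.integral_nonneg_AE AE_I2)
  fix x assume "x \<in> space M"
  then have "x \<in> \<Omega>" by simp
  with p_bounds[OF this] show "0 \<le> norm (g x) powr p1 x / p1 x + norm (g x) powr p2 x / p2 x" by simp
qed

lemma load_le:
  obtains C where "C \<ge> 0" "\<And>u g. X u g \<Longrightarrow> integrable M (\<lambda>x. f x * u x)"
    "\<And>u g. X u g \<Longrightarrow> \<bar>load u\<bar> \<le> C * (1 + (\<rho> p1 g + \<rho> p2 g))"
proof -
  have cq: "C_plus \<Omega> (\<lambda>x. max (p1 x) (p2 x))"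
    using Cp by (auto simp: C_plus_def less_max_iff_disj intro!: continuous_intros)
  obtain C where C: "C \<ge> 0" "\<And>u g. W0_grad \<Omega> p1 u g \<Longrightarrow>
    (\<integral>\<^sup>+x. ennreal \<bar>f x * u x\<bar> \<partial>M) \<le> ennreal C * (1 + modular \<Omega> (\<lambda>x. max (p1 x) (p2 x)) (\<lambda>x. norm (g x)))"
    using load_bound[OF ne C\<alpha> cq p1 sub f] by blast
  have bound: "(\<integral>\<^sup>+x. ennreal \<bar>f x * u x\<bar> \<partial>M) \<le> ennreal (C * (1 + (\<rho> p1 g + \<rho> p2 g)))" if X: "X u g" for u g
  proof -
    note [measurable] = X_measurable[OF X]
    have "(\<integral>\<^sup>+x. ennreal \<bar>f x * u x\<bar> \<partial>M) \<le> ennreal C * (1 + modular \<Omega> (\<lambda>x. max (p1 x) (p2 x)) (\<lambda>x. norm (g x)))"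
      using X C by (auto simp: X_def)
    also have "\<dots> \<le> ennreal C * (1 + (modular \<Omega> p1 (\<lambda>x. norm (g x)) + modular \<Omega> p2 (\<lambda>x. norm (g x))))"
      by (intro mult_left_mono add_left_mono modular_max_le[OF p1 p2]) auto
    also have "\<dots> = ennreal (C * (1 + (\<rho> p1 g + \<rho> p2 g)))"
      using \<rho>_nonneg[of p1 g] \<rho>_nonneg[of p2 g]
      by (simp add: X_integrable(3,4)[OF X] ennreal_mult'[OF C(1)])
    finally show ?thesis .
  qed
  show ?thesis
  proof (rule that[OF C(1)])
    fix u g assume X: "X u g"
    note [measurable] = X_measurable[OF X]
    show int: "integrable M (\<lambda>x. f x * u x)"
      using bound[OF X] by (intro integrableI_bounded) (auto intro: le_less_trans)
    have "ennreal (norm (load u)) \<le> ennreal (C * (1 + (\<rho> p1 g + \<rho> p2 g)))"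
      unfolding load_def using integral_norm_bound_ennreal[OF int] bound[OF X] by (auto intro: order_trans)
    then show "\<bar>load u\<bar> \<le> C * (1 + (\<rho> p1 g + \<rho> p2 g))"
      using C \<rho>_nonneg[of p1 g] \<rho>_nonneg[of p2 g] by (subst (asm) ennreal_le_iff) auto
  qed
qed

end

text \<open>The epsilon-delta form of \<open>W0_modular_tendsto_0\<close>, obtained by
  contradiction; Cauchy conditions with two indices need it.\<close>

lemma (in bounded_domain) modular_poincare_small:
  assumes ne: "\<Omega> \<noteq> {}" and Cp: "C_plus \<Omega> p" and p: "bdd_exponent \<Omega> p l m" and e: "e > 0"
  obtains d where "d > 0" "\<And>u g. W0_grad \<Omega> p u g \<Longrightarrow> modular \<Omega> p (\<lambda>x. norm (g x)) \<le> ennreal d \<Longrightarrow> modular \<Omega> p u \<le> ennreal e"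
proof (rule ccontr)
  assume "\<not> thesis"
  then have "\<exists>u g. W0_grad \<Omega> p u g \<and> modular \<Omega> p (\<lambda>x. norm (g x)) \<le> ennreal (1 / real (Suc n)) \<and> \<not> modular \<Omega> p u \<le> ennreal e" for n
    using that[of "1 / real (Suc n)"] by auto
  then obtain U G where UG: "\<And>n. W0_grad \<Omega> p (U n) (G n)" "\<And>n. modular \<Omega> p (\<lambda>x. norm (G n x)) \<le> ennreal (1 / real (Suc n))"
    "\<And>n. \<not> modular \<Omega> p (U n) \<le> ennreal e" by metis
  have "(\<lambda>n. ennreal (1 / real (Suc n))) \<longlonglongrightarrow> 0"
    using tendsto_ennrealI[OF LIMSEQ_inverse_real_of_nat] by (simp add: inverse_eq_divide)
  then have "(\<lambda>n. modular \<Omega> p (\<lambda>x. norm (G n x))) \<longlonglongrightarrow> 0" by (rule ennreal_tendsto_0_le[OF UG(2)])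
  then have "(\<lambda>n. modular \<Omega> p (U n)) \<longlonglongrightarrow> 0" by (rule W0_modular_tendsto_0[OF ne Cp p UG(1)])
  then have "eventually (\<lambda>n. modular \<Omega> p (U n) < ennreal e) sequentially"
    by (rule order_tendstoD(2)) (use e in auto)
  then show False using UG(3) by (auto simp: eventually_sequentially intro: less_imp_le)
qed

section \<open>Coercivity, minimizing sequences and the minimizer\<close>

context pq_problem
begin

lemma \<rho>_scale:
  assumes X: "X u g" and c: "c \<ge> 0"
  shows "c \<ge> 1 \<Longrightarrow> \<rho> p1 (\<lambda>x. c *\<^sub>R g x) \<le> c powr m * \<rho> p1 g" "c \<ge> 1 \<Longrightarrow> \<rho> p2 (\<lambda>x. c *\<^sub>R g x) \<le> c powr m * \<rho> p2 g"
    "0 < c \<Longrightarrow> c \<le> 1 \<Longrightarrow> \<rho> p1 (\<lambda>x. c *\<^sub>R g x) \<le> c powr l * \<rho> p1 g" "0 < c \<Longrightarrow> c \<le> 1 \<Longrightarrow> \<rho> p2 (\<lambda>x. c *\<^sub>R g x) \<le> c powr l * \<rho> p2 g"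
proof -
  note [measurable] = X_measurable[OF X]
  have norm_c: "(\<lambda>x. norm (c *\<^sub>R g x)) = (\<lambda>x. c * norm (g x))" using c by auto
  note mod = X_integrable(3,4)[OF X] X_integrable(3,4)[OF X_scale[OF X, of c], unfolded norm_c]
  have conv: "a \<le> k * b" if "ennreal a \<le> ennreal k * ennreal b" "0 \<le> k" "0 \<le> b" for a k b :: real
    using that by (simp flip: ennreal_mult add: mult_nonneg_nonneg)
  show "\<rho> p1 (\<lambda>x. c *\<^sub>R g x) \<le> c powr m * \<rho> p1 g" if "c \<ge> 1"
    by (rule conv) (use modular_scale_ge_1[OF p1, of "\<lambda>x. norm (g x)" c] that mod \<rho>_nonneg in auto)
  show "\<rho> p2 (\<lambda>x. c *\<^sub>R g x) \<le> c powr m * \<rho> p2 g" if "c \<ge> 1"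
    by (rule conv) (use modular_scale_ge_1[OF p2, of "\<lambda>x. norm (g x)" c] that mod \<rho>_nonneg in auto)
  show "\<rho> p1 (\<lambda>x. c *\<^sub>R g x) \<le> c powr l * \<rho> p1 g" if "0 < c" "c \<le> 1"
    by (rule conv) (use modular_scale_le_1[OF p1, of "\<lambda>x. norm (g x)" c] that mod \<rho>_nonneg in auto)
  show "\<rho> p2 (\<lambda>x. c *\<^sub>R g x) \<le> c powr l * \<rho> p2 g" if "0 < c" "c \<le> 1"
    by (rule conv) (use modular_scale_le_1[OF p2, of "\<lambda>x. norm (g x)" c] that mod \<rho>_nonneg in auto)
qed

lemma load_integrable: "X u g \<Longrightarrow> integrable M (\<lambda>x. f x * u x)"
  using load_le by metis

lemma load_scale: "load (\<lambda>x. c * u x) = c * load u"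
  unfolding load_def by (simp add: mult.left_commute)

lemma load_lincomb:
  assumes "X u g" "X v h"
  shows "load (\<lambda>x. c * u x + d * v x) = c * load u + d * load v"
proof -
  have "load (\<lambda>x. c * u x + d * v x) = (\<integral>x. c * (f x * u x) + d * (f x * v x) \<partial>M)"
    unfolding load_def by (simp add: algebra_simps)
  also have "\<dots> = c * load u + d * load v"
    unfolding load_def using load_integrable[OF assms(1)] load_integrable[OF assms(2)] by simp
  finally show ?thesis .
qed

text \<open>The constant in \<open>load_le\<close> may be large. Applied to u/s, that bound has
  modulars multiplied by at most s^(-l); multiplying the load back by s leaves s^(1-l), which is
  small for large s since l > 1.\<close>

lemma coercive:
  obtains K where "\<And>u g. X u g \<Longrightarrow> energy g \<le> 2 * (energy g - load u) + K"
proof -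
  obtain C where C: "C \<ge> 0" "\<And>u g. X u g \<Longrightarrow> \<bar>load u\<bar> \<le> C * (1 + (\<rho> p1 g + \<rho> p2 g))"
    using load_le by metis
  \<comment> \<open>Chosen so that 2 C m s^(1-l) <= 1/2: the load then costs at most half of the
    energy plus a constant.\<close>
  define s where "s = max 1 (4 * C * m) powr (1 / (l - 1))"
  have s1: "s \<ge> 1" unfolding s_def using lm by (intro ge_one_powr_ge_zero) auto
  have "s powr (l - 1) = max 1 (4 * C * m)" unfolding s_def powr_powr using lm by simp
  then have s2: "4 * C * m \<le> s powr (l - 1)" by simp
  have "energy g \<le> 2 * (energy g - load u) + 2 * s * C" if X: "X u g" for u g
  proof -
    have "\<bar>load u\<bar> = s * \<bar>load (\<lambda>x. (1/s) * u x)\<bar>" unfolding load_scale using s1 by (simp add: abs_mult)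
    also have "\<dots> \<le> s * (C * (1 + (\<rho> p1 (\<lambda>x. (1/s) *\<^sub>R g x) + \<rho> p2 (\<lambda>x. (1/s) *\<^sub>R g x))))"
      using s1 by (intro mult_left_mono C(2) X_scale X) auto
    also have "\<dots> \<le> s * (C * (1 + ((1/s) powr l * (m * energy g) + (1/s) powr l * (m * energy g))))"
    proof -
      have "\<rho> p1 (\<lambda>x. (1/s) *\<^sub>R g x) \<le> (1/s) powr l * \<rho> p1 g" "\<rho> p2 (\<lambda>x. (1/s) *\<^sub>R g x) \<le> (1/s) powr l * \<rho> p2 g"
        using s1 by (intro \<rho>_scale[OF X]; simp)+
      moreover have "(1/s) powr l * \<rho> p1 g \<le> (1/s) powr l * (m * energy g)" "(1/s) powr l * \<rho> p2 g \<le> (1/s) powr l * (m * energy g)"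
        using \<rho>_le_energy[OF X] by (intro mult_left_mono; simp)+
      ultimately have "\<rho> p1 (\<lambda>x. (1/s) *\<^sub>R g x) \<le> (1/s) powr l * (m * energy g)"
        "\<rho> p2 (\<lambda>x. (1/s) *\<^sub>R g x) \<le> (1/s) powr l * (m * energy g)" by linarith+
      with s1 C(1) show ?thesis by (intro mult_left_mono add_left_mono add_mono) auto
    qed
    also have "\<dots> = s * C + (2 * C * m * (s * (1/s) powr l)) * energy g" by (simp add: algebra_simps)
    also have "s * (1/s) powr l = 1 / s powr (l - 1)" using s1 by (simp add: powr_divide powr_diff)
    also have "(2 * C * m * (1 / s powr (l - 1))) * energy g \<le> (1 / 2) * energy g"
      using s2 s1 energy_nonneg[of g] by (intro mult_right_mono) (auto simp: field_simps)
    finally have "\<bar>load u\<bar> \<le> s * C + (1 / 2) * energy g" by simp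
    then show ?thesis by argo
  qed
  then show ?thesis by (rule that)
qed

text \<open>For fixed large t the gradient modulars of t U n are eventually at most 1, so
  \<open>load_le\<close> bounds the load of U n by 3 C / t.\<close>

lemma load_tendsto_0:
  assumes X: "\<And>n. X (U n) (G n)"
    and lim: "(\<lambda>n. \<rho> p1 (G n)) \<longlonglongrightarrow> 0" "(\<lambda>n. \<rho> p2 (G n)) \<longlonglongrightarrow> 0"
  shows "(\<lambda>n. load (U n)) \<longlonglongrightarrow> 0"
proof (rule LIMSEQ_I)
  fix e :: real assume e: "e > 0"
  obtain C where C: "C \<ge> 0" "\<And>u g. X u g \<Longrightarrow> \<bar>load u\<bar> \<le> C * (1 + (\<rho> p1 g + \<rho> p2 g))"
    using load_le by metis
  \<comment> \<open>The 4 instead of 3 yields the strict inequality for C > 0; for C = 0 the load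
    vanishes.\<close>
  define t where "t = max 1 (4 * C / e)"
  have t1: "t \<ge> 1" by (simp add: t_def)
  have "4 * C / e \<le> t" by (simp add: t_def)
  then have t2: "4 * C / t \<le> e" using e t1 by (simp add: field_simps)
  have tm: "t powr (- m) > 0" using t1 by simp
  have ev: "eventually (\<lambda>n. \<rho> p1 (G n) < t powr (- m)) sequentially" "eventually (\<lambda>n. \<rho> p2 (G n) < t powr (- m)) sequentially"
    using order_tendstoD(2)[OF lim(1) tm] order_tendstoD(2)[OF lim(2) tm] .
  have "eventually (\<lambda>n. norm (load (U n) - 0) < e) sequentially"
    using ev
  proof eventually_elim
    case (elim n)
    have r: "\<rho> p1 (\<lambda>x. t *\<^sub>R G n x) \<le> 1" "\<rho> p2 (\<lambda>x. t *\<^sub>R G n x) \<le> 1"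
    proof -
      have *: "t powr m * t powr (- m) = 1" using t1 by (simp flip: powr_add)
      have "t powr m * \<rho> p1 (G n) \<le> 1" "t powr m * \<rho> p2 (G n) \<le> 1"
        unfolding *[symmetric] using elim by (intro mult_left_mono; simp)+
      with \<rho>_scale(1,2)[OF X[of n], of t] t1 show "\<rho> p1 (\<lambda>x. t *\<^sub>R G n x) \<le> 1" "\<rho> p2 (\<lambda>x. t *\<^sub>R G n x) \<le> 1" by simp_all
    qed
    have "t * \<bar>load (U n)\<bar> = \<bar>load (\<lambda>x. t * U n x)\<bar>" unfolding load_scale using t1 by (simp add: abs_mult)
    also have "\<dots> \<le> C * (1 + (\<rho> p1 (\<lambda>x. t *\<^sub>R G n x) + \<rho> p2 (\<lambda>x. t *\<^sub>R G n x)))" by (intro C(2) X_scale X)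
    also have "\<dots> \<le> C * (1 + (1 + 1))" using r C by (intro mult_left_mono add_left_mono add_mono)
    finally have *: "\<bar>load (U n)\<bar> \<le> 3 * C / t" using t1 by (simp add: field_simps)
    show ?case
    proof (cases "C = 0")
      case False
      then have "3 * C / t < 4 * C / t" using C t1 by (intro divide_strict_right_mono) auto
      with * t2 show ?thesis by simp
    qed (use * e in simp)
  qed
  then show "\<exists>no. \<forall>n\<ge>no. norm (load (U n) - 0) < e" by (simp add: eventually_sequentially)
qed

lemma convexity_gap_integrable:
  assumes "X u g" "X v h"
  shows "integrable M (\<lambda>x. convexity_gap (p1 x) (g x) (h x))" "integrable M (\<lambda>x. convexity_gap (p2 x) (g x) (h x))"
  unfolding convexity_gap_def
  using X_integrable(1,2)[OF assms(1)] X_integrable(1,2)[OF assms(2)]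
    X_integrable(1,2)[OF X_lincomb[OF assms, of "1/2" "1/2"]] by auto

lemma energy_midpoint:
  assumes "X u g" "X v h"
  shows "energy (\<lambda>x. (1/2) *\<^sub>R g x + (1/2) *\<^sub>R h x) =
    (energy g + energy h) / 2 - (\<integral>x. convexity_gap (p1 x) (g x) (h x) / p1 x + convexity_gap (p2 x) (g x) (h x) / p2 x \<partial>M)"
proof -
  let ?D = "\<lambda>g x. norm (g x) powr p1 x / p1 x + norm (g x) powr p2 x / p2 x"
  have "(\<integral>x. convexity_gap (p1 x) (g x) (h x) / p1 x + convexity_gap (p2 x) (g x) (h x) / p2 x \<partial>M)
      = (\<integral>x. (1/2) * ?D g x + (1/2) * ?D h x - ?D (\<lambda>x. (1/2) *\<^sub>R g x + (1/2) *\<^sub>R h x) x \<partial>M)"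
    by (rule Bochner_Integration.integral_cong) (simp_all add: convexity_gap_def diff_divide_distrib add_divide_distrib)
  also have "\<dots> = (1/2) * energy g + (1/2) * energy h - energy (\<lambda>x. (1/2) *\<^sub>R g x + (1/2) *\<^sub>R h x)"
    unfolding energy_def
    using energy_integrable[OF assms(1)] energy_integrable[OF assms(2)] energy_integrable[OF X_lincomb[OF assms, of "1/2" "1/2"]]
    by simp
  finally show ?thesis by argo
qed

text \<open>The midpoint of two competitors is a competitor, so its value is at least \<mu>. The
  load is linear, hence the midpoint lies below the average of the two values by exactly the
  weighted gap integral.\<close>

lemma convexity_gap_integral_le:
  assumes "X u g" "X v h"
    and min: "\<And>u g. X u g \<Longrightarrow> \<mu> \<le> energy g - load u"
  defines "\<delta> \<equiv> ((energy g - load u) + (energy h - load v)) / 2 - \<mu>"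
  shows "(\<integral>x. convexity_gap (p1 x) (g x) (h x) \<partial>M) \<le> m * \<delta>" "(\<integral>x. convexity_gap (p2 x) (g x) (h x) \<partial>M) \<le> m * \<delta>"
proof -
  let ?I = "\<lambda>x. convexity_gap (p1 x) (g x) (h x) / p1 x + convexity_gap (p2 x) (g x) (h x) / p2 x"
  have "\<mu> \<le> energy (\<lambda>x. (1/2) *\<^sub>R g x + (1/2) *\<^sub>R h x) - load (\<lambda>x. (1/2) * u x + (1/2) * v x)"
    by (intro min X_lincomb assms)
  then have le: "(\<integral>x. ?I x \<partial>M) \<le> \<delta>"
    unfolding energy_midpoint[OF assms(1,2)] load_lincomb[OF assms(1,2)] \<delta>_def by argo
  have int: "integrable M (\<lambda>x. m * ?I x)"
    using convexity_gap_integrable[OF assms(1,2)]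
    by (intro integrable_mult_right Bochner_Integration.integrable_add integrable_div_exponent)
  have pt: "convexity_gap (p1 x) (g x) (h x) \<le> m * ?I x" "convexity_gap (p2 x) (g x) (h x) \<le> m * ?I x" if "x \<in> \<Omega>" for x
  proof -
    note b = p_bounds[OF that]
    have n: "0 \<le> convexity_gap (p1 x) (g x) (h x)" "0 \<le> convexity_gap (p2 x) (g x) (h x)"
      using b by (auto intro: convexity_gap_nonneg)
    have "convexity_gap (p1 x) (g x) (h x) \<le> m * (convexity_gap (p1 x) (g x) (h x) / p1 x)"
      "convexity_gap (p2 x) (g x) (h x) \<le> m * (convexity_gap (p2 x) (g x) (h x) / p2 x)"
      using b n by (simp_all add: field_simps mult_right_mono)
    moreover have "0 \<le> m * (convexity_gap (p1 x) (g x) (h x) / p1 x)" "0 \<le> m * (convexity_gap (p2 x) (g x) (h x) / p2 x)"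
      using b n by auto
    ultimately show "convexity_gap (p1 x) (g x) (h x) \<le> m * ?I x" "convexity_gap (p2 x) (g x) (h x) \<le> m * ?I x"
      unfolding distrib_left by linarith+
  qed
  have "m * (\<integral>x. ?I x \<partial>M) \<le> m * \<delta>" using le lm by (intro mult_left_mono) auto
  moreover have "(\<integral>x. convexity_gap (p1 x) (g x) (h x) \<partial>M) \<le> (\<integral>x. m * ?I x \<partial>M)"
    by (rule integral_mono[OF convexity_gap_integrable(1)[OF assms(1,2)] int]) (simp add: pt)
  moreover have "(\<integral>x. convexity_gap (p2 x) (g x) (h x) \<partial>M) \<le> (\<integral>x. m * ?I x \<partial>M)"
    by (rule integral_mono[OF convexity_gap_integrable(2)[OF assms(1,2)] int]) (simp add: pt)
  ultimately show "(\<integral>x. convexity_gap (p1 x) (g x) (h x) \<partial>M) \<le> m * \<delta>" "(\<integral>x. convexity_gap (p2 x) (g x) (h x) \<partial>M) \<le> m * \<delta>"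
    by (auto simp del: distrib_left)
qed

lemma \<rho>_diff_le:
  assumes e: "e > 0"
  obtains C where "C \<ge> 0" "\<And>u g v h. X u g \<Longrightarrow> X v h \<Longrightarrow>
      \<rho> p1 (\<lambda>x. g x - h x) \<le> e * (\<rho> p1 g + \<rho> p1 h) + C * (\<integral>x. convexity_gap (p1 x) (g x) (h x) \<partial>M)"
    "\<And>u g v h. X u g \<Longrightarrow> X v h \<Longrightarrow>
      \<rho> p2 (\<lambda>x. g x - h x) \<le> e * (\<rho> p2 g + \<rho> p2 h) + C * (\<integral>x. convexity_gap (p2 x) (g x) (h x) \<partial>M)"
proof -
  obtain C where C: "C \<ge> 0" "\<And>p (\<xi>::'a) \<eta>. l \<le> p \<Longrightarrow> p \<le> m \<Longrightarrow>
    norm (\<xi> - \<eta>) powr p \<le> e * (norm \<xi> powr p + norm \<eta> powr p) + C * convexity_gap p \<xi> \<eta>"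
    using uniform_convexity[OF e lm(1), of m, where 'a='a] by blast
  show ?thesis
  proof (rule that[OF C(1)])
    fix u g v h assume X: "X u g" "X v h"
    note i = X_integrable(1,2)[OF X(1)] X_integrable(1,2)[OF X(2)] X_integrable(1,2)[OF X_diff[OF X]] convexity_gap_integrable[OF X]
    have "\<rho> p1 (\<lambda>x. g x - h x) \<le> (\<integral>x. e * (norm (g x) powr p1 x + norm (h x) powr p1 x) + C * convexity_gap (p1 x) (g x) (h x) \<partial>M)"
      unfolding \<rho>_def
      by (rule integral_mono) (use i p_bounds in \<open>auto intro!: C(2)\<close>)
    also have "\<dots> = e * (\<rho> p1 g + \<rho> p1 h) + C * (\<integral>x. convexity_gap (p1 x) (g x) (h x) \<partial>M)"
      unfolding \<rho>_def using i by simp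
    finally show "\<rho> p1 (\<lambda>x. g x - h x) \<le> e * (\<rho> p1 g + \<rho> p1 h) + C * (\<integral>x. convexity_gap (p1 x) (g x) (h x) \<partial>M)" .
    have "\<rho> p2 (\<lambda>x. g x - h x) \<le> (\<integral>x. e * (norm (g x) powr p2 x + norm (h x) powr p2 x) + C * convexity_gap (p2 x) (g x) (h x) \<partial>M)"
      unfolding \<rho>_def
      by (rule integral_mono) (use i p_bounds in \<open>auto intro!: C(2)\<close>)
    also have "\<dots> = e * (\<rho> p2 g + \<rho> p2 h) + C * (\<integral>x. convexity_gap (p2 x) (g x) (h x) \<partial>M)"
      unfolding \<rho>_def using i by simp
    finally show "\<rho> p2 (\<lambda>x. g x - h x) \<le> e * (\<rho> p2 g + \<rho> p2 h) + C * (\<integral>x. convexity_gap (p2 x) (g x) (h x) \<partial>M)" .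
  qed
qed

text \<open>The order of choice matters: coercivity fixes R, then d makes the modular terms of
  \<open>\<rho>_diff_le\<close> small, which fixes C, and only then N makes the gap term
  small.\<close>

lemma minimizing_sequence_Cauchy:
  assumes X: "\<And>n. X (U n) (G n)" and min: "\<And>u g. X u g \<Longrightarrow> \<mu> \<le> energy g - load u"
    and lim: "\<And>n. energy (G n) - load (U n) < \<mu> + 1 / real (Suc n)" and e: "e > 0"
  shows "\<exists>N. \<forall>i\<ge>N. \<forall>j\<ge>N. \<rho> p1 (\<lambda>x. G i x - G j x) \<le> e \<and> \<rho> p2 (\<lambda>x. G i x - G j x) \<le> e"
proof -
  obtain K where K: "\<And>u g. X u g \<Longrightarrow> energy g \<le> 2 * (energy g - load u) + K" using coercive by blast
  \<comment> \<open>The maximum with 1 keeps R positive, as the division in d requires.\<close>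
  define R where "R = m * max 1 (2 * (\<mu> + 1) + K)"
  have R: "R > 0" using lm by (simp add: R_def)
  have \<rho>R: "\<rho> p1 (G n) \<le> R" "\<rho> p2 (G n) \<le> R" for n
  proof -
    have "energy (G n) - load (U n) < \<mu> + 1" by (rule less_le_trans[OF lim]) simp
    then have "energy (G n) \<le> 2 * (\<mu> + 1) + K" using K[OF X[of n]] by argo
    then have "m * energy (G n) \<le> R" unfolding R_def using lm by (intro mult_left_mono) auto
    with \<rho>_le_energy[OF X[of n]] show "\<rho> p1 (G n) \<le> R" "\<rho> p2 (G n) \<le> R" by linarith+
  qed
  \<comment> \<open>Two modulars of size at most R contribute at most e/2.\<close>
  define d where "d = e / (4 * R)"
  have d: "d > 0" using e R by (simp add: d_def)
  obtain C where C: "C \<ge> 0" "\<And>u g v h. X u g \<Longrightarrow> X v h \<Longrightarrow>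
      \<rho> p1 (\<lambda>x. g x - h x) \<le> d * (\<rho> p1 g + \<rho> p1 h) + C * (\<integral>x. convexity_gap (p1 x) (g x) (h x) \<partial>M)"
    "\<And>u g v h. X u g \<Longrightarrow> X v h \<Longrightarrow>
      \<rho> p2 (\<lambda>x. g x - h x) \<le> d * (\<rho> p2 g + \<rho> p2 h) + C * (\<integral>x. convexity_gap (p2 x) (g x) (h x) \<partial>M)"
    using \<rho>_diff_le[OF d] by blast
  \<comment> \<open>Makes C m / (N + 1) <= e/2, the contribution of the convexity gap.\<close>
  obtain N where N: "C * m * (2 / e) < real N" using reals_Archimedean2 by blast
  have small: "C * (m * \<delta>) \<le> e / 2" if "\<delta> \<le> 1 / real (Suc N)" for \<delta>
  proof -
    have "C * (m * \<delta>) \<le> C * (m * (1 / real (Suc N)))" using C lm that by (intro mult_left_mono) auto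
    also have "\<dots> \<le> e / 2" using N e by (simp add: field_simps)
    finally show ?thesis .
  qed
  have "\<rho> p1 (\<lambda>x. G i x - G j x) \<le> e \<and> \<rho> p2 (\<lambda>x. G i x - G j x) \<le> e" if ij: "i \<ge> N" "j \<ge> N" for i j
  proof -
    define \<delta> where "\<delta> = ((energy (G i) - load (U i)) + (energy (G j) - load (U j))) / 2 - \<mu>"
    have "1 / real (Suc i) \<le> 1 / real (Suc N)" "1 / real (Suc j) \<le> 1 / real (Suc N)"
      using ij by (auto intro!: divide_left_mono)
    then have "\<delta> \<le> 1 / real (Suc N)" using lim[of i] lim[of j] unfolding \<delta>_def by argo
    note sm = small[OF this]
    note gap = convexity_gap_integral_le[OF X[of i] X[of j] min, folded \<delta>_def]
    have dR: "d * (a + b) \<le> e / 2" if "a \<le> R" "b \<le> R" for a b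
    proof -
      have "d * (a + b) \<le> d * (R + R)" using that d by (intro mult_left_mono) auto
      also have "\<dots> = e / 2" using R by (simp add: d_def field_simps)
      finally show ?thesis .
    qed
    have "C * (\<integral>x. convexity_gap (p1 x) (G i x) (G j x) \<partial>M) \<le> C * (m * \<delta>)"
      "C * (\<integral>x. convexity_gap (p2 x) (G i x) (G j x) \<partial>M) \<le> C * (m * \<delta>)"
      using gap C(1) by (auto intro: mult_left_mono)
    then show ?thesis
      using C(2,3)[OF X[of i] X[of j]] dR[OF \<rho>R(1)[of i] \<rho>R(1)[of j]] dR[OF \<rho>R(2)[of i] \<rho>R(2)[of j]] sm by linarith
  qed
  then show ?thesis by blast
qed

text \<open>Fatou's lemma for the nonnegative energy densities.\<close>

lemma energy_lower_semicontinuous: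
  assumes X: "X u g" "\<And>n. X (U n) (G n)" and AE: "AE x in M. (\<lambda>n. G n x) \<longlonglongrightarrow> g x"
    and lim: "(\<lambda>n. energy (G n)) \<longlonglongrightarrow> c"
  shows "energy g \<le> c"
proof -
  let ?D = "\<lambda>g x. norm (g x) powr p1 x / p1 x + norm (g x) powr p2 x / p2 x"
  have Dnn: "0 \<le> ?D g x" if "x \<in> \<Omega>" for g :: "'a \<Rightarrow> 'a" and x using p_bounds[OF that] by simp
  have en: "ennreal (energy g) = (\<integral>\<^sup>+x. ennreal (?D g x) \<partial>M)" if "X u g" for u g
    unfolding energy_def by (rule nn_integral_eq_integral[symmetric, OF energy_integrable[OF that]]) (use Dnn in auto)
  note [measurable] = X_measurable[OF X(1)] X_measurable[OF X(2)]
  have "c \<ge> 0" by (rule LIMSEQ_le_const[OF lim]) (use energy_nonneg in auto)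
  have "ennreal (energy g) = (\<integral>\<^sup>+x. liminf (\<lambda>n. ennreal (?D (G n) x)) \<partial>M)"
    unfolding en[OF X(1)]
  proof (rule nn_integral_cong_AE)
    show "AE x in M. ennreal (?D g x) = liminf (\<lambda>n. ennreal (?D (G n) x))"
      using AE AE_space
    proof eventually_elim
      case (elim x)
      then have b: "1 < p1 x" "1 < p2 x" using p_bounds by auto
      then have "(\<lambda>n. ennreal (?D (G n) x)) \<longlonglongrightarrow> ennreal (?D g x)"
        using elim by (intro tendsto_ennrealI tendsto_add tendsto_divide tendsto_powr2 tendsto_norm tendsto_const) auto
      then show ?case by (intro lim_imp_Liminf[symmetric]) auto
    qed
  qed
  also have "\<dots> \<le> liminf (\<lambda>n. \<integral>\<^sup>+x. ennreal (?D (G n) x) \<partial>M)"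
    by (rule nn_integral_liminf) measurable
  also have "\<dots> = liminf (\<lambda>n. ennreal (energy (G n)))" using en[OF X(2)] by simp
  also have "\<dots> = ennreal c" using lim by (intro lim_imp_Liminf tendsto_ennrealI) auto
  finally show ?thesis using \<open>c \<ge> 0\<close> by (simp add: ennreal_le_iff)
qed

text \<open>The functions and their gradients converge strongly for both modulars, so the limit
  stays in \<open>X\<close> and the loads converge; only lower semicontinuity is asked of the
  energy.\<close>

lemma minimizer_exists:
  obtains u g where "X u g" "\<And>v h. X v h \<Longrightarrow> energy g - load u \<le> energy h - load v"
proof -
  define S where "S = {energy g - load u | u g. X u g}"
  define \<mu> where "\<mu> = Inf S"
  obtain K where K: "\<And>u g. X u g \<Longrightarrow> energy g \<le> 2 * (energy g - load u) + K" using coercive by blast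
  have bdd: "bdd_below S"
  proof (rule bdd_belowI[of _ "- K / 2"])
    fix z assume "z \<in> S"
    then obtain u g where "X u g" "z = energy g - load u" by (auto simp: S_def)
    with K[of u g] energy_nonneg[of g] show "- K / 2 \<le> z" by simp
  qed
  have "S \<noteq> {}" using X_0 by (auto simp: S_def)
  have min: "\<mu> \<le> energy g - load u" if "X u g" for u g
    unfolding \<mu>_def using that by (intro cInf_lower bdd) (auto simp: S_def)
  have "\<exists>u g. X u g \<and> energy g - load u < \<mu> + 1 / real (Suc n)" for n
    using cInf_lessD[OF \<open>S \<noteq> {}\<close>, of "\<mu> + 1 / real (Suc n)"] by (auto simp: \<mu>_def S_def)
  then obtain U G where UG: "\<And>n. X (U n) (G n)" "\<And>n. energy (G n) - load (U n) < \<mu> + 1 / real (Suc n)" by metis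
  have W: "W0_grad \<Omega> p1 (U n) (G n)" "W0_grad \<Omega> p2 (U n) (G n)" for n using UG(1) by (auto simp: X_def)
  note [measurable] = X_measurable[OF UG(1)]
  have GC: "\<exists>N. \<forall>i\<ge>N. \<forall>j\<ge>N. modular \<Omega> p1 (\<lambda>x. norm (G i x - G j x)) \<le> ennreal e"
    "\<exists>N. \<forall>i\<ge>N. \<forall>j\<ge>N. modular \<Omega> p2 (\<lambda>x. norm (G i x - G j x)) \<le> ennreal e" if e: "e > 0" for e
  proof -
    obtain N where N: "\<forall>i\<ge>N. \<forall>j\<ge>N. \<rho> p1 (\<lambda>x. G i x - G j x) \<le> e \<and> \<rho> p2 (\<lambda>x. G i x - G j x) \<le> e"
      using minimizing_sequence_Cauchy[OF UG(1) min UG(2) e] by blast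
    have "modular \<Omega> p1 (\<lambda>x. norm (G i x - G j x)) \<le> ennreal e \<and> modular \<Omega> p2 (\<lambda>x. norm (G i x - G j x)) \<le> ennreal e"
      if "i \<ge> N" "j \<ge> N" for i j
      using N that X_integrable(3,4)[OF X_diff[OF UG(1)[of i] UG(1)[of j]]] by (simp add: ennreal_leI)
    then show "\<exists>N. \<forall>i\<ge>N. \<forall>j\<ge>N. modular \<Omega> p1 (\<lambda>x. norm (G i x - G j x)) \<le> ennreal e"
      "\<exists>N. \<forall>i\<ge>N. \<forall>j\<ge>N. modular \<Omega> p2 (\<lambda>x. norm (G i x - G j x)) \<le> ennreal e" by blast+
  qed
  \<comment> \<open>The Cauchy property passes from gradients to functions by the Poincare
    inequality, applied to differences and to each exponent separately.\<close>
  have UC: "\<exists>N. \<forall>i\<ge>N. \<forall>j\<ge>N. modular \<Omega> p1 (\<lambda>x. norm (U i x - U j x)) \<le> ennreal e"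
    "\<exists>N. \<forall>i\<ge>N. \<forall>j\<ge>N. modular \<Omega> p2 (\<lambda>x. norm (U i x - U j x)) \<le> ennreal e" if e: "e > 0" for e
  proof -
    have Xd: "W0_grad \<Omega> p1 (\<lambda>x. U i x - U j x) (\<lambda>x. G i x - G j x)" "W0_grad \<Omega> p2 (\<lambda>x. U i x - U j x) (\<lambda>x. G i x - G j x)" for i j
      using X_diff[OF UG(1)[of i] UG(1)[of j]] by (auto simp: X_def)
    have abs: "modular \<Omega> p (\<lambda>x. norm (v x)) = modular \<Omega> p v" for p v :: "'a \<Rightarrow> real" by (simp add: modular_def)
    obtain d1 where d1: "d1 > 0" "\<And>u g. W0_grad \<Omega> p1 u g \<Longrightarrow> modular \<Omega> p1 (\<lambda>x. norm (g x)) \<le> ennreal d1 \<Longrightarrow> modular \<Omega> p1 u \<le> ennreal e"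
      using modular_poincare_small[OF ne Cp(1) p1 e] by blast
    obtain d2 where d2: "d2 > 0" "\<And>u g. W0_grad \<Omega> p2 u g \<Longrightarrow> modular \<Omega> p2 (\<lambda>x. norm (g x)) \<le> ennreal d2 \<Longrightarrow> modular \<Omega> p2 u \<le> ennreal e"
      using modular_poincare_small[OF ne Cp(2) p2 e] by blast
    show "\<exists>N. \<forall>i\<ge>N. \<forall>j\<ge>N. modular \<Omega> p1 (\<lambda>x. norm (U i x - U j x)) \<le> ennreal e"
      unfolding abs using GC(1)[OF d1(1)] d1(2)[OF Xd(1)] by blast
    show "\<exists>N. \<forall>i\<ge>N. \<forall>j\<ge>N. modular \<Omega> p2 (\<lambda>x. norm (U i x - U j x)) \<le> ennreal e"
      unfolding abs using GC(2)[OF d2(1)] d2(2)[OF Xd(2)] by blast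
  qed
  \<comment> \<open>Both exponents go into one application, so the limit is common to them.\<close>
  obtain g r where g[measurable]: "g \<in> borel_measurable M" and r: "strict_mono r" "AE x in M. (\<lambda>k. G (r k) x) \<longlonglongrightarrow> g x"
    and Glim: "(\<lambda>n. modular \<Omega> p1 (\<lambda>x. norm (G n x - g x))) \<longlonglongrightarrow> 0" "(\<lambda>n. modular \<Omega> p2 (\<lambda>x. norm (G n x - g x))) \<longlonglongrightarrow> 0"
    using modular_complete[OF p1 p2 X_measurable(2)[OF UG(1)] W0_gradD(5)[OF W(1)] GC] by blast
  have "(\<lambda>x. norm (U n x)) \<in> Lp_var \<Omega> p1" for n
    using W0_gradD(4)[OF W(1)[of n]] by (simp add: Lp_var_def modular_def)
  then obtain u where u[measurable]: "u \<in> borel_measurable M"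
    and Ulim: "(\<lambda>n. modular \<Omega> p1 (\<lambda>x. norm (U n x - u x))) \<longlonglongrightarrow> 0" "(\<lambda>n. modular \<Omega> p2 (\<lambda>x. norm (U n x - u x))) \<longlonglongrightarrow> 0"
    using modular_complete[OF p1 p2 X_measurable(1)[OF UG(1)] _ UC] by blast
  have Xu: "X u g" unfolding X_def
    using W0_grad_limit[OF p1 W(1) u g _ Glim(1)] W0_grad_limit[OF p2 W(2) u g _ Glim(2)] Ulim
    by (simp add: modular_def)
  note Xd = X_diff[OF UG(1) Xu]
  have \<rho>lim: "(\<lambda>n. \<rho> p1 (\<lambda>x. G n x - g x)) \<longlonglongrightarrow> 0" "(\<lambda>n. \<rho> p2 (\<lambda>x. G n x - g x)) \<longlonglongrightarrow> 0"
    using Glim unfolding X_integrable(3,4)[OF Xd]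
    by (auto simp: \<rho>_nonneg tendsto_ennreal_iff[where x=0, simplified])
  have "(\<lambda>n. load (\<lambda>x. U n x - u x)) \<longlonglongrightarrow> 0" by (rule load_tendsto_0[OF Xd \<rho>lim])
  moreover have "load (\<lambda>x. U n x - u x) = load (U n) - load u" for n
    using load_lincomb[OF UG(1) Xu, of 1 n "- 1"] by simp
  ultimately have Llim: "(\<lambda>n. load (U n)) \<longlonglongrightarrow> load u" by (simp add: LIM_zero_iff)
  have Jlim: "(\<lambda>n. energy (G n) - load (U n)) \<longlonglongrightarrow> \<mu>"
  proof (rule tendsto_sandwich[of "\<lambda>_. \<mu>" _ _ "\<lambda>n. \<mu> + 1 / real (Suc n)"])
    show "(\<lambda>n. \<mu> + 1 / real (Suc n)) \<longlonglongrightarrow> \<mu>"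
      using tendsto_add[OF tendsto_const[of \<mu>] LIMSEQ_inverse_real_of_nat] by (simp add: inverse_eq_divide)
    show "(\<lambda>_. \<mu>) \<longlonglongrightarrow> \<mu>" by simp
  qed (use min[OF UG(1)] UG(2) in \<open>auto intro!: always_eventually intro: less_imp_le\<close>)
  from tendsto_add[OF Jlim Llim] have "(\<lambda>n. energy (G n)) \<longlonglongrightarrow> \<mu> + load u" by simp
  \<comment> \<open>Pointwise convergence of the gradients is available only along r.\<close>
  then have "(\<lambda>k. energy (G (r k))) \<longlonglongrightarrow> \<mu> + load u" using r(1) by (rule LIMSEQ_subseq_LIMSEQ[unfolded comp_def])
  then have "energy g \<le> \<mu> + load u" using r(2) by (intro energy_lower_semicontinuous[OF Xu UG(1)])
  then have "energy g - load u \<le> energy h - load v" if "X v h" for v h using min[OF that] by linarith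
  with Xu show ?thesis by (rule that)
qed

end

subsection \<open>Euler--Lagrange equation and uniqueness\<close>

text \<open>The majorant for differentiating under the integral: the mean value estimate yields a
  factor t, which cancels, and what remains does not depend on t.\<close>

lemma norm_line_powr_quotient_le:
  fixes \<xi> \<eta> :: "'a::real_inner"
  assumes p: "1 < p" and t: "0 < t" "t \<le> 1"
  shows "\<bar>(norm (\<xi> + t *\<^sub>R \<eta>) powr p / p - norm \<xi> powr p / p) / t\<bar> \<le> 2 powr p * (norm \<xi> powr p + norm \<eta> powr p)"
proof -
  define c where "c = norm \<xi> + norm \<eta>"
  have t\<eta>: "norm (t *\<^sub>R \<eta>) \<le> norm \<eta>" using t by (simp add: mult_left_le_one_le)
  then have c: "norm (\<xi> + t *\<^sub>R \<eta>) \<le> c" "norm \<xi> \<le> c" "norm \<eta> \<le> c"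
    using norm_triangle_ineq[of \<xi> "t *\<^sub>R \<eta>"] by (auto simp: c_def)
  have "\<bar>norm (\<xi> + t *\<^sub>R \<eta>) powr p - norm \<xi> powr p\<bar> \<le> p * c powr (p - 1) * \<bar>norm (\<xi> + t *\<^sub>R \<eta>) - norm \<xi>\<bar>"
    using c by (intro powr_diff_le p) auto
  also have "\<dots> \<le> p * c powr (p - 1) * (t * c)"
  proof (rule mult_left_mono)
    have "\<bar>norm (\<xi> + t *\<^sub>R \<eta>) - norm \<xi>\<bar> \<le> norm (\<xi> + t *\<^sub>R \<eta> - \<xi>)" by (rule norm_triangle_ineq3)
    also have "\<dots> = t * norm \<eta>" using t by simp
    also have "\<dots> \<le> t * c" using t c by (intro mult_left_mono) auto
    finally show "\<bar>norm (\<xi> + t *\<^sub>R \<eta>) - norm \<xi>\<bar> \<le> t * c" .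
  qed (use p in auto)
  also have "\<dots> = p * t * c powr p"
    using powr_add[of c "p - 1" 1] by (cases "c = 0") (auto simp: c_def mult_ac)
  finally have "\<bar>norm (\<xi> + t *\<^sub>R \<eta>) powr p - norm \<xi> powr p\<bar> \<le> p * t * c powr p" .
  moreover have "\<bar>(norm (\<xi> + t *\<^sub>R \<eta>) powr p / p - norm \<xi> powr p / p) / t\<bar> = \<bar>norm (\<xi> + t *\<^sub>R \<eta>) powr p - norm \<xi> powr p\<bar> / (p * t)"
    using p t by (simp add: abs_mult divide_simps flip: diff_divide_distrib)
  ultimately have "\<bar>(norm (\<xi> + t *\<^sub>R \<eta>) powr p / p - norm \<xi> powr p / p) / t\<bar> \<le> c powr p"
    using p t by (simp add: divide_le_eq mult.commute)
  also have "\<dots> \<le> 2 powr p * (norm \<xi> powr p + norm \<eta> powr p)"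
    unfolding c_def using p by (intro powr_add_le) auto
  finally show ?thesis .
qed

text \<open>With a, b the norms, Cauchy-Schwarz gives I >= (a^(p-1) - b^(p-1)) (a - b) >= 0. If I =
  0 then a = b, and for a > 0 the pairing equals a^(p-2) |\<xi> - \<eta>|^2.\<close>

lemma powr_minus2_monotone:
  fixes \<xi> \<eta> :: "'a::real_inner"
  assumes p: "1 < p"
  defines "I \<equiv> norm \<xi> powr (p - 2) * (\<xi> \<bullet> (\<xi> - \<eta>)) - norm \<eta> powr (p - 2) * (\<eta> \<bullet> (\<xi> - \<eta>))"
  shows "I \<ge> 0" "I = 0 \<Longrightarrow> \<xi> = \<eta>"
proof -
  define a b where "a = norm \<xi>" and "b = norm \<eta>"
  have ab: "a \<ge> 0" "b \<ge> 0" by (auto simp: a_def b_def)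
  have split: "x powr p = x powr (p - 1) * x" if "x \<ge> 0" for x :: real
    using that powr_add[of x "p - 1" 1] by (cases "x = 0") auto
  have I: "I = a powr p + b powr p - norm \<xi> powr (p - 2) * (\<xi> \<bullet> \<eta>) - norm \<eta> powr (p - 2) * (\<eta> \<bullet> \<xi>)"
    unfolding I_def a_def b_def inner_diff_right right_diff_distrib norm_powr_minus2 by simp
  have le: "norm \<xi> powr (p - 2) * (\<xi> \<bullet> \<eta>) \<le> a powr (p - 1) * b" "norm \<eta> powr (p - 2) * (\<eta> \<bullet> \<xi>) \<le> b powr (p - 1) * a"
    using abs_norm_powr_minus2_inner_le[of \<xi> p \<eta>] abs_norm_powr_minus2_inner_le[of \<eta> p \<xi>] by (auto simp: a_def b_def)
  have prod: "a powr p + b powr p - a powr (p - 1) * b - b powr (p - 1) * a = (a powr (p - 1) - b powr (p - 1)) * (a - b)"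
    using split[OF ab(1)] split[OF ab(2)] by (simp add: algebra_simps)
  have mono: "(a powr (p - 1) - b powr (p - 1)) * (a - b) \<ge> 0" "a \<noteq> b \<Longrightarrow> (a powr (p - 1) - b powr (p - 1)) * (a - b) > 0"
    using powr_less_mono2[of "p - 1" a b] powr_less_mono2[of "p - 1" b a] p ab
    by (cases a b rule: linorder_cases; auto simp: mult_neg_neg less_imp_le)+
  show "I \<ge> 0" using I le prod mono(1) by linarith
  assume "I = 0"
  then have eq: "a = b" using I le prod mono(2) by linarith
  show "\<xi> = \<eta>"
  proof (cases "a = 0")
    case True then show ?thesis using eq by (simp add: a_def b_def)
  next
    case False
    then have apos: "a powr (p - 2) > 0" using ab by simp
    have "a powr p = a powr (p - 2) * (\<xi> \<bullet> \<xi>)" unfolding a_def by (rule norm_powr_minus2[symmetric])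
    moreover have "b powr p = a powr (p - 2) * (\<eta> \<bullet> \<eta>)" unfolding eq unfolding b_def by (rule norm_powr_minus2[symmetric])
    moreover have "norm \<xi> = a" "norm \<eta> = a" using eq by (auto simp: a_def b_def)
    ultimately have "I = a powr (p - 2) * ((\<xi> - \<eta>) \<bullet> (\<xi> - \<eta>))"
      unfolding I by (simp add: inner_diff_left inner_diff_right algebra_simps)
    with \<open>I = 0\<close> apos show ?thesis by simp
  qed
qed

context pq_problem
begin

lemma flux_integrable:
  assumes X: "X u g" "X v h"
  shows "integrable M (\<lambda>x. norm (g x) powr (p1 x - 2) * (g x \<bullet> h x))" "integrable M (\<lambda>x. norm (g x) powr (p2 x - 2) * (g x \<bullet> h x))"
proof -
  note [measurable] = X_measurable[OF X(1)] X_measurable[OF X(2)]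
  have le: "norm (norm (g x) powr (p x - 2) * (g x \<bullet> h x)) \<le> norm (norm (g x) powr p x + norm (h x) powr p x)" if "1 < p x" for p :: "'a \<Rightarrow> real" and x
    using abs_norm_powr_minus2_inner_le[of "g x" "p x" "h x"] powr_minus1_mult_le[OF that, of "norm (g x)" "norm (h x)"] by simp
  show "integrable M (\<lambda>x. norm (g x) powr (p1 x - 2) * (g x \<bullet> h x))"
    by (rule Bochner_Integration.integrable_bound[OF Bochner_Integration.integrable_add[OF X_integrable(1)[OF X(1)] X_integrable(1)[OF X(2)]]])
      (auto intro!: AE_I2 le p_bounds(5) simp del: real_norm_def)
  show "integrable M (\<lambda>x. norm (g x) powr (p2 x - 2) * (g x \<bullet> h x))"
    by (rule Bochner_Integration.integrable_bound[OF Bochner_Integration.integrable_add[OF X_integrable(2)[OF X(1)] X_integrable(2)[OF X(2)]]])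
      (auto intro!: AE_I2 le p_bounds(6) simp del: real_norm_def)
qed

definition flux :: "('a \<Rightarrow> 'a) \<Rightarrow> ('a \<Rightarrow> 'a) \<Rightarrow> real" where
  "flux g h = (\<integral>x. norm (g x) powr (p1 x - 2) * (g x \<bullet> h x) \<partial>M) + (\<integral>x. norm (g x) powr (p2 x - 2) * (g x \<bullet> h x) \<partial>M)"

text \<open>Dominated convergence along t = 1/(n+1); the constant 2^(p x) of the pointwise majorant
  is replaced by 2^m.\<close>

lemma energy_difference_quotient_tendsto:
  assumes X: "X u g" "X v h"
  shows "(\<lambda>n. (energy (\<lambda>x. g x + inverse (real (Suc n)) *\<^sub>R h x) - energy g) / inverse (real (Suc n))) \<longlonglongrightarrow> flux g h"
proof -
  let ?t = "\<lambda>n. inverse (real (Suc n))"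
  let ?q = "\<lambda>p n x. (norm (g x + ?t n *\<^sub>R h x) powr p x / p x - norm (g x) powr p x / p x) / ?t n"
  let ?d = "\<lambda>p x. norm (g x) powr (p x - 2) * (g x \<bullet> h x)"
  note [measurable] = X_measurable[OF X(1)] X_measurable[OF X(2)]
  have t: "0 < ?t n" "?t n \<le> 1" for n by (auto simp: inverse_le_1_iff)
  have Xn: "X (\<lambda>x. 1 * u x + ?t n * v x) (\<lambda>x. 1 *\<^sub>R g x + ?t n *\<^sub>R h x)" for n by (rule X_lincomb[OF X])
  have tlim: "filterlim ?t (at 0) sequentially"
    unfolding filterlim_at using LIMSEQ_inverse_real_of_nat by (auto simp: eventually_sequentially)
  have ptw: "(\<lambda>n. ?q p n x) \<longlonglongrightarrow> ?d p x" if "1 < p x" for p x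
  proof -
    have "((\<lambda>t. (norm (g x + t *\<^sub>R h x) powr p x / p x - norm (g x) powr p x / p x) / t) \<longlongrightarrow> ?d p x) (at 0)"
      using norm_line_powr_has_real_derivative[OF that, of "g x" "h x"] by (simp add: DERIV_def)
    then show ?thesis using tlim by (rule filterlim_compose)
  qed
  define w where "w x = 2 powr m * (norm (g x) powr p1 x + norm (h x) powr p1 x) + 2 powr m * (norm (g x) powr p2 x + norm (h x) powr p2 x)" for x
  have w: "integrable M w" unfolding w_def
    using X_integrable(1,2)[OF X(1)] X_integrable(1,2)[OF X(2)] by auto
  have bnd: "\<bar>?q p n x\<bar> \<le> 2 powr m * (norm (g x) powr p x + norm (h x) powr p x)" if "1 < p x" "p x \<le> m" for p n x
  proof -
    have "\<bar>?q p n x\<bar> \<le> 2 powr p x * (norm (g x) powr p x + norm (h x) powr p x)"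
      by (rule norm_line_powr_quotient_le[OF that(1) t])
    also have "\<dots> \<le> 2 powr m * (norm (g x) powr p x + norm (h x) powr p x)"
      using that by (intro mult_right_mono powr_mono) auto
    finally show ?thesis .
  qed
  have "(\<lambda>n. \<integral>x. ?q p1 n x + ?q p2 n x \<partial>M) \<longlonglongrightarrow> (\<integral>x. ?d p1 x + ?d p2 x \<partial>M)"
  proof (rule integral_dominated_convergence[OF _ _ w])
    show "AE x in M. (\<lambda>n. ?q p1 n x + ?q p2 n x) \<longlonglongrightarrow> ?d p1 x + ?d p2 x"
      by (intro AE_I2 tendsto_add ptw) (auto simp: p_bounds)
    show "AE x in M. norm (?q p1 n x + ?q p2 n x) \<le> w x" for n
    proof (rule AE_I2)
      fix x assume "x \<in> space M"
      then have x: "x \<in> \<Omega>" by simp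
      have "norm (?q p1 n x + ?q p2 n x) \<le> \<bar>?q p1 n x\<bar> + \<bar>?q p2 n x\<bar>" unfolding real_norm_def by (rule abs_triangle_ineq)
      also have "\<dots> \<le> w x" unfolding w_def using p_bounds[OF x] by (intro add_mono bnd)
      finally show "norm (?q p1 n x + ?q p2 n x) \<le> w x" .
    qed
  qed measurable
  moreover have "(\<integral>x. ?d p1 x + ?d p2 x \<partial>M) = flux g h"
    unfolding flux_def using flux_integrable[OF X] by (rule Bochner_Integration.integral_add)
  moreover have "(\<integral>x. ?q p1 n x + ?q p2 n x \<partial>M) = (energy (\<lambda>x. g x + ?t n *\<^sub>R h x) - energy g) / ?t n" for n
  proof -
    let ?D = "\<lambda>g x. norm (g x) powr p1 x / p1 x + norm (g x) powr p2 x / p2 x"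
    have "(\<integral>x. ?q p1 n x + ?q p2 n x \<partial>M) = (\<integral>x. (?D (\<lambda>x. g x + ?t n *\<^sub>R h x) x - ?D g x) / ?t n \<partial>M)"
      by (rule Bochner_Integration.integral_cong) (simp_all add: diff_divide_distrib add_divide_distrib del: of_nat_Suc)
    also have "\<dots> = (\<integral>x. ?D (\<lambda>x. g x + ?t n *\<^sub>R h x) x - ?D g x \<partial>M) / ?t n"
      by (rule integral_divide_zero)
    also have "(\<integral>x. ?D (\<lambda>x. g x + ?t n *\<^sub>R h x) x - ?D g x \<partial>M) = energy (\<lambda>x. g x + ?t n *\<^sub>R h x) - energy g"
      unfolding energy_def using energy_integrable[OF X(1)] energy_integrable[OF Xn[of n]]
      by (intro Bochner_Integration.integral_diff) (simp_all del: of_nat_Suc)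
    finally show ?thesis .
  qed
  ultimately show ?thesis by simp
qed

text \<open>Positive increments alone give load <= flux; replacing v by -v reverses the
  inequality.\<close>

lemma euler_lagrange:
  assumes X: "X u g" and min: "\<And>v h. X v h \<Longrightarrow> energy g - load u \<le> energy h - load v" and Xv: "X v h"
  shows "flux g h = load v"
proof -
  have le: "load v \<le> flux g h" if Xv: "X v h" for v h
  proof (rule LIMSEQ_le_const[OF energy_difference_quotient_tendsto[OF X Xv]], intro exI allI impI)
    fix n
    let ?t = "inverse (real (Suc n))"
    have "energy g - load u \<le> energy (\<lambda>x. 1 *\<^sub>R g x + ?t *\<^sub>R h x) - load (\<lambda>x. 1 * u x + ?t * v x)"
      by (rule min[OF X_lincomb[OF X Xv]])
    then have "?t * load v \<le> energy (\<lambda>x. g x + ?t *\<^sub>R h x) - energy g"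
      unfolding load_lincomb[OF X Xv] by simp
    then show "load v \<le> (energy (\<lambda>x. g x + ?t *\<^sub>R h x) - energy g) / ?t"
      by (subst pos_le_divide_eq) (simp_all add: mult.commute del: of_nat_Suc)
  qed
  have "load (\<lambda>x. (- 1) * v x) \<le> flux g (\<lambda>x. (- 1) *\<^sub>R h x)" by (rule le[OF X_scale[OF Xv]])
  then have "flux g h \<le> load v" unfolding load_scale by (simp add: flux_def)
  with le[OF Xv] show ?thesis by simp
qed

section \<open>Existence and uniqueness of the weak solution\<close>

lemma weak_solution_iff:
  "weak_solution \<Omega> p1 p2 f u \<longleftrightarrow> (\<exists>g. X u g \<and> (\<forall>v h. X v h \<longrightarrow> flux g h = load v))"
  unfolding weak_solution_def X_iff flux_def load_def by auto

lemma weak_solution_exists: "\<exists>u. weak_solution \<Omega> p1 p2 f u"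
proof -
  obtain u g where ug: "X u g" "\<And>v h. X v h \<Longrightarrow> energy g - load u \<le> energy h - load v"
    using minimizer_exists by blast
  show ?thesis unfolding weak_solution_iff using ug(1) euler_lagrange[OF ug] by blast
qed

text \<open>A vanishing gradient has vanishing potential, which dominates u.\<close>

lemma X_grad_AE_0_imp_AE_0:
  assumes X: "X u g" and g: "AE x in M. g x = 0"
  shows "AE x in M. u x = 0"
proof -
  have "potential g x = 0" for x
  proof -
    have "potential g x = (\<integral>\<^sup>+y. 0 \<partial>M)" unfolding potential_def using g by (intro nn_integral_cong_AE) auto
    then show ?thesis by simp
  qed
  moreover have "AE x in M. ennreal (annulus_vol TYPE('a)) * ennreal \<bar>u x\<bar> \<le> potential g x"
    using X by (intro W0_grad_le_potential[OF p1]) (simp add: X_def)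
  ultimately have "AE x in M. ennreal (annulus_vol TYPE('a)) * ennreal \<bar>u x\<bar> \<le> 0" by simp
  then show ?thesis
  proof eventually_elim
    case (elim x)
    then show ?case using emeasure_annulus(2)[where 'a='a] by (auto simp: ennreal_eq_0_iff)
  qed
qed

text \<open>Both equations are tested with u - w. The difference is the integral of two nonnegative
  monotonicity terms, so both vanish almost everywhere and the gradients agree.\<close>

lemma weak_solution_unique:
  assumes "weak_solution \<Omega> p1 p2 f u" "weak_solution \<Omega> p1 p2 f w"
  shows "AE x in M. w x = u x"
proof -
  obtain g where g: "X u g" "\<And>v h. X v h \<Longrightarrow> flux g h = load v" using assms(1) by (auto simp: weak_solution_iff)
  obtain h where h: "X w h" "\<And>v k. X v k \<Longrightarrow> flux h k = load v" using assms(2) by (auto simp: weak_solution_iff)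
  note Xd = X_diff[OF g(1) h(1)]
  let ?I = "\<lambda>p x. norm (g x) powr (p x - 2) * (g x \<bullet> (g x - h x)) - norm (h x) powr (p x - 2) * (h x \<bullet> (g x - h x))"
  note i = flux_integrable[OF g(1) Xd] flux_integrable[OF h(1) Xd]
  have nonneg: "0 \<le> ?I p1 x" "0 \<le> ?I p2 x" if "x \<in> \<Omega>" for x
    using powr_minus2_monotone(1)[OF p_bounds(5)[OF that]] powr_minus2_monotone(1)[OF p_bounds(6)[OF that]] by auto
  have int: "integrable M (\<lambda>x. ?I p1 x + ?I p2 x)" using i by auto
  have "(\<integral>x. ?I p1 x + ?I p2 x \<partial>M) = flux g (\<lambda>x. g x - h x) - flux h (\<lambda>x. g x - h x)"
    unfolding flux_def using i by simp
  also have "\<dots> = 0" using g(2)[OF Xd] h(2)[OF Xd] by simp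
  finally have "AE x in M. ?I p1 x + ?I p2 x = 0"
    using nonneg by (subst (asm) integral_nonneg_eq_0_iff_AE[OF int]) (auto intro!: AE_I2 add_nonneg_nonneg)
  then have "AE x in M. g x - h x = 0"
    using AE_space
  proof eventually_elim
    case (elim x)
    then have x: "x \<in> \<Omega>" by simp
    then have "?I p1 x = 0" using elim(1) nonneg[OF x] by linarith
    then show ?case using powr_minus2_monotone(2)[OF p_bounds(5)[OF x]] by auto
  qed
  from X_grad_AE_0_imp_AE_0[OF Xd this] show ?thesis by eventually_elim simp
qed

end

text \<open>If p_M < N, the reciprocal of the critical exponent is 1/p_M - 1/N and the hypothesis is
  only rearranged. If p_M >= N, then 1/p_M <= 1/N and 1/\<alpha> < 1.\<close>

lemma subcritical_exponent:
  fixes p1 p2 \<alpha> :: "'a::euclidean_space \<Rightarrow> real"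
  assumes "1 / ereal (\<alpha> x) + 1 / crit_exp (\<lambda>y. max (p1 y) (p2 y)) x < 1" "1 < p1 x" "1 < p2 x" "1 < \<alpha> x"
  shows "1 / \<alpha> x + 1 / max (p1 x) (p2 x) < 1 + 1 / real DIM('a)"
proof -
  define q where "q = max (p1 x) (p2 x)"
  have q: "q > 1" using assms by (auto simp: q_def)
  have N: "real DIM('a) > 0" by simp
  have \<alpha>: "1 / ereal (\<alpha> x) = ereal (1 / \<alpha> x)" using assms by (simp add: one_ereal_def)
  show ?thesis
  proof (cases "q < real DIM('a)")
    case True
    then have "1 / crit_exp (\<lambda>y. max (p1 y) (p2 y)) x = ereal (1 / (real DIM('a) * q / (real DIM('a) - q)))"
      using q by (simp add: crit_exp_def one_ereal_def flip: q_def)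
    then have "1 / \<alpha> x + 1 / (real DIM('a) * q / (real DIM('a) - q)) < 1"
      using assms(1) unfolding \<alpha> by (simp add: one_ereal_def)
    moreover have "1 / (real DIM('a) * q / (real DIM('a) - q)) = 1 / q - 1 / real DIM('a)"
      using True q N by (simp add: field_simps)
    ultimately show ?thesis unfolding q_def[symmetric] by linarith
  next
    case False
    then have "1 / q \<le> 1 / real DIM('a)" by (intro frac_le) (use N in auto)
    moreover have "1 / \<alpha> x < 1" using assms by simp
    ultimately show ?thesis unfolding q_def[symmetric] by linarith
  qed
qed

theorem theorem3p2:
  fixes \<Omega> :: "'a::euclidean_space set" and p1 p2 \<alpha> f :: "'a \<Rightarrow> real"
  assumes "smooth_bounded_domain \<Omega>"
    and "C_plus \<Omega> p1" and "C_plus \<Omega> p2"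
    and "C_plus \<Omega> \<alpha>"
    and "\<forall>x\<in>closure \<Omega>. 1 / ereal (\<alpha> x) + 1 / crit_exp (\<lambda>y. max (p1 y) (p2 y)) x < 1"
    and "f \<in> Lp_var \<Omega> \<alpha>"
  shows "\<exists>u. weak_solution \<Omega> p1 p2 f u \<and>
           (\<forall>w. weak_solution \<Omega> p1 p2 f w \<longrightarrow> (AE x in lebesgue_on \<Omega>. w x = u x))"
proof -
  have dom: "open \<Omega>" "bounded \<Omega>" "\<Omega> \<noteq> {}" using assms(1) by (auto simp: smooth_bounded_domain_def)
  obtain l1 m1 where e1: "bdd_exponent \<Omega> p1 l1 m1" using C_plus_bdd_exponent[OF assms(2) dom(2,1,3)] .
  obtain l2 m2 where e2: "bdd_exponent \<Omega> p2 l2 m2" using C_plus_bdd_exponent[OF assms(3) dom(2,1,3)] .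
  \<comment> \<open>The minimum and maximum provide one pair of bounds valid for both
    exponents.\<close>
  interpret pq_problem \<Omega> p1 p2 \<alpha> f "min l1 l2" "max m1 m2"
  proof
    show "bdd_exponent \<Omega> p1 (min l1 l2) (max m1 m2)" "bdd_exponent \<Omega> p2 (min l1 l2) (max m1 m2)"
      using e1 e2 by (auto simp: bdd_exponent_def min_def max_def)
    show "1 / \<alpha> x + 1 / max (p1 x) (p2 x) < 1 + 1 / real DIM('a)" if "x \<in> closure \<Omega>" for x
      using assms(2-5) that by (intro subcritical_exponent) (auto simp: C_plus_def)
  qed (use dom assms in auto)
  obtain u where "weak_solution \<Omega> p1 p2 f u" using weak_solution_exists by blast
  with weak_solution_unique show ?thesis by blast
qed

end
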